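(* (1) The endomorphisms of a compact abelian group $A$ that are extensible in the category of compact abelian groups (that is, extensible along every morphism from $A$ into a compact abelian group) are precisely the scaling operators by integers, i.e. the maps $a\mapsto na$ for $n\in\mathbb{Z}$. (2) If the compact abelian group $A$ is not profinite, the scaling operators by integers are also precisely the endomorphisms of $A$ that are extensible along all morphisms from $A$ into finite-dimensional tori. (3) If the compact abelian group $A$ is profinite, the endomorphisms of $A$ that are extensible along all morphisms from $A$ into finite-dimensional tori are precisely the scaling operators by profinite integers, i.e. by elements $n$ of the profinite completion $\widehat{\mathbb{Z}}$ of $(\mathbb{Z},+)$.
   Context: Compact groups are Hausdorff, and all morphisms (in particular endomorphisms) are continuous group homomorphisms. An endomorphism $\varphi$ of a compact abelian group $A$ is extensible along a morphism $\theta:A\to B$ of compact abelian groups if there is an endomorphism $\varphi':B\to B$ with $\varphi'\circ\theta=\theta\circ\varphi$. A finite-dimensional torus is a group $(\mathbb{S}^1)^d$, $d\in\mathbb{Z}_{\ge 0}$. A compact group is profinite if it is an inverse limit of finite groups, equivalently if it is totally disconnected; thus a compact abelian group is non-profinite exactly when its identity component is non-trivial. $\widehat{\mathbb{Z}}=\varprojlim_n\mathbb{Z}/n$ (with $n\in\mathbb{Z}_{>0}$ ordered by divisibility) is the ring of profinite integers. Every profinite abelian group $A$ is a module over $\widehat{\mathbb{Z}}$, extending the usual $\mathbb{Z}$-module structure: on each finite quotient $F$ of $A$, $\widehat{\mathbb{Z}}$ acts through its quotient $\mathbb{Z}/|F|$, and one passes to the inverse limit. Scaling by $n\in\widehat{\mathbb{Z}}$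 refers to this action. *)

theory Defs
  imports "HOL-Analysis.Analysis" "HOL-Algebra.Product_Groups"
begin

text \<open>
  Groups are multiplicative records, so the scaling operator by an integer \<open>n\<close> is \<open>a \<mapsto> a [^] n\<close>.
  A compact group is a group together with a topology on its carrier. Functions are only
  constrained on carriers.
\<close>

locale compact_abelian_group = comm_group G
  for G :: "'a monoid" (structure) +
  fixes T :: "'a topology"
  assumes topspace_eq: "topspace T = carrier G"
    and compact: "compact_space T"
    and Hausdorff: "Hausdorff_space T"
    and continuous_mult: "continuous_map (prod_topology T T) T (\<lambda>(x, y). x \<otimes> y)"
    and continuous_inv: "continuous_map T T (\<lambda>x. inv x)"

definition continuous_hom ::
  "'a monoid \<Rightarrow> 'a topology \<Rightarrow> 'b monoid \<Rightarrow> 'b topology \<Rightarrow> ('a \<Rightarrow> 'b) set"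
  where "continuous_hom A S B T = {h \<in> hom A B. continuous_map S T h}"

definition extensible_along ::
  "'a monoid \<Rightarrow> 'b monoid \<Rightarrow> 'b topology \<Rightarrow> ('a \<Rightarrow> 'b) \<Rightarrow> ('a \<Rightarrow> 'a) \<Rightarrow> bool"
  where "extensible_along A B T \<theta> \<phi> \<longleftrightarrow>
    (\<exists>\<phi>' \<in> continuous_hom B T B T. \<forall>a \<in> carrier A. \<phi>' (\<theta> a) = \<theta> (\<phi> a))"

text \<open>
  A single formula cannot quantify over types, so the targets range over all compact abelian
  groups whose carrier is a subset of the type \<open>'b\<close>. Every compact abelian group is a target
  for some \<open>'b\<close>, and \<open>'b\<close> will be an arbitrary type of cardinality at least the continuum.
\<close>

definition extensible_cab :: "'b itself \<Rightarrow> 'a monoid \<Rightarrow> 'a topology \<Rightarrow> ('a \<Rightarrow> 'a) \<Rightarrow> bool"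
  where "extensible_cab _ A S \<phi> \<longleftrightarrow>
    (\<forall>(B :: 'b monoid) T. compact_abelian_group B T \<longrightarrow>
      (\<forall>\<theta> \<in> continuous_hom A S B T. extensible_along A B T \<theta> \<phi>))"

definition circle_group :: "complex monoid"
  where "circle_group = \<lparr>carrier = sphere 0 1, monoid.mult = (*), one = 1\<rparr>"

definition torus :: "nat \<Rightarrow> (nat \<Rightarrow> complex) monoid"
  where "torus d = product_group {..<d} (\<lambda>_. circle_group)"

definition torus_topology :: "nat \<Rightarrow> (nat \<Rightarrow> complex) topology"
  where "torus_topology d = product_topology (\<lambda>_. top_of_set (sphere 0 1)) {..<d}"

definition extensible_tori :: "'a monoid \<Rightarrow> 'a topology \<Rightarrow> ('a \<Rightarrow> 'a) \<Rightarrow> bool"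
  where "extensible_tori A S \<phi> \<longleftrightarrow>
    (\<forall>d. \<forall>\<theta> \<in> continuous_hom A S (torus d) (torus_topology d).
      extensible_along A (torus d) (torus_topology d) \<theta> \<phi>)"

text \<open>
  In an inverse system, \<open>p i j\<close> is the transition map from the group at \<open>j\<close> to the group at
  \<open>i\<close>, for \<open>i\<close> below \<open>j\<close>.
\<close>

locale finite_inverse_system =
  fixes I :: "'i set" and below :: "'i \<Rightarrow> 'i \<Rightarrow> bool"
    and G :: "'i \<Rightarrow> 'g monoid" and p :: "'i \<Rightarrow> 'i \<Rightarrow> 'g \<Rightarrow> 'g"
  assumes nonempty: "I \<noteq> {}"
    and refl: "i \<in> I \<Longrightarrow> below i i"
    and antisym: "\<lbrakk>i \<in> I; j \<in> I; below i j; below j i\<rbrakk> \<Longrightarrow> i = j"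
    and trans: "\<lbrakk>i \<in> I; j \<in> I; k \<in> I; below i j; below j k\<rbrakk> \<Longrightarrow> below i k"
    and directed: "\<lbrakk>i \<in> I; j \<in> I\<rbrakk> \<Longrightarrow> \<exists>k \<in> I. below i k \<and> below j k"
    and groups: "i \<in> I \<Longrightarrow> group (G i)"
    and finite: "i \<in> I \<Longrightarrow> finite (carrier (G i))"
    and transition: "\<lbrakk>i \<in> I; j \<in> I; below i j\<rbrakk> \<Longrightarrow> p i j \<in> hom (G j) (G i)"
    and transition_id: "\<lbrakk>i \<in> I; x \<in> carrier (G i)\<rbrakk> \<Longrightarrow> p i i x = x"
    and transition_comp:
      "\<lbrakk>i \<in> I; j \<in> I; k \<in> I; below i j; below j k; x \<in> carrier (G k)\<rbrakk> \<Longrightarrow> p i j (p j k x) = p i k x"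

definition inverse_limit ::
  "'i set \<Rightarrow> ('i \<Rightarrow> 'i \<Rightarrow> bool) \<Rightarrow> ('i \<Rightarrow> 'g monoid) \<Rightarrow> ('i \<Rightarrow> 'i \<Rightarrow> 'g \<Rightarrow> 'g) \<Rightarrow> ('i \<Rightarrow> 'g) monoid"
  where "inverse_limit I below G p = (product_group I G)
    \<lparr>carrier := {x \<in> carrier (product_group I G).
      \<forall>i \<in> I. \<forall>j \<in> I. below i j \<longrightarrow> p i j (x j) = x i}\<rparr>"

definition inverse_limit_topology ::
  "'i set \<Rightarrow> ('i \<Rightarrow> 'i \<Rightarrow> bool) \<Rightarrow> ('i \<Rightarrow> 'g monoid) \<Rightarrow> ('i \<Rightarrow> 'i \<Rightarrow> 'g \<Rightarrow> 'g) \<Rightarrow> ('i \<Rightarrow> 'g) topology"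
  where "inverse_limit_topology I below G p =
    subtopology (product_topology (\<lambda>i. discrete_topology (carrier (G i))) I)
      (carrier (inverse_limit I below G p))"

text \<open>
  Indices and the elements of the finite groups may be taken in \<open>'a set\<close> without loss of
  generality: a profinite group is the inverse limit of its quotients by open normal subgroups,
  indexed by those subgroups under reverse inclusion.
\<close>

definition profinite :: "'a monoid \<Rightarrow> 'a topology \<Rightarrow> bool"
  where "profinite A S \<longleftrightarrow>
    (\<exists>(I :: 'a set set) below (G :: 'a set \<Rightarrow> 'a set monoid) p h.
      finite_inverse_system I below G p \<and>
      h \<in> iso A (inverse_limit I below G p) \<and>
      homeomorphic_map S (inverse_limit_topology I below G p) h)"

text \<open>
  The inverse limit of the rings of integers modulo \<open>k\<close> for positive \<open>k\<close> under divisibility; the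
  residue class at \<open>k\<close> is given by its representative in \<open>{0..<k}\<close>.
\<close>

definition profinite_integers :: "(nat \<Rightarrow> int) set"
  where "profinite_integers =
    {n \<in> (\<Pi>\<^sub>E k \<in> {0<..}. {0..<int k}). \<forall>j>0. \<forall>k>0. j dvd k \<longrightarrow> n k mod int j = n j}"

text \<open>
  The action of a profinite integer \<open>n\<close> on a profinite abelian group \<open>A\<close>: the image of \<open>a\<close> is the
  unique element whose class in each finite quotient \<open>F = A Mod N\<close>, with \<open>N\<close> an open subgroup, is
  the class of \<open>a\<close> scaled by the component of \<open>n\<close> at the order of \<open>F\<close>.
\<close>

definition profinite_scale ::
  "'a monoid \<Rightarrow> 'a topology \<Rightarrow> (nat \<Rightarrow> int) \<Rightarrow> 'a \<Rightarrow> 'a"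
  where "profinite_scale A S n a =
    (THE b. b \<in> carrier A \<and>
      (\<forall>N. subgroup N A \<and> openin S N \<longrightarrow>
        N #>\<^bsub>A\<^esub> b = (N #>\<^bsub>A\<^esub> a) [^]\<^bsub>A Mod N\<^esub> n (card (carrier (A Mod N)))))"

end

theory Submission
  imports Defs "HOL-Algebra.Multiplicative_Group"
begin

text \<open>
  Extensibility along the characters of \<open>G\<close>, with values in the one-dimensional torus, says that the
  dual of \<open>\<phi>\<close> maps each character to an integral power of itself. An endomorphism of an
  abelian group with this property is a power map as soon as some element has infinite order;
  otherwise the dual is torsion, \<open>G\<close> is profinite, and the exponents fit together to a profinite
  integer. This uses that characters separate points, which is proved without Haar measure. The
  autocorrelation of a function concentrated near \<open>\<one>\<close> is a positive definite state; by
  Krein--Milman some homomorphism to the circle, a priori discontinuous, carries as much energy as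
  this state, and a homomorphism of large energy is continuous.

  A profinite scaling that is extensible along all morphisms still has to be integral. Countably many
  characters map \<open>G\<close> onto a totally disconnected subgroup of the infinite torus. Gluing a point
  of that image to a one-parameter subgroup forces \<open>\<phi>\<close> to send it to one of its integral
  powers. By the Baire category theorem, either the image has a point of infinite order or its
  exponent is finite, so in both cases a single integer serves for all the chosen characters.
\<close>

section \<open>Invariant means\<close>

text \<open>The extreme points of the set of states are characters of the discrete group, and
  nothing in Krein--Milman makes them continuous. Energy is the device that selects a continuous
  one. It is affine in the state, so an extreme point can be found that does at least as well as the
  autocorrelation, and it decreases when lists are convolved, so the conditions for finitely many
  lists follow from the condition for one list and compactness finds a character good for all. To
  separate x0 from the identity, the function is chosen as a difference of a function and its
  translate by x0: for a character trivial at x0 the averages along powers of x0 telescope.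

  In the profinite case every test by characters is passed by all profinite scalings. A genuine
  integer first appears as the winding number of a homomorphism from the line to the circle, which
  is why a line is glued in. Countably many characters suffice, because refuting each of the
  countably many integers takes one character. The target thus stays inside a countable power of the
  circle, which has the cardinality of the continuum; hence the bound on the type of
  targets.\<close>

lemma sum_list_diff_le:
  fixes xs ys :: "real list"
  assumes "length xs = length ys" "\<And>x y. x \<in> set xs \<Longrightarrow> y \<in> set ys \<Longrightarrow> x - y \<le> D"
  shows "sum_list xs - sum_list ys \<le> real (length xs) * D"
  using assms
proof (induction xs ys rule: list_induct2)
  case (Cons x xs y ys)
  have "x - y \<le> D" using Cons.prems by simp
  moreover have "sum_list xs - sum_list ys \<le> real (length xs) * D"
    using Cons.IH Cons.prems by simp
  ultimately show ?case by (simp add: algebra_simps)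
qed simp

lemma sum_list_bound:
  fixes f :: "'b \<Rightarrow> real"
  assumes "\<And>a. a \<in> set L \<Longrightarrow> \<bar>f a\<bar> \<le> D"
  shows "\<bar>\<Sum>a\<leftarrow>L. f a\<bar> \<le> real (length L) * D"
  using assms
proof (induction L)
  case (Cons a L)
  have "\<bar>f a\<bar> \<le> D" "\<bar>\<Sum>a\<leftarrow>L. f a\<bar> \<le> real (length L) * D"
    using Cons by auto
  then show ?case by (simp add: algebra_simps)
qed simp

section \<open>Uniform continuity, finite covers by translates, and averages\<close>

context compact_abelian_group
begin

lemma continuous_map_mult:
  assumes "continuous_map X T f" "continuous_map X T g"
  shows "continuous_map X T (\<lambda>x. f x \<otimes> g x)"
proof -
  have "continuous_map X (prod_topology T T) (\<lambda>x. (f x, g x))"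
    using assms by (simp add: continuous_map_pairedI)
  from continuous_map_compose[OF this continuous_mult]
  show ?thesis by (simp add: o_def)
qed

lemma continuous_translate:
  assumes "a \<in> carrier G"
  shows "continuous_map T T (\<lambda>x. a \<otimes> x)"
  by (rule continuous_map_mult) (use assms in \<open>auto simp: topspace_eq\<close>)

lemma openin_translate:
  assumes a: "a \<in> carrier G" and V: "openin T V"
  shows "openin T ((\<lambda>x. a \<otimes> x) ` V)"
proof -
  have "V \<subseteq> carrier G" using V openin_subset topspace_eq by blast
  then have "(\<lambda>x. a \<otimes> x) ` V = {x \<in> topspace T. inv a \<otimes> x \<in> V}"
  proof (intro subset_antisym subsetI)
    fix x assume "x \<in> {x \<in> topspace T. inv a \<otimes> x \<in> V}"
    then have "x \<in> carrier G" "inv a \<otimes> x \<in> V" by (auto simp: topspace_eq)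
    moreover then have "x = a \<otimes> (inv a \<otimes> x)" using a by (simp flip: m_assoc)
    ultimately show "x \<in> (\<lambda>x. a \<otimes> x) ` V" by blast
  qed (use a \<open>V \<subseteq> carrier G\<close> in \<open>auto simp: topspace_eq subset_eq simp flip: m_assoc\<close>)
  then show ?thesis
    using openin_continuous_map_preimage[OF continuous_translate[of "inv a"] V] a by simp
qed

text \<open>The pairs \<open>(x, v)\<close> at which \<open>f (x \<otimes> v)\<close> is within
  \<open>e\<close> of \<open>f x\<close> form an open set that contains the slice over the identity.
  Since the carrier is compact, the tube lemma fits a product with a neighbourhood \<open>V\<close>
  of the identity into it.\<close>

lemma uniform_continuity:
  fixes f :: "'a \<Rightarrow> 'c::real_normed_vector"
  assumes f: "continuous_map T euclidean f" and e: "e > 0"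
  obtains V where "openin T V" "\<one> \<in> V"
    "\<And>x v. x \<in> carrier G \<Longrightarrow> v \<in> V \<Longrightarrow> norm (f (x \<otimes> v) - f x) < e"
proof -
  let ?d = "\<lambda>p. f (fst p \<otimes> snd p) - f (fst p)"
  let ?W = "{p \<in> topspace (prod_topology T T). ?d p \<in> ball 0 e}"
  have "continuous_map (prod_topology T T) T (\<lambda>p. fst p \<otimes> snd p)"
    using continuous_mult by (simp add: case_prod_unfold)
  then have "continuous_map (prod_topology T T) euclidean ?d"
    by (intro continuous_map_diff continuous_map_compose[OF _ f, unfolded o_def]
        continuous_map_fst)
  then have W: "openin (prod_topology T T) ?W"
    by (rule openin_continuous_map_preimage) (simp flip: open_openin)
  have "\<exists>U V. openin T U \<and> openin T V \<and> topspace T \<subseteq> U \<and> \<one> \<in> V \<and> U \<times> V \<subseteq> ?W"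
    by (rule tube_lemma_left[OF W])
      (use compact e in \<open>auto simp: compact_space_def topspace_eq\<close>)
  then obtain U V where "openin T V" "topspace T \<subseteq> U" "\<one> \<in> V" "U \<times> V \<subseteq> ?W" by blast
  then show thesis
    by (intro that[of V]) (force simp: dist_norm norm_minus_commute topspace_eq[symmetric])+
qed

lemma finite_translates_cover:
  assumes V: "openin T V" "\<one> \<in> V"
  obtains bs where "bs \<noteq> []" "set bs \<subseteq> carrier G"
    "\<And>x. x \<in> carrier G \<Longrightarrow> \<exists>b\<in>set bs. \<exists>v\<in>V. x = b \<otimes> v"
proof -
  let ?U = "(\<lambda>a. (\<lambda>x. a \<otimes> x) ` V) ` carrier G"
  have "V \<subseteq> carrier G" using V openin_subset topspace_eq by blast
  have "topspace T \<subseteq> \<Union>?U"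
    using V(2) by (force simp: topspace_eq image_iff intro: r_one[symmetric])
  moreover have "\<forall>U\<in>?U. openin T U" using openin_translate V(1) by auto
  ultimately obtain F where F: "finite F" "F \<subseteq> ?U" "topspace T \<subseteq> \<Union>F"
    using compact unfolding compact_space_alt by meson
  then obtain B where B: "B \<subseteq> carrier G" "finite B" "F = (\<lambda>a. (\<lambda>x. a \<otimes> x) ` V) ` B"
    by (meson finite_subset_image)
  obtain bs where bs: "set bs = B" using B(2) finite_list by blast
  have *: "\<exists>b\<in>set bs. \<exists>v\<in>V. x = b \<otimes> v" if "x \<in> carrier G" for x
    using F(3) that unfolding B(3) bs topspace_eq by blast
  from *[of \<one>] have "bs \<noteq> []" by auto
  then show thesis using that * B bs by auto
qed

lemma continuous_bounded:
  fixes f :: "'a \<Rightarrow> 'c::real_normed_vector"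
  assumes "continuous_map T euclidean f"
  obtains B where "B > 0" "\<And>x. x \<in> carrier G \<Longrightarrow> norm (f x) \<le> B"
proof -
  have "compact (f ` carrier G)"
    using image_compactin[OF _ assms, of "carrier G"] compact
    by (simp add: compact_space_def topspace_eq)
  then have "bounded (f ` carrier G)" by (rule compact_imp_bounded)
  then show thesis using that unfolding bounded_pos by auto
qed

text \<open>Averages along lists of translations play the role of Haar measure: on a continuous
  function they converge uniformly to a constant, by von Neumann's argument.\<close>

definition shifts :: "'a list \<Rightarrow> bool"
  where "shifts L \<longleftrightarrow> L \<noteq> [] \<and> set L \<subseteq> carrier G"

definition avg :: "'a list \<Rightarrow> ('a \<Rightarrow> real) \<Rightarrow> 'a \<Rightarrow> real"
  where "avg L f x = (\<Sum>a\<leftarrow>L. f (a \<otimes> x)) / length L"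

text \<open>Convolution of two counting measures. Lists are used instead of sets because an element
  that is a product in several ways has to be counted as often.\<close>

definition conv :: "'a list \<Rightarrow> 'a list \<Rightarrow> 'a list"
  where "conv L L' = concat (map (\<lambda>a. map (\<lambda>b. a \<otimes> b) L') L)"

text \<open>The best uniform upper bound that averaging can reach. An infimum needs no limit over
  the directed family of averages; for continuous \<open>f\<close>, \<open>mean_approx\<close> shows
  that suitable averages are uniformly close to it from both sides.\<close>

definition mean :: "('a \<Rightarrow> real) \<Rightarrow> real"
  where "mean f = Inf {s. \<exists>L. shifts L \<and> (\<forall>x\<in>carrier G. avg L f x \<le> s)}"

lemma length_conv [simp]: "length (conv L L') = length L * length L'"
  unfolding conv_def by (induction L) auto

lemma shifts_conv: "shifts L \<Longrightarrow> shifts L' \<Longrightarrow> shifts (conv L L')"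
  unfolding shifts_def by (auto simp: conv_def subset_eq)

lemma sum_list_conv:
  fixes h :: "'a \<Rightarrow> 'c::comm_monoid_add"
  shows "(\<Sum>c\<leftarrow>conv L L'. h c) = (\<Sum>a\<leftarrow>L. \<Sum>b\<leftarrow>L'. h (a \<otimes> b))"
  unfolding conv_def by (induction L) (auto simp: o_def)

lemma sum_list_conv_commute:
  fixes h :: "'a \<Rightarrow> 'c::comm_monoid_add"
  assumes "set L \<subseteq> carrier G" "set L' \<subseteq> carrier G"
  shows "(\<Sum>c\<leftarrow>conv L L'. h c) = (\<Sum>c\<leftarrow>conv L' L. h c)"
proof -
  have "(\<Sum>a\<leftarrow>L. \<Sum>b\<leftarrow>L'. h (a \<otimes> b)) = (\<Sum>b\<leftarrow>L'. \<Sum>a\<leftarrow>L. h (a \<otimes> b))"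
    by (induction L) (simp_all add: sum_list_addf)
  also have "\<dots> = (\<Sum>b\<leftarrow>L'. \<Sum>a\<leftarrow>L. h (b \<otimes> a))"
    using assms by (intro arg_cong[where f = sum_list] map_cong refl arg_cong[where f = h] m_comm) auto
  finally show ?thesis unfolding sum_list_conv .
qed

lemma avg_conv:
  assumes "shifts L" "shifts L'" "x \<in> carrier G"
  shows "avg (conv L L') f x = avg L (avg L' f) x"
proof -
  have "(\<Sum>c\<leftarrow>conv L L'. f (c \<otimes> x)) = (\<Sum>a\<leftarrow>L. \<Sum>b\<leftarrow>L'. f (b \<otimes> (a \<otimes> x)))"
    unfolding sum_list_conv using assms unfolding shifts_def
    by (intro arg_cong[where f = sum_list] map_cong refl arg_cong[where f = f])
      (auto simp: subset_eq m_ac)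
  moreover have "(\<Sum>a\<leftarrow>L. avg L' f (a \<otimes> x)) = (\<Sum>a\<leftarrow>L. \<Sum>b\<leftarrow>L'. f (b \<otimes> (a \<otimes> x))) / length L'"
    unfolding avg_def by (simp only: divide_inverse sum_list_mult_const)
  ultimately show ?thesis
    unfolding avg_def[of L] avg_def[of "conv L L'"] by simp
qed

text \<open>Averagings commute because \<open>G\<close> is abelian. This is what makes
  approximations along two unrelated lists comparable in the proofs about
  \<open>mean\<close>.\<close>

lemma avg_conv':
  assumes "shifts L" "shifts L'" "x \<in> carrier G"
  shows "avg (conv L L') f x = avg L' (avg L f) x"
proof -
  have "avg (conv L L') f x = avg (conv L' L) f x"
    using assms unfolding avg_def shifts_def by (simp add: sum_list_conv_commute ac_simps)
  then show ?thesis using assms by (simp add: avg_conv)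
qed

lemma avg_near:
  assumes L: "shifts L" and "x \<in> carrier G"
    and "\<And>y. y \<in> carrier G \<Longrightarrow> \<bar>f y - c\<bar> \<le> e"
  shows "\<bar>avg L f x - c\<bar> \<le> e"
proof -
  have "\<bar>\<Sum>a\<leftarrow>L. f (a \<otimes> x) - c\<bar> \<le> real (length L) * e"
    by (rule sum_list_bound) (use assms in \<open>auto simp: shifts_def\<close>)
  moreover have "(\<Sum>a\<leftarrow>L. f (a \<otimes> x) - c) = (\<Sum>a\<leftarrow>L. f (a \<otimes> x)) - real (length L) * c"
    by (simp add: sum_list_subtractf sum_list_triv)
  moreover have "length L > 0" using L by (simp add: shifts_def)
  ultimately show ?thesis unfolding avg_def by (simp add: field_simps abs_le_iff)
qed

lemma avg_le:
  assumes L: "shifts L" and "x \<in> carrier G" "\<And>y. y \<in> carrier G \<Longrightarrow> f y \<le> s"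
  shows "avg L f x \<le> s"
proof -
  have "(\<Sum>a\<leftarrow>L. f (a \<otimes> x)) \<le> (\<Sum>a\<leftarrow>L. s)"
    by (rule sum_list_mono) (use assms in \<open>auto simp: shifts_def\<close>)
  moreover have "length L > 0" using L by (simp add: shifts_def)
  ultimately show ?thesis unfolding avg_def by (simp add: sum_list_triv field_simps)
qed

lemma avg_ge:
  assumes L: "shifts L" and "x \<in> carrier G" "\<And>y. y \<in> carrier G \<Longrightarrow> s \<le> f y"
  shows "s \<le> avg L f x"
proof -
  have "(\<Sum>a\<leftarrow>L. s) \<le> (\<Sum>a\<leftarrow>L. f (a \<otimes> x))"
    by (rule sum_list_mono) (use assms in \<open>auto simp: shifts_def\<close>)
  moreover have "length L > 0" using L by (simp add: shifts_def)
  ultimately show ?thesis unfolding avg_def by (simp add: sum_list_triv field_simps)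
qed

text \<open>Let N translates of a small \<open>V\<close> cover the group. In the difference of two
  averages over the N centres, one pair of terms can be chosen to differ by at most e/2, the others
  by at most the old oscillation D. The new oscillation is at most ((N - 1) D + e/2) / N, and
  iterating this contraction converges to its fixed point e/2.\<close>

lemma avg_contracts_oscillation:
  assumes f: "continuous_map T euclideanreal f" and e: "e > 0"
  obtains L where "shifts L"
    "\<And>x y. x \<in> carrier G \<Longrightarrow> y \<in> carrier G \<Longrightarrow> avg L f x - avg L f y \<le> e"
proof -
  obtain V where V: "openin T V" "\<one> \<in> V"
    and unif: "\<And>x v. x \<in> carrier G \<Longrightarrow> v \<in> V \<Longrightarrow> norm (f (x \<otimes> v) - f x) < e / 2"
    using uniform_continuity[OF f, of "e / 2"] e by auto
  have VG: "V \<subseteq> carrier G" using V openin_subset topspace_eq by blast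
  obtain bs where bs: "bs \<noteq> []" "set bs \<subseteq> carrier G"
    and cover: "\<And>x. x \<in> carrier G \<Longrightarrow> \<exists>b\<in>set bs. \<exists>v\<in>V. x = b \<otimes> v"
    using finite_translates_cover[OF V] by blast
  obtain B where B: "\<And>x. x \<in> carrier G \<Longrightarrow> norm (f x) \<le> B" "B > 0"
    using continuous_bounded[OF f] by blast
  define N where "N = real (length bs)"
  have N: "N \<ge> 1" using bs(1) unfolding N_def by (cases bs) auto
  have tbs: "shifts bs" using bs by (simp add: shifts_def)
  define q where "q = 1 - 1 / N"
  have q: "0 \<le> q" "q < 1" using N by (auto simp: q_def)
  have step: "\<exists>L. shifts L \<and> (\<forall>x\<in>carrier G. \<forall>y\<in>carrier G. avg L f x - avg L f y \<le> e / 2 + q ^ k * (2 * B))" for k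
  proof (induction k)
    case 0
    have "avg [\<one>] f x - avg [\<one>] f y \<le> e / 2 + 2 * B" if "x \<in> carrier G" "y \<in> carrier G" for x y
      using B(1)[of x] B(1)[of y] e that by (simp add: avg_def abs_le_iff)
    then show ?case by (intro exI[of _ "[\<one>]"]) (simp add: shifts_def)
  next
    case (Suc k)
    then obtain L where L: "shifts L"
      and osc: "\<And>x y. x \<in> carrier G \<Longrightarrow> y \<in> carrier G \<Longrightarrow> avg L f x - avg L f y \<le> e / 2 + q ^ k * (2 * B)"
      by blast
    define g where "g = avg L f"
    define D where "D = e / 2 + q ^ k * (2 * B)"
    have g_unif: "\<bar>g (x \<otimes> v) - g x\<bar> \<le> e / 2" if "x \<in> carrier G" "v \<in> V" for x v
    proof -
      have "\<bar>\<Sum>a\<leftarrow>L. f (a \<otimes> (x \<otimes> v)) - f (a \<otimes> x)\<bar> \<le> real (length L) * (e / 2)"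
      proof (rule sum_list_bound)
        fix a assume "a \<in> set L"
        then have "a \<in> carrier G" using L by (auto simp: shifts_def)
        then show "\<bar>f (a \<otimes> (x \<otimes> v)) - f (a \<otimes> x)\<bar> \<le> e / 2"
          using unif[of "a \<otimes> x" v] that VG by (auto simp: m_assoc subset_eq)
      qed
      moreover have "length L > 0" using L by (simp add: shifts_def)
      ultimately show ?thesis
        unfolding g_def avg_def by (simp add: sum_list_subtractf field_simps abs_le_iff)
    qed
    have "avg bs g x - avg bs g y \<le> e / 2 + q ^ Suc k * (2 * B)"
      if x: "x \<in> carrier G" and y: "y \<in> carrier G" for x y
    proof -
      \<comment> \<open>With \<open>c\<close> fixed, the cover supplies a \<open>b\<close> such that
        \<open>c \<otimes> y\<close> lies in the translate of \<open>V\<close> by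
        \<open>b \<otimes> x\<close>. These are the two terms that nearly cancel.\<close>
      obtain c where c: "c \<in> set bs" using bs(1) by (cases bs) auto
      have cG: "c \<in> carrier G" using c bs by auto
      obtain b v where b: "b \<in> set bs" "v \<in> V" "c \<otimes> y \<otimes> inv x = b \<otimes> v"
        using cover[of "c \<otimes> y \<otimes> inv x"] x y cG by auto
      have bG: "b \<in> carrier G" "v \<in> carrier G" using b bs VG by auto
      have "c \<otimes> y = (b \<otimes> x) \<otimes> v"
      proof -
        have "c \<otimes> y = c \<otimes> y \<otimes> inv x \<otimes> x" using x y cG by (simp add: m_assoc)
        also have "\<dots> = (b \<otimes> x) \<otimes> v" using b(3) bG x by (simp add: m_ac)
        finally show ?thesis .
      qed
      then have 1: "g (b \<otimes> x) - g (c \<otimes> y) \<le> e / 2"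
        using g_unif[of "b \<otimes> x" v] b(2) bG x unfolding abs_le_iff by simp
      \<comment> \<open>The remaining N - 1 terms may be paired in any way, as each difference is
        bounded by the old oscillation.\<close>
      have 2: "sum_list (map (\<lambda>a. g (a \<otimes> x)) (remove1 b bs)) - sum_list (map (\<lambda>a. g (a \<otimes> y)) (remove1 c bs))
          \<le> real (length (map (\<lambda>a. g (a \<otimes> x)) (remove1 b bs))) * D"
      proof (rule sum_list_diff_le)
        fix u w
        assume "u \<in> set (map (\<lambda>a. g (a \<otimes> x)) (remove1 b bs))"
          "w \<in> set (map (\<lambda>a. g (a \<otimes> y)) (remove1 c bs))"
        then obtain a a' where "a \<in> set (remove1 b bs)" "a' \<in> set (remove1 c bs)"
          and uw: "u = g (a \<otimes> x)" "w = g (a' \<otimes> y)"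
          by auto
        then have "a \<in> carrier G" "a' \<in> carrier G"
          using bs(2) set_remove1_subset by fastforce+
        then show "u - w \<le> D" using osc x y uw by (simp add: g_def D_def)
      qed (use b(1) c in \<open>simp add: length_remove1\<close>)
      have 3: "real (length (map (\<lambda>a. g (a \<otimes> x)) (remove1 b bs))) = N - 1"
        using b(1) bs(1) by (simp add: length_remove1 N_def of_nat_diff Suc_leI)
      have "(\<Sum>a\<leftarrow>bs. g (a \<otimes> x)) - (\<Sum>a\<leftarrow>bs. g (a \<otimes> y)) \<le> (N - 1) * D + e / 2"
        using 1 2 unfolding 3
        by (simp add: sum_list_map_remove1[OF b(1), of "\<lambda>a. g (a \<otimes> x)"]
            sum_list_map_remove1[OF c, of "\<lambda>a. g (a \<otimes> y)"])
      then have "avg bs g x - avg bs g y \<le> ((N - 1) * D + e / 2) / N"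
        using N unfolding avg_def N_def[symmetric] by (simp add: divide_right_mono flip: diff_divide_distrib)
      also have "\<dots> = e / 2 + q ^ Suc k * (2 * B)"
        using N by (simp add: D_def q_def field_simps)
      finally show ?thesis .
    qed
    moreover have "avg (conv L bs) f x = avg bs g x" if "x \<in> carrier G" for x
      using avg_conv'[OF L tbs that] by (simp add: g_def)
    ultimately show ?case
      by (intro exI[of _ "conv L bs"]) (simp add: shifts_conv L tbs)
  qed
  \<comment> \<open>The oscillation of \<open>f\<close> itself is at most 2 B; this many steps
    reduce the excess over e/2 to at most e/2.\<close>
  obtain k where k: "q ^ k < e / (4 * B)"
    using real_arch_pow_inv[of "e / (4 * B)" q] q e B by auto
  have "q ^ k * (2 * B) \<le> e / 2"
    using k B(2) by (simp add: field_simps)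
  then have le: "e / 2 + q ^ k * (2 * B) \<le> e" by simp
  obtain L where "shifts L" "\<forall>x\<in>carrier G. \<forall>y\<in>carrier G. avg L f x - avg L f y \<le> e / 2 + q ^ k * (2 * B)"
    using step[of k] by blast
  then show thesis using that[of L] order_trans[OF _ le] by blast
qed

text \<open>A list on which \<open>f\<close> oscillates by at most \<open>e\<close> already works.
  If \<open>s\<close> bounds the averages along another list \<open>L'\<close>, then averaging
  \<open>avg L f\<close> along \<open>L'\<close> stays above \<open>avg L f x - e\<close>, while in
  the other order the same number is at most \<open>s\<close>. So no admissible bound lies far
  below.\<close>

lemma mean_approx:
  assumes f: "continuous_map T euclideanreal f" and e: "e > 0"
  obtains L where "shifts L" "\<And>x. x \<in> carrier G \<Longrightarrow> \<bar>avg L f x - mean f\<bar> \<le> e"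
proof -
  let ?S = "{s. \<exists>L. shifts L \<and> (\<forall>x\<in>carrier G. avg L f x \<le> s)}"
  obtain L where L: "shifts L"
    and osc: "\<And>x y. x \<in> carrier G \<Longrightarrow> y \<in> carrier G \<Longrightarrow> avg L f x - avg L f y \<le> e"
    using avg_contracts_oscillation[OF f e] by blast
  have lower: "avg L f x - e \<le> s" if x: "x \<in> carrier G" and s: "s \<in> ?S" for x s
  proof -
    obtain L' where L': "shifts L'" "\<forall>x\<in>carrier G. avg L' f x \<le> s" using s by blast
    have "avg L f x - e \<le> avg L' (avg L f) x"
      by (rule avg_ge[OF L'(1) x]) (use osc x in \<open>smt (verit)\<close>)
    also have "\<dots> = avg L (avg L' f) x"
      using avg_conv avg_conv' L L'(1) x by simp
    also have "\<dots> \<le> s" by (rule avg_le[OF L x]) (use L' in auto)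
    finally show ?thesis .
  qed
  have upper: "avg L f x + e \<in> ?S" if x: "x \<in> carrier G" for x
    using L osc x by (smt (verit) mem_Collect_eq)
  have "\<bar>avg L f x - mean f\<bar> \<le> e" if x: "x \<in> carrier G" for x
  proof -
    have "mean f \<le> avg L f x + e"
      unfolding mean_def by (rule cInf_lower[OF upper[OF x]]) (use lower[OF x] in \<open>auto simp: bdd_below_def\<close>)
    moreover have "avg L f x - e \<le> mean f"
      unfolding mean_def by (rule cInf_greatest) (use upper[OF x] lower[OF x] in auto)
    ultimately show ?thesis by linarith
  qed
  then show thesis using that L by blast
qed

text \<open>Average along the list for \<open>c\<close> and along a list for \<open>mean f\<close>.
  Done in one order the result is close to \<open>c\<close>, in the other to \<open>mean f\<close>,
  and the orders agree.\<close>

lemma mean_unique: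
  assumes f: "continuous_map T euclideanreal f"
    and c: "\<And>e. e > 0 \<Longrightarrow> \<exists>L. shifts L \<and> (\<forall>x\<in>carrier G. \<bar>avg L f x - c\<bar> \<le> e)"
  shows "mean f = c"
proof -
  have "\<bar>mean f - c\<bar> \<le> e" if e: "e > 0" for e
  proof -
    obtain L where L: "shifts L" "\<forall>x\<in>carrier G. \<bar>avg L f x - c\<bar> \<le> e / 2"
      using c[of "e / 2"] e by auto
    obtain L' where L': "shifts L'" "\<And>x. x \<in> carrier G \<Longrightarrow> \<bar>avg L' f x - mean f\<bar> \<le> e / 2"
      using mean_approx[OF f, of "e / 2"] e by auto
    have "\<bar>avg L' (avg L f) \<one> - c\<bar> \<le> e / 2"
      by (rule avg_near) (use L L' in auto)
    moreover have "\<bar>avg L (avg L' f) \<one> - mean f\<bar> \<le> e / 2"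
      by (rule avg_near) (use L L' in auto)
    moreover have "avg L' (avg L f) \<one> = avg L (avg L' f) \<one>"
      using avg_conv avg_conv' L(1) L'(1) by simp
    ultimately show ?thesis by linarith
  qed
  then have "\<bar>mean f - c\<bar> \<le> 0" by (rule field_le_epsilon[of _ 0, simplified])
  then show ?thesis by simp
qed

lemma mean_add:
  assumes f: "continuous_map T euclideanreal f" and g: "continuous_map T euclideanreal g"
  shows "mean (\<lambda>x. f x + g x) = mean f + mean g"
proof (rule mean_unique)
  show "continuous_map T euclideanreal (\<lambda>x. f x + g x)"
    using f g by (intro continuous_intros)
  fix e :: real assume e: "e > 0"
  obtain L where L: "shifts L" "\<And>x. x \<in> carrier G \<Longrightarrow> \<bar>avg L f x - mean f\<bar> \<le> e / 2"
    using mean_approx[OF f, of "e / 2"] e by auto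
  obtain L' where L': "shifts L'" "\<And>x. x \<in> carrier G \<Longrightarrow> \<bar>avg L' g x - mean g\<bar> \<le> e / 2"
    using mean_approx[OF g, of "e / 2"] e by auto
  have "\<bar>avg (conv L L') (\<lambda>x. f x + g x) x - (mean f + mean g)\<bar> \<le> e" if x: "x \<in> carrier G" for x
  proof -
    have "avg (conv L L') (\<lambda>x. f x + g x) x = avg (conv L L') f x + avg (conv L L') g x"
      by (simp add: avg_def sum_list_addf add_divide_distrib)
    moreover have "\<bar>avg L' (avg L f) x - mean f\<bar> \<le> e / 2"
      by (rule avg_near) (use L L' x in auto)
    moreover have "\<bar>avg L (avg L' g) x - mean g\<bar> \<le> e / 2"
      by (rule avg_near) (use L L' x in auto)
    ultimately show ?thesis
      using avg_conv[OF L(1) L'(1) x] avg_conv'[OF L(1) L'(1) x] by (smt (verit) field_sum_of_halves)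
  qed
  then show "\<exists>L. shifts L \<and> (\<forall>x\<in>carrier G. \<bar>avg L (\<lambda>x. f x + g x) x - (mean f + mean g)\<bar> \<le> e)"
    using shifts_conv L(1) L'(1) by blast
qed

lemma mean_cmult:
  assumes f: "continuous_map T euclideanreal f"
  shows "mean (\<lambda>x. c * f x) = c * mean f"
proof (rule mean_unique)
  show "continuous_map T euclideanreal (\<lambda>x. c * f x)"
    using f by (intro continuous_intros)
  fix e :: real assume e: "e > 0"
  obtain L where L: "shifts L" "\<And>x. x \<in> carrier G \<Longrightarrow> \<bar>avg L f x - mean f\<bar> \<le> e / (\<bar>c\<bar> + 1)"
    using mean_approx[OF f divide_pos_pos[OF e, of "\<bar>c\<bar> + 1"]] by (metis abs_add_one_gt_zero add.commute)
  have "\<bar>avg L (\<lambda>x. c * f x) x - c * mean f\<bar> \<le> e" if x: "x \<in> carrier G" for x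
  proof -
    have "avg L (\<lambda>x. c * f x) x - c * mean f = c * (avg L f x - mean f)"
      by (simp add: avg_def sum_list_const_mult algebra_simps)
    then have "\<bar>avg L (\<lambda>x. c * f x) x - c * mean f\<bar> = \<bar>c\<bar> * \<bar>avg L f x - mean f\<bar>"
      by (simp add: abs_mult)
    also have "\<dots> \<le> \<bar>c\<bar> * (e / (\<bar>c\<bar> + 1))" using L(2)[OF x] by (intro mult_left_mono) auto
    also have "\<dots> \<le> e" using e by (simp add: field_simps)
    finally show ?thesis .
  qed
  then show "\<exists>L. shifts L \<and> (\<forall>x\<in>carrier G. \<bar>avg L (\<lambda>x. c * f x) x - c * mean f\<bar> \<le> e)"
    using L(1) by blast
qed

lemma mean_cong:
  assumes "\<And>x. x \<in> carrier G \<Longrightarrow> f x = g x"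
  shows "mean f = mean g"
proof -
  have "avg L f x = avg L g x" if "shifts L" "x \<in> carrier G" for L x
    unfolding avg_def using assms that
    by (intro arg_cong[where f = "\<lambda>s. s / _"] arg_cong[where f = sum_list] map_cong)
      (auto simp: shifts_def subset_eq)
  then show ?thesis unfolding mean_def by (intro arg_cong[where f = Inf] Collect_cong ex_cong1) auto
qed

lemma mean_const: "mean (\<lambda>x. c) = c"
  by (rule mean_unique)
    (auto intro!: exI[of _ "[\<one>]"] simp: avg_def shifts_def)

lemma mean_nonneg:
  assumes f: "continuous_map T euclideanreal f" and "\<And>x. x \<in> carrier G \<Longrightarrow> 0 \<le> f x"
  shows "0 \<le> mean f"
proof (rule field_le_epsilon)
  fix e :: real assume "e > 0"
  then obtain L where L: "shifts L" "\<And>x. x \<in> carrier G \<Longrightarrow> \<bar>avg L f x - mean f\<bar> \<le> e"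
    using mean_approx[OF f] by blast
  then show "0 \<le> mean f + e" using avg_ge[OF L(1) one_closed, of 0 f] assms(2) L(2)[OF one_closed] by (smt (verit))
qed

lemma mean_diff:
  assumes f: "continuous_map T euclideanreal f" and g: "continuous_map T euclideanreal g"
  shows "mean (\<lambda>x. f x - g x) = mean f - mean g"
proof -
  have "continuous_map T euclideanreal (\<lambda>x. (-1) * g x)" using g by (intro continuous_intros)
  from mean_add[OF f this] mean_cmult[OF g, of "-1"] show ?thesis by simp
qed

lemma mean_mono:
  assumes f: "continuous_map T euclideanreal f" and g: "continuous_map T euclideanreal g"
    and "\<And>x. x \<in> carrier G \<Longrightarrow> f x \<le> g x"
  shows "mean f \<le> mean g"
proof -
  have "continuous_map T euclideanreal (\<lambda>x. g x - f x)" using f g by (intro continuous_intros)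
  from mean_nonneg[OF this] mean_diff[OF g f] assms(3) show ?thesis by simp
qed

lemma continuous_map_translate:
  assumes "continuous_map T X f" "a \<in> carrier G"
  shows "continuous_map T X (\<lambda>x. f (a \<otimes> x))"
  using continuous_map_compose[OF continuous_translate[OF assms(2)] assms(1)] by (simp add: o_def)

lemma mean_translate:
  assumes f: "continuous_map T euclideanreal f" and a: "a \<in> carrier G"
  shows "mean (\<lambda>x. f (a \<otimes> x)) = mean f"
proof (rule mean_unique)
  show "continuous_map T euclideanreal (\<lambda>x. f (a \<otimes> x))"
    by (rule continuous_map_translate[OF f a])
  fix e :: real assume e: "e > 0"
  then obtain L where L: "shifts L" "\<And>x. x \<in> carrier G \<Longrightarrow> \<bar>avg L f x - mean f\<bar> \<le> e"
    using mean_approx[OF f] by blast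
  have "avg L (\<lambda>x. f (a \<otimes> x)) x = avg L f (a \<otimes> x)" if "x \<in> carrier G" for x
    unfolding avg_def using a L(1) that unfolding shifts_def
    by (intro arg_cong[where f = "\<lambda>s. s / _"] arg_cong[where f = sum_list] map_cong refl
        arg_cong[where f = f]) (auto simp: m_lcomm subset_eq)
  then show "\<exists>L. shifts L \<and> (\<forall>x\<in>carrier G. \<bar>avg L (\<lambda>x. f (a \<otimes> x)) x - mean f\<bar> \<le> e)"
    using L a by (intro exI[of _ L]) auto
qed

end

section \<open>Positive definite states\<close>

text \<open>The Krein--Milman argument: a minimal closed face of the maximum face of \<open>\<Phi>\<close> is a point.\<close>

lemma extreme_point_above:
  fixes K :: "('i \<Rightarrow> complex) set" and \<Phi> :: "('i \<Rightarrow> complex) \<Rightarrow> real"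
  defines "mix \<equiv> \<lambda>t q p x. complex_of_real t * q x + complex_of_real (1 - t) * p x"
  assumes K: "compact K" "closed K" and q0: "q0 \<in> K" and cont: "continuous_on UNIV \<Phi>"
    and affine: "\<And>t q p. \<Phi> (mix t q p) = t * \<Phi> q + (1 - t) * \<Phi> p"
  obtains \<psi> where "\<psi> \<in> K" "\<Phi> q0 \<le> \<Phi> \<psi>"
    "\<And>t q p. q \<in> K \<Longrightarrow> p \<in> K \<Longrightarrow> 0 < t \<Longrightarrow> t < 1 \<Longrightarrow> mix t q p = \<psi> \<Longrightarrow> q = \<psi>"
proof -
  define face where "face F \<longleftrightarrow> closed F \<and> F \<noteq> {} \<and> F \<subseteq> K \<and>
    (\<forall>q\<in>K. \<forall>p\<in>K. \<forall>t. 0 < t \<longrightarrow> t < 1 \<longrightarrow> mix t q p \<in> F \<longrightarrow> q \<in> F \<and> p \<in> F)" for F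
  \<comment> \<open>Where an affine functional attains its maximum over a face is again a face: a
    proper convex combination attains the maximum only if both of its ends do.\<close>
  have argmax: "\<exists>q\<in>F. (\<forall>p\<in>F. \<Psi> p \<le> \<Psi> q) \<and> face {p\<in>F. \<Psi> p = \<Psi> q}"
    if F: "face F" and \<Psi>: "continuous_on UNIV \<Psi>"
      and aff: "\<And>t q p. \<Psi> (mix t q p) = t * \<Psi> q + (1 - t) * \<Psi> p" for F and \<Psi> :: "('i \<Rightarrow> complex) \<Rightarrow> real"
  proof -
    have "compact F" using F K(1) unfolding face_def
      by (metis compact_Int_closed inf.absorb_iff2)
    then obtain q where q: "q \<in> F" "\<forall>p\<in>F. \<Psi> p \<le> \<Psi> q"
      using continuous_attains_sup[of F \<Psi>] F continuous_on_subset[OF \<Psi>] unfolding face_def by blast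
    have "closed {p. \<Psi> p = \<Psi> q}" by (intro closed_Collect_eq \<Psi> continuous_intros)
    then have "closed {p\<in>F. \<Psi> p = \<Psi> q}"
      using F closed_Int[of F "{p. \<Psi> p = \<Psi> q}"] unfolding face_def by (simp add: Int_def)
    moreover have "p \<in> F \<and> p' \<in> F \<and> \<Psi> p = \<Psi> q \<and> \<Psi> p' = \<Psi> q"
      if "p \<in> K" "p' \<in> K" "0 < t" "t < 1" "mix t p p' \<in> F" "\<Psi> (mix t p p') = \<Psi> q" for t p p'
    proof -
      have *: "p \<in> F" "p' \<in> F" using that F unfolding face_def by blast+
      then have le: "\<Psi> p \<le> \<Psi> q" "\<Psi> p' \<le> \<Psi> q" using q(2) by auto
      have eq: "t * (\<Psi> q - \<Psi> p) + (1 - t) * (\<Psi> q - \<Psi> p') = 0"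
        using that(6) unfolding aff by (simp add: algebra_simps)
      have "0 \<le> t * (\<Psi> q - \<Psi> p)" "0 \<le> (1 - t) * (\<Psi> q - \<Psi> p')"
        using le that by auto
      with eq have "t * (\<Psi> q - \<Psi> p) = 0" "(1 - t) * (\<Psi> q - \<Psi> p') = 0" by linarith+
      then show ?thesis using * that by auto
    qed
    ultimately have "face {p\<in>F. \<Psi> p = \<Psi> q}"
      using F q(1) unfolding face_def by auto
    then show ?thesis using q by blast
  qed
  have "face K" using K q0 unfolding face_def by auto
  from argmax[OF this cont affine] obtain q1 where q1: "q1 \<in> K" "\<forall>p\<in>K. \<Phi> p \<le> \<Phi> q1"
    and F0: "face {p\<in>K. \<Phi> p = \<Phi> q1}" by blast
  define F0 where "F0 = {p\<in>K. \<Phi> p = \<Phi> q1}"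
  \<comment> \<open>Zorn's lemma for inclusion gives maximal sets, so a minimal face is obtained as
    the complement of a maximal member of \<open>A\<close>. The union of a chain in \<open>A\<close>
    corresponds to an intersection of faces, nonempty by compactness.\<close>
  define A where "A = uminus ` {F. face F \<and> F \<subseteq> F0}"
  have "\<exists>M\<in>A. \<forall>X\<in>A. M \<subseteq> X \<longrightarrow> X = M"
  proof (rule subset_Zorn_nonempty)
    show "A \<noteq> {}" using F0 unfolding A_def F0_def by auto
    fix \<C> assume ne: "\<C> \<noteq> {}" and ch: "subset.chain A \<C>"
    define D where "D = uminus ` \<C>"
    have D: "face F \<and> F \<subseteq> F0" if "F \<in> D" for F
      using that ch unfolding D_def A_def subset.chain_def by auto
    have total: "F \<subseteq> F' \<or> F' \<subseteq> F" if "F \<in> D" "F' \<in> D" for F F'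
    proof -
      from that obtain C C' where C: "C \<in> \<C>" "C' \<in> \<C>" "F = - C" "F' = - C'"
        unfolding D_def by blast
      then have "C \<subseteq> C' \<or> C' \<subseteq> C" using ch unfolding subset_chain_def by blast
      then show ?thesis using C by auto
    qed
    have "K \<inter> \<Inter>D \<noteq> {}"
    proof (rule compact_imp_fip[OF K(1)])
      show "closed F" if "F \<in> D" for F using D[OF that] unfolding face_def by blast
      fix F' assume F': "finite F'" "F' \<subseteq> D"
      show "K \<inter> \<Inter>F' \<noteq> {}"
      proof (cases "F' = {}")
        case False
        then obtain m where m: "m \<in> F'" "\<forall>F\<in>F'. F \<subseteq> m \<longrightarrow> m = F"
          using finite_has_minimal[OF F'(1)] by blast
        then have "m \<subseteq> F" if "F \<in> F'" for F
          using total[of m F] F'(2) that by blast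
        then have "m \<subseteq> K \<inter> \<Inter>F'" using D[of m] m(1) F'(2) unfolding face_def by blast
        then show ?thesis using D[of m] m(1) F'(2) unfolding face_def by blast
      qed (use q0 in auto)
    qed
    then have ne': "\<Inter>D \<noteq> {}" by blast
    have D_ne: "D \<noteq> {}" using ne unfolding D_def by blast
    have "closed (\<Inter>D)" using D unfolding face_def by blast
    moreover have "\<Inter>D \<subseteq> K" "\<Inter>D \<subseteq> F0" using D D_ne unfolding face_def by blast+
    moreover have "q \<in> \<Inter>D \<and> p \<in> \<Inter>D" if "q \<in> K" "p \<in> K" "0 < t" "t < 1" "mix t q p \<in> \<Inter>D" for q p t
      using that D unfolding face_def by blast
    ultimately have "face (\<Inter>D)" using ne' unfolding face_def by blast
    moreover have "\<Union>\<C> = - \<Inter>D" unfolding D_def by auto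
    ultimately show "\<Union>\<C> \<in> A" using \<open>\<Inter>D \<subseteq> F0\<close> unfolding A_def by blast
  qed
  then obtain U where U: "U \<in> A" "\<forall>X\<in>A. U \<subseteq> X \<longrightarrow> X = U" by blast
  from U(1) obtain M where M: "face M" "M \<subseteq> F0" "U = - M" unfolding A_def by blast
  have min: "F = M" if "face F" "F \<subseteq> F0" "F \<subseteq> M" for F
    using U(2)[rule_format, of "- F"] that unfolding A_def M(3) by blast
  obtain \<psi> where \<psi>: "\<psi> \<in> M" using M unfolding face_def by blast
  \<comment> \<open>By minimality the maximum set of any continuous affine functional on
    \<open>M\<close> is all of \<open>M\<close>. Applied to real and imaginary parts of the
    coordinates, this leaves a single point.\<close>
  have const: "\<Psi> p = \<Psi> \<psi>" if "p \<in> M" and \<Psi>: "continuous_on UNIV \<Psi>"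
      and aff: "\<And>t q p. \<Psi> (mix t q p) = t * \<Psi> q + (1 - t) * \<Psi> p" for p and \<Psi> :: "('i \<Rightarrow> complex) \<Rightarrow> real"
  proof -
    obtain q where "q \<in> M" "face {p\<in>M. \<Psi> p = \<Psi> q}"
      using argmax[OF M(1) \<Psi> aff] by blast
    with min M(2) have "{p\<in>M. \<Psi> p = \<Psi> q} = M" by blast
    then show ?thesis using that(1) \<psi> by (metis (mono_tags, lifting) mem_Collect_eq)
  qed
  have single: "p = \<psi>" if p: "p \<in> M" for p
  proof
    fix x
    have "Re (p x) = Re (\<psi> x)"
      by (rule const[OF p, of "\<lambda>q. Re (q x)"])
        (auto simp: mix_def intro!: continuous_intros continuous_on_product_coordinates)
    moreover have "Im (p x) = Im (\<psi> x)"
      by (rule const[OF p, of "\<lambda>q. Im (q x)"])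
        (auto simp: mix_def intro!: continuous_intros continuous_on_product_coordinates)
    ultimately show "p x = \<psi> x" by (simp add: complex_eq_iff)
  qed
  show thesis
  proof (rule that[of \<psi>])
    show "\<psi> \<in> K" using \<psi> M unfolding face_def by blast
    show "\<Phi> q0 \<le> \<Phi> \<psi>" using \<psi> M(2) q1(2) q0 unfolding F0_def by auto
    fix t q p assume "q \<in> K" "p \<in> K" "0 < t" "t < (1::real)" "mix t q p = \<psi>"
    then have "q \<in> M" using M(1) \<psi> unfolding face_def by blast
    then show "q = \<psi>" by (rule single)
  qed
qed

lemma continuous_on_sum_list:
  fixes f :: "'b \<Rightarrow> 'c::topological_space \<Rightarrow> 'd::real_normed_vector"
  assumes "\<And>p. p \<in> set ps \<Longrightarrow> continuous_on S (f p)"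
  shows "continuous_on S (\<lambda>q. \<Sum>p\<leftarrow>ps. f p q)"
  using assms by (induction ps) (auto intro!: continuous_intros)

lemma Re_sum_list: "Re (\<Sum>p\<leftarrow>ps. f p) = (\<Sum>p\<leftarrow>ps. Re (f p))"
  by (induction ps) auto

lemma compact_le_one: "compact {q :: 'b \<Rightarrow> complex. \<forall>x. norm (q x) \<le> 1}"
proof -
  have "compactin (product_topology (\<lambda>_. euclidean) UNIV) (PiE UNIV (\<lambda>_::'b. cball (0::complex) 1))"
    unfolding compactin_PiE by (simp add: compactin_euclidean_iff)
  moreover have "PiE UNIV (\<lambda>_::'b. cball (0::complex) 1) = {q. \<forall>x. norm (q x) \<le> 1}"
    by (auto simp: PiE_def)
  ultimately show ?thesis by (simp add: euclidean_product_topology compactin_euclidean_iff)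
qed

section \<open>States and characters of a discrete abelian group\<close>

context comm_group
begin

text \<open>A list of pairs stands for an element of the complex group algebra, and this is its
  Hermitian form given by \<open>q\<close>. Repeated group elements are allowed, so that appending
  lists adds the elements they stand for.\<close>

definition form :: "('a \<Rightarrow> complex) \<Rightarrow> ('a \<times> complex) list \<Rightarrow> complex"
  where "form q ps = (\<Sum>p\<leftarrow>ps. \<Sum>p'\<leftarrow>ps. snd p * cnj (snd p') * q (fst p \<otimes> inv (fst p')))"

definition positive_definite :: "('a \<Rightarrow> complex) \<Rightarrow> bool"
  where "positive_definite q \<longleftrightarrow> (\<forall>x\<in>carrier G. q (inv x) = cnj (q x)) \<and>
    (\<forall>ps. fst ` set ps \<subseteq> carrier G \<longrightarrow> 0 \<le> Re (form q ps))"

text \<open>The value 0 off the carrier keeps the coordinates bounded there; otherwise the set would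
  not be compact in the product over the whole type.\<close>

definition states :: "('a \<Rightarrow> complex) set"
  where "states = {q. positive_definite q \<and> q \<one> = 1 \<and> (\<forall>x. x \<notin> carrier G \<longrightarrow> q x = 0)}"

text \<open>These are the characters of \<open>G\<close> as a discrete group. Continuity is left out
  because only then is the set closed under pointwise limits, hence compact.\<close>

definition unitary_characters :: "('a \<Rightarrow> complex) set"
  where "unitary_characters = {\<psi>. (\<forall>x. x \<notin> carrier G \<longrightarrow> \<psi> x = 0) \<and>
    (\<forall>x\<in>carrier G. norm (\<psi> x) = 1) \<and>
    (\<forall>x\<in>carrier G. \<forall>y\<in>carrier G. \<psi> (x \<otimes> y) = \<psi> x * \<psi> y)}"

text \<open>Take the form on the points \<open>x\<close> and \<open>\<one>\<close> with coefficients
  \<open>z\<close> and 1, where \<open>z\<close> of modulus 1 rotates \<open>q x\<close> to the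
  negative axis. Its value is \<open>2 * q \<one>\<close> minus twice the modulus of
  \<open>q x\<close>.\<close>

lemma positive_definite_bound:
  assumes q: "positive_definite q" and x: "x \<in> carrier G"
  shows "norm (q x) \<le> Re (q \<one>)"
proof (cases "q x = 0")
  case True
  have "0 \<le> Re (form q [(\<one>, 1)])" using q unfolding positive_definite_def by simp
  then show ?thesis using True by (simp add: form_def)
next
  case False
  define z where "z = - cnj (sgn (q x))"
  have nz: "z * cnj z = 1"
    using complex_norm_square[of z] False by (simp add: z_def norm_sgn)
  have zq: "z * q x = - of_real (norm (q x))"
    using False complex_norm_square[of "q x"] by (simp add: z_def sgn_eq power2_eq_square field_simps)
  have "0 \<le> Re (form q [(x, z), (\<one>, 1)])"
    using q x unfolding positive_definite_def by simp
  also have "form q [(x, z), (\<one>, 1)] = 2 * q \<one> + z * q x + cnj (z * q x)"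
    using q x nz unfolding positive_definite_def by (simp add: form_def)
  finally show ?thesis unfolding zq by simp
qed

lemma states_bound:
  assumes "q \<in> states"
  shows "norm (q x) \<le> 1"
  using assms positive_definite_bound[of q x] by (cases "x \<in> carrier G") (auto simp: states_def)

lemma closed_states: "closed states"
proof -
  have "states = (\<Inter>x\<in>carrier G. {q. q (inv x) = cnj (q x)}) \<inter>
    (\<Inter>ps\<in>{ps. fst ` set ps \<subseteq> carrier G}. {q. 0 \<le> Re (form q ps)}) \<inter> {q. q \<one> = 1} \<inter>
    (\<Inter>x\<in>-carrier G. {q. q x = 0})"
    unfolding states_def positive_definite_def by auto
  also have "closed \<dots>"
    unfolding form_def
    by (intro closed_Int closed_INT ballI closed_Collect_eq closed_Collect_le continuous_intros
        continuous_on_sum_list continuous_on_product_coordinates)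
  finally show ?thesis .
qed

lemma compact_states: "compact states"
proof -
  have "states = {q. \<forall>x. norm (q x) \<le> 1} \<inter> states" using states_bound by auto
  then show ?thesis using compact_Int_closed[OF compact_le_one closed_states] by simp
qed

lemma compact_unitary_characters: "compact unitary_characters"
proof -
  have "unitary_characters = {q. \<forall>x. norm (q x) \<le> 1} \<inter> ((\<Inter>x\<in>-carrier G. {q. q x = 0}) \<inter>
    (\<Inter>x\<in>carrier G. {q. norm (q x) = 1}) \<inter>
    (\<Inter>x\<in>carrier G. \<Inter>y\<in>carrier G. {q. q (x \<otimes> y) = q x * q y}))" (is "_ = _ \<inter> ?C")
    unfolding unitary_characters_def by (auto, metis norm_zero order.refl zero_le_one)
  moreover have "closed ?C"
    by (intro closed_Int closed_INT ballI closed_Collect_eq continuous_intros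
        continuous_on_product_coordinates)
  ultimately show ?thesis using compact_Int_closed[OF compact_le_one, of ?C] by (simp only:)
qed

text \<open>Perturbing an extreme state \<open>q\<close> by its translates by \<open>a\<close> and \<open>inv a\<close>: the coefficient
  \<open>5/4 = 1 + |1/2|\<^sup>2\<close> makes the perturbation the form of \<open>q\<close> on a doubled list.\<close>

lemma positive_definite_perturb:
  assumes q: "positive_definite q" and a: "a \<in> carrier G" and l: "norm l = 1"
  shows "positive_definite (\<lambda>y. if y \<in> carrier G
    then 5 / 4 * q y + (l * q (y \<otimes> a) + cnj l * q (y \<otimes> inv a)) / 2 else 0)"
    (is "positive_definite ?r")
proof -
  have her: "q (inv x) = cnj (q x)" if "x \<in> carrier G" for x
    using q that unfolding positive_definite_def by blast
  have "?r (inv x) = cnj (?r x)" if x: "x \<in> carrier G" for x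
  proof -
    have "inv x \<otimes> a = inv (x \<otimes> inv a)" "inv x \<otimes> inv a = inv (x \<otimes> a)"
      using a x by (simp_all add: inv_mult)
    then show ?thesis using a x by (simp add: her add.commute)
  qed
  moreover have "0 \<le> Re (form ?r ps)" if ps: "fst ` set ps \<subseteq> carrier G" for ps
  proof -
    define m where "m = l / 2"
    define ps' where "ps' = map (\<lambda>p. (fst p \<otimes> a, m * snd p)) ps"
    have eq: "snd p * cnj (snd p') * ?r (fst p \<otimes> inv (fst p')) =
       snd p * cnj (snd p') * q (fst p \<otimes> inv (fst p'))
       + snd p * cnj (m * snd p') * q (fst p \<otimes> inv (fst p' \<otimes> a))
       + (m * snd p * cnj (snd p') * q (fst p \<otimes> a \<otimes> inv (fst p'))
       + m * snd p * cnj (m * snd p') * q (fst p \<otimes> a \<otimes> inv (fst p' \<otimes> a)))"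
      if "p \<in> set ps" "p' \<in> set ps" for p p'
    proof -
      have G: "fst p \<in> carrier G" "fst p' \<in> carrier G" using that ps by auto
      have e: "fst p \<otimes> inv (fst p' \<otimes> a) = fst p \<otimes> inv (fst p') \<otimes> inv a"
        "fst p \<otimes> a \<otimes> inv (fst p') = fst p \<otimes> inv (fst p') \<otimes> a"
        "fst p \<otimes> a \<otimes> inv (fst p' \<otimes> a) = fst p \<otimes> inv (fst p')"
      proof -
        have "a \<otimes> (inv a \<otimes> inv (fst p')) = inv (fst p')" using G a by (simp flip: m_assoc)
        then show "fst p \<otimes> a \<otimes> inv (fst p' \<otimes> a) = fst p \<otimes> inv (fst p')"
          using G a by (simp add: inv_mult_group m_assoc)
      qed (use G a in \<open>simp_all add: inv_mult_group m_ac\<close>)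
      have "l * cnj l = 1" using l complex_norm_square[of l] by simp
      then show ?thesis using G a unfolding e by (simp add: m_def algebra_simps add_divide_distrib)
    qed
    have "form ?r ps = (\<Sum>p\<leftarrow>ps. \<Sum>p'\<leftarrow>ps. snd p * cnj (snd p') * q (fst p \<otimes> inv (fst p'))
       + snd p * cnj (m * snd p') * q (fst p \<otimes> inv (fst p' \<otimes> a))
       + (m * snd p * cnj (snd p') * q (fst p \<otimes> a \<otimes> inv (fst p'))
       + m * snd p * cnj (m * snd p') * q (fst p \<otimes> a \<otimes> inv (fst p' \<otimes> a))))"
      unfolding form_def by (intro arg_cong[where f = sum_list] map_cong refl eq)
    also have "\<dots> = form q (ps @ ps')"
      unfolding form_def ps'_def by (simp add: sum_list_addf o_def)
    finally have "form ?r ps = form q (ps @ ps')" .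
    moreover have "fst ` set (ps @ ps') \<subseteq> carrier G"
      using ps a unfolding ps'_def by auto
    ultimately show ?thesis using q unfolding positive_definite_def by metis
  qed
  ultimately show ?thesis unfolding positive_definite_def by blast
qed

lemma positive_definite_scale:
  assumes "positive_definite q" "0 \<le> c"
  shows "positive_definite (\<lambda>y. complex_of_real c * q y)"
proof -
  have "form (\<lambda>y. complex_of_real c * q y) ps = complex_of_real c * form q ps" for ps
    unfolding form_def by (simp add: sum_list_const_mult[symmetric] ac_simps)
  then show ?thesis using assms unfolding positive_definite_def by simp
qed

text \<open>The perturbations for \<open>l\<close> and \<open>- l\<close> add up to a multiple of
  \<open>q\<close>. Normalised, they exhibit \<open>q\<close> as a convex combination of two states,
  so extremality makes the one for \<open>l\<close> proportional to \<open>q\<close>. That is a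
  linear equation for the values of \<open>q\<close> at \<open>y \<otimes> a\<close> and
  \<open>y \<otimes> inv a\<close>; taking \<open>l = 1\<close> and \<open>l = \<i>\<close> and
  eliminating the second value leaves multiplicativity. Modulus 1 then comes from
  \<open>q (inv x) = cnj (q x)\<close>.\<close>

lemma extreme_state_multiplicative:
  assumes q: "q \<in> states"
    and extreme: "\<And>t p p'. p \<in> states \<Longrightarrow> p' \<in> states \<Longrightarrow> 0 < t \<Longrightarrow> t < 1 \<Longrightarrow>
      (\<lambda>x. complex_of_real t * p x + complex_of_real (1 - t) * p' x) = q \<Longrightarrow> p = q"
  shows "q \<in> unitary_characters"
proof -
  have pd: "positive_definite q" and q1: "q \<one> = 1" and q0: "\<And>x. x \<notin> carrier G \<Longrightarrow> q x = 0"
    using q unfolding states_def by auto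
  have her: "q (inv x) = cnj (q x)" if "x \<in> carrier G" for x
    using pd that unfolding positive_definite_def by blast
  have key: "l * q (y \<otimes> a) + cnj l * q (y \<otimes> inv a) = 2 * Re (l * q a) * q y"
    if a: "a \<in> carrier G" and y: "y \<in> carrier G" and l: "norm l = 1" for a y l
  proof -
    define r where "r l y = (if y \<in> carrier G
      then 5 / 4 * q y + (l * q (y \<otimes> a) + cnj l * q (y \<otimes> inv a)) / 2 else 0)" for l y
    define \<rho> where "\<rho> = Re (l * q a)"
    have "\<bar>\<rho>\<bar> \<le> norm (l * q a)" unfolding \<rho>_def by (rule abs_Re_le_cmod)
    also have "\<dots> \<le> 1" using l states_bound[OF q] by (simp add: norm_mult)
    finally have \<rho>: "\<bar>\<rho>\<bar> \<le> 1" .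
    \<comment> \<open>The values of the two perturbations at the identity. Since \<rho> is at most 1
      in modulus, both are positive and one can divide by them.\<close>
    define c1 c2 where "c1 = 5 / 4 + \<rho>" and "c2 = 5 / 4 - \<rho>"
    have c: "c1 > 0" "c2 > 0" "c1 + c2 = 5 / 2" using \<rho> by (auto simp: c1_def c2_def)
    have "cnj l * q (inv a) = cnj (l * q a)" using a by (simp add: her)
    then have r1: "r l \<one> = of_real c1" "r (- l) \<one> = of_real c2"
      using a by (simp_all add: r_def q1 \<rho>_def c1_def c2_def complex_eq_iff)
    define t where "t = c1 / (5 / 2)"
    have t: "0 < t" "t < 1" "1 - t = c2 / (5 / 2)" using c by (auto simp: t_def field_simps)
    have pdr: "positive_definite (r l')" if "norm l' = 1" for l'
      using positive_definite_perturb[OF pd a that] by (simp add: r_def[abs_def])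
    have st: "(\<lambda>y. complex_of_real c * r l' y) \<in> states"
      if "norm l' = 1" "0 \<le> c" "complex_of_real c * r l' \<one> = 1" for c l'
      using positive_definite_scale[OF pdr[OF that(1)] that(2)] that(3)
      unfolding states_def by (auto simp: r_def)
    have st1: "(\<lambda>y. complex_of_real (1 / c1) * r l y) \<in> states"
      by (rule st) (use l c in \<open>auto simp: r1\<close>)
    have st2: "(\<lambda>y. complex_of_real (1 / c2) * r (- l) y) \<in> states"
      by (rule st) (use l c in \<open>auto simp: r1\<close>)
    \<comment> \<open>The weights are proportional to \<open>c1\<close> and \<open>c2\<close> and
      cancel the normalisations; what remains is 2/5 of the sum of the perturbations, whose terms in
      \<open>l\<close> cancel.\<close>
    have mix: "(\<lambda>y. complex_of_real t * (complex_of_real (1 / c1) * r l y) +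
      complex_of_real (1 - t) * (complex_of_real (1 / c2) * r (- l) y)) = q"
    proof
      fix y
      have "t * (1 / c1) = 2 / 5" "(1 - t) * (1 / c2) = 2 / 5"
        unfolding t(3) using c by (simp_all add: t_def)
      then have "complex_of_real t * (complex_of_real (1 / c1) * r l y) +
        complex_of_real (1 - t) * (complex_of_real (1 / c2) * r (- l) y) =
        complex_of_real (2 / 5) * r l y + complex_of_real (2 / 5) * r (- l) y"
        by (simp only: mult.assoc[symmetric] of_real_mult[symmetric])
      also have "\<dots> = q y" using q0[of y] by (simp add: r_def field_simps)
      finally show "complex_of_real t * (complex_of_real (1 / c1) * r l y) +
        complex_of_real (1 - t) * (complex_of_real (1 / c2) * r (- l) y) = q y" .
    qed
    have "(\<lambda>y. complex_of_real (1 / c1) * r l y) = q"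
      by (rule extreme[OF st1 st2 t(1,2) mix])
    then have "complex_of_real (1 / c1) * r l y = q y" by (rule fun_cong)
    then have "r l y = of_real c1 * q y" using c(1) by (auto simp: field_simps)
    then show ?thesis using y unfolding \<rho>_def[symmetric] by (simp add: r_def c1_def algebra_simps)
  qed
  have mult: "q (y \<otimes> a) = q y * q a" if a: "a \<in> carrier G" and y: "y \<in> carrier G" for a y
  proof -
    have 1: "q (y \<otimes> a) + q (y \<otimes> inv a) = 2 * Re (q a) * q y"
      using key[OF a y, of 1] by simp
    have "\<i> * (q (y \<otimes> a) - q (y \<otimes> inv a)) = - 2 * Im (q a) * q y"
      using key[OF a y, of \<i>] by (simp add: algebra_simps)
    then have "\<i> * (\<i> * (q (y \<otimes> a) - q (y \<otimes> inv a))) = \<i> * (- 2 * Im (q a) * q y)"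
      by simp
    then have 2: "q (y \<otimes> a) - q (y \<otimes> inv a) = 2 * \<i> * Im (q a) * q y"
      by (simp add: algebra_simps)
    have "2 * q (y \<otimes> a) = 2 * ((Re (q a) + \<i> * Im (q a)) * q y)"
      using arg_cong2[OF 1 2, of "(+)"] by (simp add: algebra_simps)
    then show ?thesis by (simp flip: complex_eq)
  qed
  have "norm (q x) = 1" if x: "x \<in> carrier G" for x
  proof -
    have "q x * cnj (q x) = 1" using mult[of "inv x" x] x her q1 by simp
    then have "complex_of_real ((norm (q x))\<^sup>2) = 1" by (simp only: complex_norm_square)
    then have "(norm (q x))\<^sup>2 = 1" by (simp only: of_real_eq_1_iff)
    then show ?thesis by (metis norm_ge_zero power2_eq_iff_nonneg power_one zero_le_one)
  qed
  then show ?thesis using q0 mult unfolding unitary_characters_def by blast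
qed

text \<open>The list encodes a functional on states that is continuous and affine, so an extreme
  state does at least as well as \<open>q0\<close>, and extreme states are characters. It will be
  applied to the energy of a fixed list.\<close>

lemma character_above_state:
  assumes "q0 \<in> states"
  obtains \<psi> where "\<psi> \<in> unitary_characters"
    "(\<Sum>p\<leftarrow>ps. Re (snd p * q0 (fst p))) \<le> (\<Sum>p\<leftarrow>ps. Re (snd p * \<psi> (fst p)))"
proof -
  define \<Phi> where "\<Phi> q = (\<Sum>p\<leftarrow>ps. Re (snd p * q (fst p)))" for q
  have cont: "continuous_on UNIV \<Phi>"
    unfolding \<Phi>_def by (intro continuous_on_sum_list continuous_intros continuous_on_product_coordinates)
  have aff: "\<Phi> (\<lambda>x. complex_of_real t * q x + complex_of_real (1 - t) * p x) = t * \<Phi> q + (1 - t) * \<Phi> p"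
    for t q p
    unfolding \<Phi>_def by (induction ps) (auto simp: algebra_simps)
  obtain \<psi> where \<psi>: "\<psi> \<in> states" "\<Phi> q0 \<le> \<Phi> \<psi>"
    and ext: "\<And>t q p. q \<in> states \<Longrightarrow> p \<in> states \<Longrightarrow> 0 < t \<Longrightarrow> t < 1 \<Longrightarrow>
      (\<lambda>x. complex_of_real t * q x + complex_of_real (1 - t) * p x) = \<psi> \<Longrightarrow> q = \<psi>"
    using extreme_point_above[OF compact_states closed_states assms cont aff] by blast
  have "\<psi> \<in> unitary_characters" by (rule extreme_state_multiplicative[OF \<psi>(1) ext])
  then show thesis using that \<psi>(2) unfolding \<Phi>_def by blast
qed

end

section \<open>Energy of characters\<close>

lemma continuous_map_euclidean_compose:
  assumes "continuous_map X euclidean f" "continuous_on UNIV h"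
  shows "continuous_map X euclidean (\<lambda>x. h (f x))"
  using continuous_map_compose[OF assms(1), of euclidean h] assms(2) by (simp add: o_def)

lemma continuous_map_sum_list:
  fixes f :: "'b \<Rightarrow> 'c \<Rightarrow> 'd::real_normed_vector"
  assumes "\<And>a. a \<in> set L \<Longrightarrow> continuous_map X euclidean (f a)"
  shows "continuous_map X euclidean (\<lambda>x. \<Sum>a\<leftarrow>L. f a x)"
  using assms by (induction L) (auto intro!: continuous_map_add)

lemma continuous_map_epsI:
  fixes f :: "'b \<Rightarrow> 'c::metric_space"
  assumes "\<And>x e. x \<in> topspace X \<Longrightarrow> e > 0 \<Longrightarrow> \<exists>U. openin X U \<and> x \<in> U \<and> (\<forall>y\<in>U. dist (f y) (f x) < e)"
  shows "continuous_map X euclidean f"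
  unfolding continuous_map_def
proof (intro conjI allI impI)
  fix U :: "'c set" assume "openin euclidean U"
  then have U: "open U" by simp
  show "openin X {x \<in> topspace X. f x \<in> U}"
  proof (subst openin_subopen, intro ballI)
    fix x assume x: "x \<in> {x \<in> topspace X. f x \<in> U}"
    then obtain e where e: "e > 0" "ball (f x) e \<subseteq> U" using U openE by blast
    obtain V where V: "openin X V" "x \<in> V" "\<forall>y\<in>V. dist (f y) (f x) < e"
      using assms[of x e] x e by blast
    moreover have "V \<subseteq> {x \<in> topspace X. f x \<in> U}"
      using V e(2) openin_subset[OF V(1)] by (force simp: dist_commute)
    ultimately show "\<exists>V. openin X V \<and> x \<in> V \<and> V \<subseteq> {x \<in> topspace X. f x \<in> U}" by blast
  qed
qed simp

lemma norm_sum_list_square: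
  fixes A :: "'b \<Rightarrow> complex"
  shows "(norm (\<Sum>p\<leftarrow>ps. A p))\<^sup>2 = (\<Sum>p\<leftarrow>ps. \<Sum>p'\<leftarrow>ps. Re (A p * cnj (A p')))"
proof -
  have cnj: "cnj (\<Sum>p\<leftarrow>ps. A p) = (\<Sum>p\<leftarrow>ps. cnj (A p))" for ps :: "'b list" by (induction ps) auto
  have "complex_of_real ((norm (\<Sum>p\<leftarrow>ps. A p))\<^sup>2) = (\<Sum>p\<leftarrow>ps. \<Sum>p'\<leftarrow>ps. A p * cnj (A p'))"
    unfolding complex_norm_square cnj by (simp add: sum_list_mult_const sum_list_const_mult)
  from arg_cong[OF this, of Re] show ?thesis by (simp only: Re_sum_list Re_complex_of_real)
qed

lemma sum_list_square_le:
  fixes f :: "'b \<Rightarrow> real"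
  shows "(\<Sum>a\<leftarrow>L. f a)\<^sup>2 \<le> length L * (\<Sum>a\<leftarrow>L. (f a)\<^sup>2)"
proof (induction L)
  case (Cons a L)
  define n s S where "n = real (length L)" and "s = (\<Sum>a\<leftarrow>L. f a)" and "S = (\<Sum>a\<leftarrow>L. (f a)\<^sup>2)"
  have IH: "s\<^sup>2 \<le> n * S" using Cons by (simp add: n_def s_def S_def)
  have "2 * s * f a \<le> S + n * (f a)\<^sup>2"
  proof (cases "L = []")
    case False
    then have n: "n > 0" by (simp add: n_def)
    have "0 \<le> (s - n * f a)\<^sup>2" by simp
    then have "n * (2 * s * f a) \<le> s\<^sup>2 + n * (n * (f a)\<^sup>2)"
      by (simp add: power2_eq_square algebra_simps)
    also have "\<dots> \<le> n * (S + n * (f a)\<^sup>2)" using IH by (simp add: algebra_simps)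
    finally show ?thesis using n by simp
  qed (simp add: n_def s_def S_def)
  then have "(f a + s)\<^sup>2 \<le> (1 + n) * ((f a)\<^sup>2 + S)"
    using IH by (simp add: power2_sum algebra_simps)
  then show ?case by (simp add: n_def s_def S_def)
qed simp

text \<open>Used with a finite cover by translates: however long \<open>L\<close> is, one translate
  contains a proportion of its entries that does not depend on \<open>L\<close>.\<close>

lemma pigeonhole_list:
  assumes "bs \<noteq> []" "L \<noteq> []" "\<And>a. a \<in> set L \<Longrightarrow> \<exists>b\<in>set bs. P b a"
  obtains b where "b \<in> set bs" "length L \<le> length bs * length (filter (P b) L)"
proof (rule ccontr)
  assume "\<not> thesis"
  with that have less: "length bs * length (filter (P b) L) < length L" if "b \<in> set bs" for b
    using that by (meson not_le)
  have "length L \<le> (\<Sum>b\<leftarrow>bs. length (filter (P b) L))"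
    using assms(3)
  proof (induction L)
    case (Cons a L)
    obtain b where b: "b \<in> set bs" "P b a" using Cons.prems by auto
    have "1 \<le> (\<Sum>b\<leftarrow>bs. if P b a then 1 else 0 :: nat)"
      using member_le_sum_list[of "1::nat" "map (\<lambda>b. if P b a then 1 else 0) bs"] b by force
    moreover have "(\<Sum>b\<leftarrow>bs. length (filter (P b) (a # L))) =
      (\<Sum>b\<leftarrow>bs. (if P b a then 1 else 0) + length (filter (P b) L))"
      by (intro arg_cong[where f = sum_list] map_cong) auto
    ultimately show ?case using Cons by (simp add: sum_list_addf)
  qed simp
  moreover have "\<bar>\<Sum>b\<leftarrow>bs. real (length (filter (P b) L))\<bar>
      \<le> real (length bs) * ((real (length L) - 1) / real (length bs))"
  proof (rule sum_list_bound)
    fix b assume "b \<in> set bs"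
    \<comment> \<open>A strict inequality of naturals leaves room for 1. Summed over
      \<open>bs\<close>, the bounds then account for at most \<open>length L - 1\<close>
      entries.\<close>
    then have "length bs * length (filter (P b) L) + 1 \<le> length L" using less by fastforce
    then have "real (length bs * length (filter (P b) L) + 1) \<le> real (length L)" by (rule of_nat_mono)
    then show "\<bar>real (length (filter (P b) L))\<bar> \<le> (real (length L) - 1) / real (length bs)"
      using assms(1) by (simp add: field_simps)
  qed
  moreover have "(\<Sum>b\<leftarrow>bs. real (length (filter (P b) L))) = real (\<Sum>b\<leftarrow>bs. length (filter (P b) L))"
    by (induction bs) auto
  ultimately show False using assms(1) by simp
qed

context comm_group
begin

lemma unitary_character_one:
  assumes "\<psi> \<in> unitary_characters"
  shows "\<psi> \<one> = 1"
proof -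
  have "\<psi> (\<one> \<otimes> \<one>) = \<psi> \<one> * \<psi> \<one>" "norm (\<psi> \<one>) = 1"
    using assms unfolding unitary_characters_def by blast+
  then show ?thesis by auto
qed

lemma unitary_character_inv:
  assumes "\<psi> \<in> unitary_characters" "x \<in> carrier G"
  shows "\<psi> (inv x) = cnj (\<psi> x)"
proof -
  have 1: "\<psi> (inv x) * \<psi> x = 1"
    using assms unitary_character_one[OF assms(1)] unfolding unitary_characters_def
    by (metis (mono_tags, lifting) inv_closed l_inv mem_Collect_eq)
  moreover have "cnj (\<psi> x) * \<psi> x = 1"
    using assms complex_norm_square[of "\<psi> x"] unfolding unitary_characters_def by (simp add: mult.commute)
  ultimately show ?thesis by (metis mult_cancel_right mult_zero_right zero_neq_one)
qed

end

section \<open>The autocorrelation as a state, and its energy\<close>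

context compact_abelian_group
begin

lemma mean_sum_list:
  assumes "\<And>a. a \<in> set L \<Longrightarrow> continuous_map T euclideanreal (f a)"
  shows "mean (\<lambda>x. \<Sum>a\<leftarrow>L. f a x) = (\<Sum>a\<leftarrow>L. mean (f a))"
  using assms
proof (induction L)
  case (Cons a L)
  then show ?case by (simp add: mean_add continuous_map_sum_list)
qed (simp add: mean_const)

definition autocorrelation :: "('a \<Rightarrow> real) \<Rightarrow> 'a \<Rightarrow> real"
  where "autocorrelation g x = mean (\<lambda>z. g (x \<otimes> z) * g z)"

lemma mean_translates:
  assumes g: "continuous_map T euclideanreal g" and ab: "a \<in> carrier G" "b \<in> carrier G"
  shows "mean (\<lambda>z. g (a \<otimes> z) * g (b \<otimes> z)) = autocorrelation g (a \<otimes> inv b)"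
proof -
  have cont: "continuous_map T euclideanreal (\<lambda>z. g (a \<otimes> z) * g (b \<otimes> z))"
    by (intro continuous_map_real_mult continuous_map_translate[OF g] ab)
  have "mean (\<lambda>z. g (a \<otimes> z) * g (b \<otimes> z)) = mean (\<lambda>z. g (a \<otimes> (inv b \<otimes> z)) * g (b \<otimes> (inv b \<otimes> z)))"
    using mean_translate[OF cont, of "inv b"] ab by simp
  also have "\<dots> = autocorrelation g (a \<otimes> inv b)"
    unfolding autocorrelation_def
  proof (rule mean_cong)
    fix z assume z: "z \<in> carrier G"
    have "b \<otimes> (inv b \<otimes> z) = z" using ab z by (simp flip: m_assoc)
    then show "g (a \<otimes> (inv b \<otimes> z)) * g (b \<otimes> (inv b \<otimes> z)) = g (a \<otimes> inv b \<otimes> z) * g z"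
      using ab z by (simp add: m_assoc)
  qed
  finally show ?thesis .
qed

text \<open>This is why the autocorrelation is positive definite: its form is the mean of a square.
  Expanding the square produces means of products of two translates of \<open>g\<close>, and these
  depend only on the quotient of the translations.\<close>

lemma mean_norm_square:
  assumes g: "continuous_map T euclideanreal g" and ps: "fst ` set ps \<subseteq> carrier G"
  shows "mean (\<lambda>z. (norm (\<Sum>p\<leftarrow>ps. snd p * complex_of_real (g (fst p \<otimes> z))))\<^sup>2) =
    Re (form (\<lambda>x. complex_of_real (autocorrelation g x)) ps)"
proof -
  have cont: "continuous_map T euclideanreal (\<lambda>z. g (fst p \<otimes> z) * g (fst p' \<otimes> z))"
    if "p \<in> set ps" "p' \<in> set ps" for p p'
    by (intro continuous_map_real_mult continuous_map_translate[OF g]) (use that ps in auto)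
  have cont': "continuous_map T euclideanreal
      (\<lambda>z. Re (snd p * cnj (snd p')) * (g (fst p \<otimes> z) * g (fst p' \<otimes> z)))"
    if "p \<in> set ps" "p' \<in> set ps" for p p'
    using continuous_map_real_mult_left[OF cont[OF that]] by simp
  have "(norm (\<Sum>p\<leftarrow>ps. snd p * complex_of_real (g (fst p \<otimes> z))))\<^sup>2 =
    (\<Sum>p\<leftarrow>ps. \<Sum>p'\<leftarrow>ps. Re (snd p * cnj (snd p')) * (g (fst p \<otimes> z) * g (fst p' \<otimes> z)))" for z
    unfolding norm_sum_list_square by (simp add: algebra_simps)
  then have "mean (\<lambda>z. (norm (\<Sum>p\<leftarrow>ps. snd p * complex_of_real (g (fst p \<otimes> z))))\<^sup>2) =
    mean (\<lambda>z. \<Sum>p\<leftarrow>ps. \<Sum>p'\<leftarrow>ps. Re (snd p * cnj (snd p')) * (g (fst p \<otimes> z) * g (fst p' \<otimes> z)))"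
    by simp
  also have "\<dots> = (\<Sum>p\<leftarrow>ps. mean (\<lambda>z. \<Sum>p'\<leftarrow>ps. Re (snd p * cnj (snd p')) * (g (fst p \<otimes> z) * g (fst p' \<otimes> z))))"
    by (intro mean_sum_list continuous_map_sum_list cont')
  also have "\<dots> = (\<Sum>p\<leftarrow>ps. \<Sum>p'\<leftarrow>ps. mean (\<lambda>z. Re (snd p * cnj (snd p')) * (g (fst p \<otimes> z) * g (fst p' \<otimes> z))))"
    by (intro arg_cong[where f = sum_list] map_cong refl mean_sum_list cont')
  also have "\<dots> = (\<Sum>p\<leftarrow>ps. \<Sum>p'\<leftarrow>ps. Re (snd p * cnj (snd p')) * autocorrelation g (fst p \<otimes> inv (fst p')))"
    using ps by (intro arg_cong[where f = sum_list] map_cong refl)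
      (simp add: mean_cmult[OF cont] mean_translates[OF g] image_subset_iff)
  also have "\<dots> = Re (form (\<lambda>x. complex_of_real (autocorrelation g x)) ps)"
    unfolding form_def Re_sum_list by (simp add: algebra_simps)
  finally show ?thesis .
qed

lemma autocorrelation_inv:
  assumes g: "continuous_map T euclideanreal g" and x: "x \<in> carrier G"
  shows "autocorrelation g (inv x) = autocorrelation g x"
proof -
  have "autocorrelation g (inv x) = mean (\<lambda>z. g (\<one> \<otimes> z) * g (x \<otimes> z))"
    using mean_translates[OF g one_closed x] x by simp
  also have "\<dots> = mean (\<lambda>z. g (x \<otimes> z) * g (\<one> \<otimes> z))" by (simp add: mult.commute)
  also have "\<dots> = autocorrelation g x"
    using mean_translates[OF g x one_closed] x by simp
  finally show ?thesis .
qed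

text \<open>Near the identity the square of \<open>g\<close> exceeds half its value there. Finitely
  many translates of that neighbourhood cover the group, so a finite sum of translates of the square
  is bounded below by a positive constant, and all these translates have the same mean.\<close>

lemma mean_square_pos:
  assumes g: "continuous_map T euclideanreal g" and "g \<one> \<noteq> 0"
  shows "autocorrelation g \<one> > 0"
proof -
  define V where "V = {x \<in> topspace T. g x * g x \<in> {(g \<one>)\<^sup>2 / 2 <..}}"
  have gg: "continuous_map T euclideanreal (\<lambda>x. g x * g x)"
    by (intro continuous_map_real_mult g)
  have V: "openin T V" "\<one> \<in> V"
    unfolding V_def using openin_continuous_map_preimage[OF gg, of "{(g \<one>)\<^sup>2 / 2 <..}"] assms(2)
    by (auto simp: topspace_eq power2_eq_square zero_less_mult_iff linorder_neq_iff)
  obtain bs where bs: "bs \<noteq> []" "set bs \<subseteq> carrier G"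
    and cover: "\<And>x. x \<in> carrier G \<Longrightarrow> \<exists>b\<in>set bs. \<exists>v\<in>V. x = b \<otimes> v"
    using finite_translates_cover[OF V] by blast
  have trans: "continuous_map T euclideanreal (\<lambda>x. g (inv b \<otimes> x) * g (inv b \<otimes> x))" if "b \<in> set bs" for b
    by (intro continuous_map_real_mult continuous_map_translate[OF g]) (use bs that in auto)
  have "(g \<one>)\<^sup>2 / 2 \<le> (\<Sum>b\<leftarrow>bs. g (inv b \<otimes> x) * g (inv b \<otimes> x))" if x: "x \<in> carrier G" for x
  proof -
    obtain b v where b: "b \<in> set bs" "v \<in> V" "x = b \<otimes> v" using cover[OF x] by blast
    have "b \<in> carrier G" "v \<in> carrier G" using b bs by (auto simp: V_def topspace_eq)
    then have "inv b \<otimes> x = v" using b by (simp flip: m_assoc)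
    then have "(g \<one>)\<^sup>2 / 2 \<le> g (inv b \<otimes> x) * g (inv b \<otimes> x)" using b(2) by (simp add: V_def)
    also have "\<dots> \<le> (\<Sum>b\<leftarrow>bs. g (inv b \<otimes> x) * g (inv b \<otimes> x))"
      unfolding sum_list_map_remove1[OF b(1), of "\<lambda>b. g (inv b \<otimes> x) * g (inv b \<otimes> x)"]
      by (auto intro!: sum_list_nonneg)
    finally show ?thesis .
  qed
  then have "mean (\<lambda>x. (g \<one>)\<^sup>2 / 2) \<le> mean (\<lambda>x. \<Sum>b\<leftarrow>bs. g (inv b \<otimes> x) * g (inv b \<otimes> x))"
    by (intro mean_mono continuous_map_sum_list trans) auto
  also have "\<dots> = (\<Sum>b\<leftarrow>bs. mean (\<lambda>x. g (inv b \<otimes> x) * g (inv b \<otimes> x)))"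
    by (intro mean_sum_list trans)
  also have "\<dots> = (\<Sum>b\<leftarrow>bs. autocorrelation g \<one>)"
    using bs by (intro arg_cong[where f = sum_list] map_cong refl)
      (use mean_translates[OF g] in \<open>auto simp: subset_eq\<close>)
  finally have "(g \<one>)\<^sup>2 / 2 \<le> length bs * autocorrelation g \<one>"
    by (simp add: mean_const sum_list_triv)
  moreover have "(g \<one>)\<^sup>2 / 2 > 0" using assms(2) by simp
  ultimately have "0 < length bs * autocorrelation g \<one>" by linarith
  then show ?thesis by (simp add: zero_less_mult_iff)
qed

lemma autocorrelation_state:
  assumes g: "continuous_map T euclideanreal g" and "g \<one> \<noteq> 0"
  shows "(\<lambda>x. if x \<in> carrier G then complex_of_real (autocorrelation g x / autocorrelation g \<one>) else 0) \<in> states"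
    (is "?q \<in> _")
proof -
  define c where "c = 1 / autocorrelation g \<one>"
  have c: "c \<ge> 0" using mean_square_pos[OF assms] by (simp add: c_def)
  have "0 \<le> Re (form ?q ps)" if ps: "fst ` set ps \<subseteq> carrier G" for ps
  proof -
    have "form ?q ps = complex_of_real c * form (\<lambda>x. complex_of_real (autocorrelation g x)) ps"
      unfolding form_def sum_list_const_mult[symmetric] using ps
      by (intro arg_cong[where f = sum_list] map_cong refl) (auto simp: c_def)
    moreover have "0 \<le> Re (form (\<lambda>x. complex_of_real (autocorrelation g x)) ps)"
      unfolding mean_norm_square[OF g ps, symmetric]
    proof (rule mean_nonneg)
      show "continuous_map T euclideanreal (\<lambda>x. (norm (\<Sum>p\<leftarrow>ps. snd p * complex_of_real (g (fst p \<otimes> x))))\<^sup>2)"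
        by (rule continuous_map_euclidean_compose[where h = "\<lambda>u. (norm u)\<^sup>2"], rule continuous_map_sum_list,
            rule continuous_map_euclidean_compose[where h = "\<lambda>u. _ * complex_of_real u"], rule continuous_map_translate[OF g])
          (use ps in \<open>auto intro!: continuous_intros\<close>)
    qed simp
    ultimately show ?thesis using c by simp
  qed
  then show ?thesis
    using mean_square_pos[OF assms] autocorrelation_inv[OF g]
    unfolding states_def positive_definite_def by auto
qed

text \<open>Replacing \<open>b \<otimes> z\<close> by its translates by \<open>u\<close> and
  \<open>v\<close> changes each factor \<open>g\<close> by at most \<open>e\<close>, and with
  \<open>e = k1 / (4 * B)\<close> the product changes by at most k1/2. The mean of the unperturbed
  product is \<open>k1\<close>.\<close>

lemma autocorrelation_near:
  assumes g: "continuous_map T euclideanreal g" and "g \<one> \<noteq> 0"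
  obtains V where "openin T V" "\<one> \<in> V"
    "\<And>b u v. b \<in> carrier G \<Longrightarrow> u \<in> V \<Longrightarrow> v \<in> V \<Longrightarrow>
      autocorrelation g \<one> / 2 \<le> autocorrelation g (b \<otimes> u \<otimes> inv (b \<otimes> v))"
proof -
  define k1 where "k1 = autocorrelation g \<one>"
  have k1: "k1 > 0" using mean_square_pos[OF assms] by (simp add: k1_def)
  obtain B where B: "B > 0" "\<And>x. x \<in> carrier G \<Longrightarrow> norm (g x) \<le> B"
    using continuous_bounded[OF g] by blast
  define e where "e = k1 / (4 * B)"
  have e: "e > 0" using k1 B by (simp add: e_def)
  obtain V where V: "openin T V" "\<one> \<in> V"
    and unif: "\<And>x v. x \<in> carrier G \<Longrightarrow> v \<in> V \<Longrightarrow> norm (g (x \<otimes> v) - g x) < e"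
    using uniform_continuity[OF g e] by blast
  have "k1 / 2 \<le> autocorrelation g (b \<otimes> u \<otimes> inv (b \<otimes> v))"
    if b: "b \<in> carrier G" and uv: "u \<in> V" "v \<in> V" for b u v
  proof -
    have G: "u \<in> carrier G" "v \<in> carrier G" using uv V(1) openin_subset topspace_eq by blast+
    have "g (b \<otimes> z) * g (b \<otimes> z) - k1 / 2 \<le> g (b \<otimes> u \<otimes> z) * g (b \<otimes> v \<otimes> z)"
      if z: "z \<in> carrier G" for z
    proof -
      have bz: "b \<otimes> z \<in> carrier G" using b z by simp
      have eq: "b \<otimes> u \<otimes> z = (b \<otimes> z) \<otimes> u" "b \<otimes> v \<otimes> z = (b \<otimes> z) \<otimes> v"
        using b z G by (simp_all add: m_ac)
      define s p q where "s = g (b \<otimes> z)" and "p = g (b \<otimes> u \<otimes> z)" and "q = g (b \<otimes> v \<otimes> z)"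
      have d: "\<bar>p - s\<bar> \<le> e" "\<bar>q - s\<bar> \<le> e"
        using unif[OF bz uv(1)] unif[OF bz uv(2)] unfolding s_def p_def q_def eq by auto
      have bd: "\<bar>s\<bar> \<le> B" "\<bar>q\<bar> \<le> B"
        unfolding s_def q_def using B(2)[of "b \<otimes> z"] B(2)[of "b \<otimes> v \<otimes> z"] b z G by auto
      have "\<bar>p * q - s * s\<bar> = \<bar>(p - s) * q + s * (q - s)\<bar>" by (simp add: algebra_simps)
      also have "\<dots> \<le> \<bar>p - s\<bar> * \<bar>q\<bar> + \<bar>s\<bar> * \<bar>q - s\<bar>"
        by (metis abs_mult abs_triangle_ineq)
      also have "\<dots> \<le> e * B + B * e"
        using d bd B(1) e by (intro add_mono mult_mono) auto
      also have "\<dots> = k1 / 2" using B(1) by (simp add: e_def)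
      finally have "s * s - k1 / 2 \<le> p * q" by linarith
      then show ?thesis unfolding s_def p_def q_def .
    qed
    then have "mean (\<lambda>z. g (b \<otimes> z) * g (b \<otimes> z) - k1 / 2) \<le> mean (\<lambda>z. g (b \<otimes> u \<otimes> z) * g (b \<otimes> v \<otimes> z))"
      using b G by (intro mean_mono continuous_map_diff continuous_map_real_mult continuous_map_translate[OF g]) auto
    moreover have "mean (\<lambda>z. g (b \<otimes> z) * g (b \<otimes> z) - k1 / 2) = k1 - k1 / 2"
      using b by (subst mean_diff) (auto intro!: continuous_map_real_mult continuous_map_translate[OF g]
          simp: mean_translates[OF g] mean_const k1_def)
    ultimately show ?thesis using mean_translates[OF g, of "b \<otimes> u" "b \<otimes> v"] b G by simp
  qed
  then show thesis using that V unfolding k1_def by blast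
qed

text \<open>For a character this is the mean square of a twisted average of \<open>g\<close>, see
  \<open>energy_character\<close>. The double sum makes sense for every state and is real-linear and
  continuous in \<open>q\<close>, as the extreme point argument and the compactness argument
  require.\<close>

definition energy :: "('a \<Rightarrow> real) \<Rightarrow> 'a list \<Rightarrow> ('a \<Rightarrow> complex) \<Rightarrow> real"
  where "energy g L q = (\<Sum>a\<leftarrow>L. \<Sum>b\<leftarrow>L. Re (q (a \<otimes> inv b)) * autocorrelation g (a \<otimes> inv b)) / (length L)\<^sup>2"

text \<open>At the state obtained from the autocorrelation every summand is a square over
  \<open>k1\<close>, hence nonnegative. One of the N translates of \<open>V\<close> holds at least a
  fraction 1/N of the entries of \<open>L\<close>, and each pair of entries from it contributes at
  least k1/4. This gives a bound k1/(4 N^2) independent of \<open>L\<close>.\<close>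

lemma energy_autocorrelation:
  assumes g: "continuous_map T euclideanreal g" and "g \<one> \<noteq> 0"
  obtains c where "c > 0" "\<And>L. shifts L \<Longrightarrow>
    c \<le> energy g L (\<lambda>x. if x \<in> carrier G then complex_of_real (autocorrelation g x / autocorrelation g \<one>) else 0)"
proof -
  define k1 where "k1 = autocorrelation g \<one>"
  have k1: "k1 > 0" using mean_square_pos[OF assms] by (simp add: k1_def)
  obtain V where V: "openin T V" "\<one> \<in> V"
    and near: "\<And>b u v. b \<in> carrier G \<Longrightarrow> u \<in> V \<Longrightarrow> v \<in> V \<Longrightarrow>
      k1 / 2 \<le> autocorrelation g (b \<otimes> u \<otimes> inv (b \<otimes> v))"
    using autocorrelation_near[OF assms] unfolding k1_def by blast
  obtain bs where bs: "bs \<noteq> []" "set bs \<subseteq> carrier G"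
    and cover: "\<And>x. x \<in> carrier G \<Longrightarrow> \<exists>b\<in>set bs. \<exists>v\<in>V. x = b \<otimes> v"
    using finite_translates_cover[OF V] by blast
  define N where "N = real (length bs)"
  have N: "N > 0" using bs by (simp add: N_def)
  let ?q = "\<lambda>x. if x \<in> carrier G then complex_of_real (autocorrelation g x / autocorrelation g \<one>) else 0"
  have "k1 / (4 * N\<^sup>2) \<le> energy g L ?q" if L: "shifts L" for L
  proof -
    define P where "P b a \<longleftrightarrow> (\<exists>v\<in>V. a = b \<otimes> v)" for b a
    have "\<exists>b\<in>set bs. P b a" if "a \<in> set L" for a
      using cover[of a] L that unfolding P_def shifts_def by blast
    then obtain b where b: "b \<in> set bs" "length L \<le> length bs * length (filter (P b) L)"
      using pigeonhole_list[OF bs(1), of L P] L unfolding shifts_def by blast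
    define n m where "n = real (length L)" and "m = real (length (filter (P b) L))"
    have n: "n > 0" using L by (simp add: n_def shifts_def)
    have nm: "n \<le> N * m" using b(2) unfolding n_def N_def m_def by (metis of_nat_mono of_nat_mult)
    have bG: "b \<in> carrier G" using b bs by auto
    have trm: "(if P b x then 1 else 0) * ((if P b y then 1 else 0) * (k1 / 4)) \<le>
      Re (?q (x \<otimes> inv y)) * autocorrelation g (x \<otimes> inv y)" if "x \<in> set L" "y \<in> set L" for x y
    proof -
      have G: "x \<otimes> inv y \<in> carrier G" using that L by (auto simp: shifts_def)
      define k where "k = autocorrelation g (x \<otimes> inv y)"
      have eq: "Re (?q (x \<otimes> inv y)) * k = k * k / k1"
        using G by (simp add: k_def k1_def)
      show ?thesis
      proof (cases "P b x \<and> P b y")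
        case True
        then have "k1 / 2 \<le> k" unfolding P_def k_def using near[OF bG] by blast
        then have "k1 / 2 * (k1 / 2) \<le> k * k" using k1 by (intro mult_mono) auto
        then have "k1 / 4 \<le> k * k / k1" using k1 by (simp add: field_simps)
        then show ?thesis using True eq by (simp add: k_def)
      next
        case False
        have "0 \<le> k * k / k1" using k1 by simp
        moreover have "(if P b x then 1 else 0) * ((if P b y then 1 else 0) * (k1 / 4)) = 0" using False by auto
        ultimately show ?thesis using eq unfolding k_def by linarith
      qed
    qed
    have cnt: "(\<Sum>x\<leftarrow>L. if P b x then 1 else 0 :: real) = m"
      unfolding m_def by (induction L) auto
    have "m * (m * (k1 / 4)) = (\<Sum>x\<leftarrow>L. \<Sum>y\<leftarrow>L. (if P b x then 1 else 0) * ((if P b y then 1 else 0) * (k1 / 4)))"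
      unfolding sum_list_const_mult sum_list_mult_const cnt ..
    also have "\<dots> \<le> (\<Sum>x\<leftarrow>L. \<Sum>y\<leftarrow>L. Re (?q (x \<otimes> inv y)) * autocorrelation g (x \<otimes> inv y))"
      by (intro sum_list_mono trm)
    finally have "m * (m * (k1 / 4)) / n\<^sup>2 \<le> energy g L ?q"
      unfolding energy_def n_def of_nat_power by (rule divide_right_mono) simp
    moreover have "n\<^sup>2 \<le> (N * m)\<^sup>2" using nm n by (intro power_mono) auto
    then have "k1 * n\<^sup>2 \<le> k1 * (N * m)\<^sup>2" using k1 by (intro mult_left_mono) auto
    then have "k1 / (4 * N\<^sup>2) \<le> m * (m * (k1 / 4)) / n\<^sup>2"
      using n N by (simp add: field_simps power2_eq_square)
    ultimately show ?thesis by linarith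
  qed
  then show thesis using that[of "k1 / (4 * N\<^sup>2)"] k1 N by (simp add: k1_def)
qed

end

lemma norm_sum_list_le:
  fixes f :: "'b \<Rightarrow> 'c::real_normed_vector"
  shows "norm (\<Sum>a\<leftarrow>L. f a) \<le> (\<Sum>a\<leftarrow>L. norm (f a))"
  by (induction L) (auto intro: norm_triangle_le)

lemma sum_list_concat_map:
  fixes h :: "'b \<Rightarrow> 'c::comm_monoid_add"
  shows "(\<Sum>p\<leftarrow>concat (map f L). h p) = (\<Sum>a\<leftarrow>L. \<Sum>p\<leftarrow>f a. h p)"
  by (induction L) auto

section \<open>Twisted averages and the continuity of characters of large energy\<close>

context compact_abelian_group
begin

text \<open>For a continuous \<psi> and suitable lists these averages approach the component of
  \<open>g\<close> along the conjugate of \<psi>. They make sense for discontinuous \<psi> too, and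
  are continuous in \<open>z\<close> whenever \<open>g\<close> is.\<close>

definition twisted_avg :: "('a \<Rightarrow> real) \<Rightarrow> ('a \<Rightarrow> complex) \<Rightarrow> 'a list \<Rightarrow> 'a \<Rightarrow> complex"
  where "twisted_avg g \<psi> L z = (\<Sum>a\<leftarrow>L. \<psi> a * complex_of_real (g (a \<otimes> z))) / of_nat (length L)"

lemma continuous_twisted_avg:
  assumes g: "continuous_map T euclideanreal g" and L: "shifts L"
  shows "continuous_map T euclidean (twisted_avg g \<psi> L)"
proof -
  have "continuous_map T euclidean (\<lambda>z. \<Sum>a\<leftarrow>L. \<psi> a * complex_of_real (g (a \<otimes> z)))"
    by (rule continuous_map_sum_list,
        rule continuous_map_euclidean_compose[where h = "\<lambda>u. _ * complex_of_real u"], rule continuous_map_translate[OF g])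
      (use L in \<open>auto simp: shifts_def intro!: continuous_intros\<close>)
  moreover have "continuous_on UNIV (\<lambda>u. u / complex_of_nat (length L))"
    using L by (auto simp: shifts_def intro!: continuous_intros)
  ultimately show ?thesis
    unfolding twisted_avg_def by (rule continuous_map_euclidean_compose)
qed

lemma continuous_norm_square:
  fixes f :: "'a \<Rightarrow> complex"
  assumes "continuous_map T euclidean f"
  shows "continuous_map T euclideanreal (\<lambda>z. (norm (f z))\<^sup>2)"
  by (rule continuous_map_euclidean_compose[OF assms, of "\<lambda>u. (norm u)\<^sup>2"]) (intro continuous_intros)

text \<open>Multiplicativity splits \<open>\<psi> (a \<otimes> inv b)\<close> into
  \<open>\<psi> a * cnj (\<psi> b)\<close>. The double sum becomes the form of the autocorrelation
  with coefficients \<open>\<psi> a\<close>, which is the mean of a square.\<close>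

lemma energy_character:
  assumes g: "continuous_map T euclideanreal g" and L: "shifts L" and \<psi>: "\<psi> \<in> unitary_characters"
  shows "energy g L \<psi> = mean (\<lambda>z. (norm (twisted_avg g \<psi> L z))\<^sup>2)"
proof -
  define n where "n = real (length L)"
  define ps where "ps = map (\<lambda>a. (a, \<psi> a)) L"
  have ps: "fst ` set ps \<subseteq> carrier G" using L by (auto simp: ps_def shifts_def)
  have n: "n > 0" using L by (simp add: n_def shifts_def)
  have eq: "(norm (twisted_avg g \<psi> L z))\<^sup>2 = (1 / n\<^sup>2) * (norm (\<Sum>p\<leftarrow>ps. snd p * complex_of_real (g (fst p \<otimes> z))))\<^sup>2" for z
    unfolding twisted_avg_def ps_def n_def by (simp add: o_def norm_divide power_divide)
  have cont: "continuous_map T euclideanreal (\<lambda>z. (norm (\<Sum>p\<leftarrow>ps. snd p * complex_of_real (g (fst p \<otimes> z))))\<^sup>2)"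
    by (rule continuous_norm_square, rule continuous_map_sum_list,
        rule continuous_map_euclidean_compose[where h = "\<lambda>u. _ * complex_of_real u"], rule continuous_map_translate[OF g])
      (use ps in \<open>auto intro!: continuous_intros\<close>)
  have "mean (\<lambda>z. (norm (twisted_avg g \<psi> L z))\<^sup>2) = (1 / n\<^sup>2) * Re (form (\<lambda>x. complex_of_real (autocorrelation g x)) ps)"
    unfolding eq mean_cmult[OF cont] mean_norm_square[OF g ps] ..
  also have "Re (form (\<lambda>x. complex_of_real (autocorrelation g x)) ps) =
    (\<Sum>a\<leftarrow>L. \<Sum>b\<leftarrow>L. Re (\<psi> a * cnj (\<psi> b)) * autocorrelation g (a \<otimes> inv b))"
    unfolding form_def ps_def Re_sum_list by (simp add: o_def Re_sum_list algebra_simps)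
  also have "\<dots> = (\<Sum>a\<leftarrow>L. \<Sum>b\<leftarrow>L. Re (\<psi> (a \<otimes> inv b)) * autocorrelation g (a \<otimes> inv b))"
  proof -
    have "\<psi> (a \<otimes> inv b) = \<psi> a * cnj (\<psi> b)" if "a \<in> set L" "b \<in> set L" for a b
    proof -
      have "a \<in> carrier G" "b \<in> carrier G" using that L by (auto simp: shifts_def)
      then show ?thesis using \<psi> unitary_character_inv[OF \<psi>] unfolding unitary_characters_def by simp
    qed
    then show ?thesis by (intro arg_cong[where f = sum_list] map_cong refl) simp
  qed
  finally show ?thesis unfolding energy_def n_def by simp
qed

text \<open>The twisted average along \<open>conv L L'\<close> is an average, over \<open>L\<close>,
  of translates of the one along \<open>L'\<close> multiplied by numbers of modulus 1. By
  Cauchy--Schwarz its square is at most the average of their squares, and translation does not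
  change the mean.\<close>

lemma energy_conv_le:
  assumes g: "continuous_map T euclideanreal g" and L: "shifts L" "shifts L'" and \<psi>: "\<psi> \<in> unitary_characters"
  shows "energy g (conv L L') \<psi> \<le> energy g L' \<psi>"
proof -
  define n where "n = real (length L)"
  have n: "n > 0" using L by (simp add: n_def shifts_def)
  have LG: "set L \<subseteq> carrier G" "set L' \<subseteq> carrier G" using L by (auto simp: shifts_def)
  let ?h = "\<lambda>z. (norm (twisted_avg g \<psi> L' z))\<^sup>2"
  have cont: "continuous_map T euclideanreal ?h"
    by (intro continuous_norm_square continuous_twisted_avg[OF g] L)
  have cont': "continuous_map T euclideanreal (\<lambda>z. ?h (a \<otimes> z))" if "a \<in> set L" for a
    by (rule continuous_map_translate[OF cont]) (use that LG in auto)
  have le: "(norm (twisted_avg g \<psi> (conv L L') z))\<^sup>2 \<le> (1 / n) * (\<Sum>a\<leftarrow>L. ?h (a \<otimes> z))" if z: "z \<in> carrier G" for z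
  proof -
    have "(\<Sum>c\<leftarrow>conv L L'. \<psi> c * complex_of_real (g (c \<otimes> z))) =
       (\<Sum>a\<leftarrow>L. \<psi> a * (\<Sum>b\<leftarrow>L'. \<psi> b * complex_of_real (g (b \<otimes> (a \<otimes> z)))))"
      unfolding sum_list_conv sum_list_const_mult[symmetric]
    proof (intro arg_cong[where f = sum_list] map_cong refl)
      fix a b assume "a \<in> set L" "b \<in> set L'"
      then have ab: "a \<in> carrier G" "b \<in> carrier G" using LG by auto
      then have "\<psi> (a \<otimes> b) = \<psi> a * \<psi> b" using \<psi> unfolding unitary_characters_def by blast
      moreover have "a \<otimes> b \<otimes> z = b \<otimes> (a \<otimes> z)" using ab z by (simp add: m_ac)
      ultimately show "\<psi> (a \<otimes> b) * complex_of_real (g (a \<otimes> b \<otimes> z)) = \<psi> a * (\<psi> b * complex_of_real (g (b \<otimes> (a \<otimes> z))))"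
        by simp
    qed
    then have "twisted_avg g \<psi> (conv L L') z = (\<Sum>a\<leftarrow>L. \<psi> a * twisted_avg g \<psi> L' (a \<otimes> z)) / of_real n"
      unfolding twisted_avg_def n_def
      by (simp only: length_conv of_nat_mult times_divide_eq_right divide_inverse[of _ "of_nat (length L')"]
          sum_list_mult_const mult.assoc[symmetric] of_real_of_nat_eq divide_divide_eq_left)
        (simp add: divide_inverse sum_list_mult_const[symmetric] mult_ac)
    then have "(norm (twisted_avg g \<psi> (conv L L') z))\<^sup>2 = (norm (\<Sum>a\<leftarrow>L. \<psi> a * twisted_avg g \<psi> L' (a \<otimes> z)))\<^sup>2 / n\<^sup>2"
      using n by (simp add: norm_divide power_divide)
    also have "\<dots> \<le> (\<Sum>a\<leftarrow>L. norm (\<psi> a * twisted_avg g \<psi> L' (a \<otimes> z)))\<^sup>2 / n\<^sup>2"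
      using norm_sum_list_le by (intro divide_right_mono power_mono) auto
    also have "\<dots> \<le> (n * (\<Sum>a\<leftarrow>L. (norm (\<psi> a * twisted_avg g \<psi> L' (a \<otimes> z)))\<^sup>2)) / n\<^sup>2"
      unfolding n_def by (intro divide_right_mono sum_list_square_le) auto
    also have "\<dots> = (1 / n) * (\<Sum>a\<leftarrow>L. (norm (\<psi> a * twisted_avg g \<psi> L' (a \<otimes> z)))\<^sup>2)"
      using n by (simp add: field_simps power2_eq_square)
    also have "(\<Sum>a\<leftarrow>L. (norm (\<psi> a * twisted_avg g \<psi> L' (a \<otimes> z)))\<^sup>2) = (\<Sum>a\<leftarrow>L. ?h (a \<otimes> z))"
      using \<psi> LG by (intro arg_cong[where f = sum_list] map_cong refl)
        (auto simp: unitary_characters_def norm_mult subset_eq)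
    finally show ?thesis .
  qed
  have cs: "continuous_map T euclideanreal (\<lambda>z. \<Sum>a\<leftarrow>L. ?h (a \<otimes> z))"
    by (intro continuous_map_sum_list cont')
  have "energy g (conv L L') \<psi> = mean (\<lambda>z. (norm (twisted_avg g \<psi> (conv L L') z))\<^sup>2)"
    by (rule energy_character[OF g shifts_conv[OF L] \<psi>])
  also have "\<dots> \<le> mean (\<lambda>z. (1 / n) * (\<Sum>a\<leftarrow>L. ?h (a \<otimes> z)))"
    by (intro mean_mono le continuous_norm_square continuous_twisted_avg[OF g] shifts_conv L
        continuous_map_real_mult_left cs)
  also have "\<dots> = (1 / n) * (\<Sum>a\<leftarrow>L. mean (\<lambda>z. ?h (a \<otimes> z)))"
    unfolding mean_cmult[OF cs] by (subst mean_sum_list[OF cont']) simp_all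
  also have "(\<Sum>a\<leftarrow>L. mean (\<lambda>z. ?h (a \<otimes> z))) = (\<Sum>a\<leftarrow>L. mean ?h)"
    using LG by (intro arg_cong[where f = sum_list] map_cong refl mean_translate[OF cont]) auto
  also have "(1 / n) * (\<Sum>a\<leftarrow>L. mean ?h) = mean ?h"
    using n by (simp add: sum_list_triv n_def)
  also have "\<dots> = energy g L' \<psi>" by (rule energy_character[OF g L(2) \<psi>, symmetric])
  finally show ?thesis .
qed

lemma energy_conv_commute:
  assumes g: "continuous_map T euclideanreal g" and L: "shifts L" "shifts L'" and \<psi>: "\<psi> \<in> unitary_characters"
  shows "energy g (conv L L') \<psi> = energy g (conv L' L) \<psi>"
proof -
  have "twisted_avg g \<psi> (conv L L') z = twisted_avg g \<psi> (conv L' L) z" for z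
    using L unfolding twisted_avg_def shifts_def by (simp add: sum_list_conv_commute[of L] mult.commute)
  then show ?thesis using energy_character[OF g shifts_conv \<psi>] L by simp
qed

text \<open>For a single list, the energy of the autocorrelation state is matched by some character.
  Compactness of the characters then yields one for all lists: any finite set of lists is dominated
  by their convolution, whose energy is the smallest.\<close>

lemma character_with_large_energy:
  assumes g: "continuous_map T euclideanreal g" and "g \<one> \<noteq> 0"
  obtains \<psi> c where "\<psi> \<in> unitary_characters" "c > 0" "\<And>L. shifts L \<Longrightarrow> c \<le> energy g L \<psi>"
proof -
  let ?q = "\<lambda>x. if x \<in> carrier G then complex_of_real (autocorrelation g x / autocorrelation g \<one>) else 0"
  obtain c where c: "c > 0" "\<And>L. shifts L \<Longrightarrow> c \<le> energy g L ?q"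
    using energy_autocorrelation[OF assms] by blast
  have ex: "\<exists>\<psi>\<in>unitary_characters. c \<le> energy g L \<psi>" if L: "shifts L" for L
  proof -
    \<comment> \<open>The energy of \<open>L\<close> written as a linear functional of the state,
      with one pair for every pair of entries of \<open>L\<close>.\<close>
    define ps where "ps = concat (map (\<lambda>a. map (\<lambda>b. (a \<otimes> inv b,
      complex_of_real (autocorrelation g (a \<otimes> inv b) / (length L)\<^sup>2))) L) L)"
    have R: "Re (complex_of_real r * w) = r * Re w" for r w by simp
    have en: "(\<Sum>p\<leftarrow>ps. Re (snd p * q (fst p))) = energy g L q" for q
    proof -
      have "(\<Sum>p\<leftarrow>ps. Re (snd p * q (fst p))) = (\<Sum>a\<leftarrow>L. \<Sum>b\<leftarrow>L.
        Re (complex_of_real (autocorrelation g (a \<otimes> inv b) / (length L)\<^sup>2) * q (a \<otimes> inv b)))"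
        unfolding ps_def sum_list_concat_map by (simp add: o_def)
      also have "\<dots> = (\<Sum>a\<leftarrow>L. \<Sum>b\<leftarrow>L. Re (q (a \<otimes> inv b)) * autocorrelation g (a \<otimes> inv b) * inverse (real ((length L)\<^sup>2)))"
        by (intro arg_cong[where f = sum_list] map_cong refl, simp only: R)
          (simp add: divide_inverse)
      also have "\<dots> = energy g L q"
        unfolding energy_def sum_list_mult_const by (simp add: divide_inverse)
      finally show ?thesis .
    qed
    obtain \<psi> where \<psi>: "\<psi> \<in> unitary_characters"
      "(\<Sum>p\<leftarrow>ps. Re (snd p * ?q (fst p))) \<le> (\<Sum>p\<leftarrow>ps. Re (snd p * \<psi> (fst p)))"
      by (rule character_above_state[OF autocorrelation_state[OF assms], of ps])
    have "energy g L ?q \<le> energy g L \<psi>" using \<psi>(2) unfolding en[symmetric] .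
    with c(2)[OF L] have "c \<le> energy g L \<psi>" by (rule order_trans)
    then show ?thesis using \<psi>(1) by (rule bexI)
  qed
  have "unitary_characters \<inter> (\<Inter>L\<in>{L. shifts L}. {\<psi>. c \<le> energy g L \<psi>}) \<noteq> {}"
  proof (rule compact_imp_fip_image[OF compact_unitary_characters])
    fix L
    show "closed {\<psi>. c \<le> energy g L \<psi>}"
      unfolding energy_def divide_inverse
      by (intro closed_Collect_le continuous_intros continuous_on_sum_list continuous_on_product_coordinates)
  next
    fix I' assume "finite I'" "I' \<subseteq> {L. shifts L}"
    \<comment> \<open>Convolving the finitely many lists gives a list of smaller energy for every
      character, so a character good for it is good for all of them.\<close>
    then have "\<exists>M. shifts M \<and> (\<forall>L\<in>I'. \<forall>\<psi>\<in>unitary_characters. energy g M \<psi> \<le> energy g L \<psi>)"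
    proof (induction I' rule: finite_induct)
      case empty
      show ?case by (rule exI[of _ "[\<one>]"]) (simp add: shifts_def)
    next
      case (insert L I')
      then obtain M where M: "shifts M" "\<forall>L\<in>I'. \<forall>\<psi>\<in>unitary_characters. energy g M \<psi> \<le> energy g L \<psi>"
        by auto
      have L: "shifts L" using insert by auto
      have "energy g (conv L M) \<psi> \<le> energy g L' \<psi>"
        if "L' \<in> insert L I'" "\<psi> \<in> unitary_characters" for L' \<psi>
        using energy_conv_le[OF g L M(1) that(2)] energy_conv_le[OF g M(1) L that(2)]
          energy_conv_commute[OF g L M(1) that(2)] that M(2) by force
      then show ?case using shifts_conv[OF L M(1)] by blast
    qed
    then obtain M where M: "shifts M" "\<forall>L\<in>I'. \<forall>\<psi>\<in>unitary_characters. energy g M \<psi> \<le> energy g L \<psi>" by blast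
    obtain \<psi> where "\<psi> \<in> unitary_characters" "c \<le> energy g M \<psi>" using ex[OF M(1)] by blast
    then have "\<psi> \<in> unitary_characters \<inter> (\<Inter>L\<in>I'. {\<psi>. c \<le> energy g L \<psi>})" using M(2) by force
    then show "unitary_characters \<inter> (\<Inter>L\<in>I'. {\<psi>. c \<le> energy g L \<psi>}) \<noteq> {}" by blast
  qed
  then show thesis using that c(1) by blast
qed

text \<open>The coefficients have modulus 1, so twisted averages inherit the modulus of continuity
  of \<open>g\<close>. The bound does not involve \<open>L\<close> or \<psi>, and holds before
  anything is known about the continuity of \<psi>.\<close>

lemma twisted_avg_uniform:
  assumes g: "continuous_map T euclideanreal g" and L: "shifts L" and \<psi>: "\<psi> \<in> unitary_characters"
    and v: "v \<in> carrier G" and unif: "\<And>x. x \<in> carrier G \<Longrightarrow> \<bar>g (x \<otimes> v) - g x\<bar> \<le> t" and z: "z \<in> carrier G"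
  shows "norm (twisted_avg g \<psi> L (v \<otimes> z) - twisted_avg g \<psi> L z) \<le> t"
proof -
  define n where "n = real (length L)"
  have n: "n > 0" using L by (simp add: n_def shifts_def)
  have "twisted_avg g \<psi> L (v \<otimes> z) - twisted_avg g \<psi> L z =
    (\<Sum>a\<leftarrow>L. \<psi> a * (complex_of_real (g (a \<otimes> (v \<otimes> z))) - complex_of_real (g (a \<otimes> z)))) / of_real n"
    unfolding twisted_avg_def n_def by (simp add: diff_divide_distrib sum_list_subtractf right_diff_distrib)
  also have "norm \<dots> = norm (\<Sum>a\<leftarrow>L. \<psi> a * (complex_of_real (g (a \<otimes> (v \<otimes> z))) - complex_of_real (g (a \<otimes> z)))) / n"
    using n by (simp add: norm_divide)
  also have "\<dots> \<le> (\<Sum>a\<leftarrow>L. norm (\<psi> a * (complex_of_real (g (a \<otimes> (v \<otimes> z))) - complex_of_real (g (a \<otimes> z))))) / n"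
    by (intro divide_right_mono norm_sum_list_le) (use n in simp)
  also have "\<dots> \<le> (\<Sum>a\<leftarrow>L. t) / n"
  proof (intro divide_right_mono sum_list_mono)
    fix a assume "a \<in> set L"
    then have a: "a \<in> carrier G" using L by (auto simp: shifts_def)
    then have "a \<otimes> (v \<otimes> z) = (a \<otimes> z) \<otimes> v" using v z by (simp add: m_ac)
    then have "\<bar>g (a \<otimes> (v \<otimes> z)) - g (a \<otimes> z)\<bar> \<le> t" using unif[of "a \<otimes> z"] a z by simp
    then show "norm (\<psi> a * (complex_of_real (g (a \<otimes> (v \<otimes> z))) - complex_of_real (g (a \<otimes> z)))) \<le> t"
      using \<psi> a by (simp add: norm_mult unitary_characters_def flip: of_real_diff)
  qed (use n in simp)
  also have "\<dots> = t" using n by (simp add: sum_list_triv n_def)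
  finally show ?thesis .
qed

text \<open>A twisted average \<open>u\<close> of almost minimal energy is almost invariant under the twisted
  translations, by the parallelogram law; as \<open>u\<close> is equicontinuous, this forces \<open>\<psi>\<close> to be
  continuous.\<close>

lemma large_energy_continuous:
  assumes g: "continuous_map T euclideanreal g" and \<psi>: "\<psi> \<in> unitary_characters"
    and c: "c > 0" "\<And>L. shifts L \<Longrightarrow> c \<le> energy g L \<psi>"
  shows "continuous_map T euclidean \<psi>"
proof (rule continuous_map_epsI)
  fix x0 e assume x0: "x0 \<in> topspace T" and e: "e > (0::real)"
  have x0G: "x0 \<in> carrier G" using x0 topspace_eq by simp
  define c0 where "c0 = Inf ((\<lambda>L. energy g L \<psi>) ` {L. shifts L})"
  have bdd: "bdd_below ((\<lambda>L. energy g L \<psi>) ` {L. shifts L})"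
    using c(2) by (auto simp: bdd_below_def)
  have c0_le: "c0 \<le> energy g L \<psi>" if "shifts L" for L
    unfolding c0_def by (rule cInf_lower[OF _ bdd]) (use that in auto)
  \<comment> \<open>The estimate at the end bounds c times the square of the modulus of
    \<open>\<psi> v - 1\<close> by 8 d + 2 t^2. With these values of \<open>d\<close> and
    \<open>t\<close> both summands are c e^2 / 4.\<close>
  define d where "d = c * e\<^sup>2 / 32"
  define t where "t = sqrt (c * e\<^sup>2 / 8)"
  have d: "d > 0" and t: "t > 0" "t\<^sup>2 = c * e\<^sup>2 / 8" using c e by (simp_all add: d_def t_def)
  have "shifts [\<one>]" by (simp add: shifts_def)
  then obtain L where L: "shifts L" "energy g L \<psi> < c0 + d"
    using cInf_lessD[of "(\<lambda>L. energy g L \<psi>) ` {L. shifts L}" "c0 + d"] d unfolding c0_def by auto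
  obtain V where V: "openin T V" "\<one> \<in> V"
    and unif: "\<And>x v. x \<in> carrier G \<Longrightarrow> v \<in> V \<Longrightarrow> norm (g (x \<otimes> v) - g x) < t"
    using uniform_continuity[OF g t(1)] by blast
  have small: "norm (\<psi> v - 1) < e" if v: "v \<in> V" for v
  proof -
    have vG: "v \<in> carrier G" using v V(1) openin_subset topspace_eq by blast
    define u where "u = twisted_avg g \<psi> L"
    define w where "w z = u (v \<otimes> z)" for z
    \<comment> \<open>The twisted average along \<open>L'\<close> is the midpoint of
      \<open>u\<close> and its twisted translate by \<open>v\<close>. Its energy is at least the
      infimum \<open>c0\<close>, as for every list.\<close>
    define L' where "L' = L @ map (\<lambda>a. v \<otimes> a) L"
    have L': "shifts L'" using L(1) vG by (auto simp: L'_def shifts_def)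
    have \<psi>v: "norm (\<psi> v) = 1" using \<psi> vG unfolding unitary_characters_def by blast
    have n: "length L > 0" using L(1) by (simp add: shifts_def)
    have avg': "twisted_avg g \<psi> L' z = (u z + \<psi> v * w z) / 2" if z: "z \<in> carrier G" for z
    proof -
      have "(\<Sum>a\<leftarrow>L. \<psi> (v \<otimes> a) * complex_of_real (g (v \<otimes> a \<otimes> z))) =
        \<psi> v * (\<Sum>a\<leftarrow>L. \<psi> a * complex_of_real (g (a \<otimes> (v \<otimes> z))))"
        unfolding sum_list_const_mult[symmetric]
      proof (intro arg_cong[where f = sum_list] map_cong refl)
        fix a assume "a \<in> set L"
        then have a: "a \<in> carrier G" using L by (auto simp: shifts_def)
        then have "v \<otimes> a \<otimes> z = a \<otimes> (v \<otimes> z)" using vG z by (simp add: m_ac)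
        then show "\<psi> (v \<otimes> a) * complex_of_real (g (v \<otimes> a \<otimes> z)) = \<psi> v * (\<psi> a * complex_of_real (g (a \<otimes> (v \<otimes> z))))"
          using \<psi> a vG unfolding unitary_characters_def by simp
      qed
      then show ?thesis
        using n unfolding twisted_avg_def L'_def u_def w_def by (simp add: o_def field_simps)
    qed
    have cu: "continuous_map T euclidean u" unfolding u_def by (rule continuous_twisted_avg[OF g L(1)])
    have cw: "continuous_map T euclidean w" unfolding w_def by (rule continuous_map_translate[OF cu vG])
    have cvw: "continuous_map T euclidean (\<lambda>z. \<psi> v * w z)"
      by (rule continuous_map_euclidean_compose[OF cw, of "\<lambda>s. \<psi> v * s"]) (intro continuous_intros)
    have Eu: "mean (\<lambda>z. (norm (u z))\<^sup>2) = energy g L \<psi>"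
      unfolding u_def by (rule energy_character[OF g L(1) \<psi>, symmetric])
    have Ew: "mean (\<lambda>z. (norm (w z))\<^sup>2) = energy g L \<psi>"
      unfolding w_def using mean_translate[OF continuous_norm_square[OF cu] vG] Eu by simp
    have EL': "energy g L' \<psi> = mean (\<lambda>z. (norm ((u z + \<psi> v * w z) / 2))\<^sup>2)"
      unfolding energy_character[OF g L' \<psi>] by (rule mean_cong) (simp add: avg')
    have csum: "continuous_map T euclidean (\<lambda>z. (u z + \<psi> v * w z) / 2)"
      by (rule continuous_map_euclidean_compose[where h = "\<lambda>s. s / 2", OF continuous_map_add[OF cu cvw]])
        (auto intro!: continuous_intros)
    have cdiff: "continuous_map T euclidean (\<lambda>z. \<psi> v * w z - u z)"
      by (rule continuous_map_diff[OF cvw cu])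
    \<comment> \<open>The parallelogram law. Taking means gives four times the energy of
      \<open>L\<close> minus four times that of \<open>L'\<close>, which is at most 4 d because
      \<open>L\<close> is within \<open>d\<close> of the infimum.\<close>
    have par: "(norm (\<psi> v * w z - u z))\<^sup>2 = (2 * (norm (u z))\<^sup>2 + 2 * (norm (w z))\<^sup>2) - 4 * (norm ((u z + \<psi> v * w z) / 2))\<^sup>2" for z
    proof -
      have "(norm (a - b))\<^sup>2 = 2 * (norm b)\<^sup>2 + 2 * (norm a)\<^sup>2 - (norm (b + a))\<^sup>2" for a b :: complex
        unfolding cmod_power2 by (simp add: power2_eq_square algebra_simps)
      from this[of "\<psi> v * w z" "u z"] show ?thesis
        using \<psi>v by (simp add: norm_mult norm_divide power_divide)
    qed
    have "mean (\<lambda>z. (norm (\<psi> v * w z - u z))\<^sup>2) = (2 * energy g L \<psi> + 2 * energy g L \<psi>) - 4 * energy g L' \<psi>"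
      unfolding par EL' Eu[symmetric] Ew[symmetric]
      by (subst mean_diff mean_add mean_cmult; (intro continuous_intros continuous_map_add continuous_map_real_mult_left
            continuous_norm_square cu cw csum)?)+ (simp add: Eu Ew)
    also have "\<dots> \<le> 4 * d" using L(2) c0_le[OF L'] by simp
    finally have m1: "mean (\<lambda>z. (norm (\<psi> v * w z - u z))\<^sup>2) \<le> 4 * d" .
    \<comment> \<open>\<open>(\<psi> v - 1) * w z\<close> is the difference of
      \<open>\<psi> v * w z - u z\<close>, which is small in mean square, and
      \<open>w z - u z\<close>, which is uniformly at most \<open>t\<close>. The mean square of
      \<open>w\<close> is at least \<open>c\<close>, so \<open>\<psi> v - 1\<close> has to be
      small.\<close>
    have pw: "(norm (\<psi> v - 1))\<^sup>2 * (norm (w z))\<^sup>2 \<le> 2 * (norm (\<psi> v * w z - u z))\<^sup>2 + 2 * t\<^sup>2" if z: "z \<in> carrier G" for z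
    proof -
      have le: "norm (w z - u z) \<le> t"
        unfolding w_def u_def using unif[OF _ v] by (intro twisted_avg_uniform[OF g L(1) \<psi> vG _ z]) (simp add: less_imp_le)
      have "(norm (\<psi> v - 1))\<^sup>2 * (norm (w z))\<^sup>2 = (norm ((\<psi> v * w z - u z) - (w z - u z)))\<^sup>2"
        by (simp add: power_mult_distrib[symmetric] norm_mult[symmetric] algebra_simps)
      also have "\<dots> \<le> (norm (\<psi> v * w z - u z) + norm (w z - u z))\<^sup>2"
        by (intro power_mono norm_triangle_ineq4) simp
      also have "\<dots> \<le> 2 * (norm (\<psi> v * w z - u z))\<^sup>2 + 2 * (norm (w z - u z))\<^sup>2"
        using sum_squares_bound[of "norm (\<psi> v * w z - u z)" "norm (w z - u z)"] by (simp add: power2_sum)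
      also have "\<dots> \<le> 2 * (norm (\<psi> v * w z - u z))\<^sup>2 + 2 * t\<^sup>2"
        using le by (simp add: power_mono)
      finally show ?thesis .
    qed
    have "(norm (\<psi> v - 1))\<^sup>2 * c \<le> (norm (\<psi> v - 1))\<^sup>2 * mean (\<lambda>z. (norm (w z))\<^sup>2)"
      using c(2)[OF L(1)] Ew by (simp add: mult_left_mono)
    also have "\<dots> = mean (\<lambda>z. (norm (\<psi> v - 1))\<^sup>2 * (norm (w z))\<^sup>2)"
      by (rule mean_cmult[OF continuous_norm_square[OF cw], symmetric])
    also have "\<dots> \<le> mean (\<lambda>z. 2 * (norm (\<psi> v * w z - u z))\<^sup>2 + 2 * t\<^sup>2)"
      by (intro mean_mono pw continuous_map_add continuous_map_real_mult_left continuous_norm_square cw cdiff) auto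
    also have "\<dots> = 2 * mean (\<lambda>z. (norm (\<psi> v * w z - u z))\<^sup>2) + 2 * t\<^sup>2"
      using mean_add[OF continuous_map_real_mult_left[OF continuous_norm_square[OF cdiff], of 2], of "\<lambda>_. 2 * t\<^sup>2"]
        mean_cmult[OF continuous_norm_square[OF cdiff], of 2] mean_const by simp
    also have "\<dots> \<le> 8 * d + 2 * t\<^sup>2" using m1 by simp
    also have "\<dots> = c * (e\<^sup>2 / 2)" using t by (simp add: d_def)
    finally have "c * (norm (\<psi> v - 1))\<^sup>2 \<le> c * (e\<^sup>2 / 2)" by (simp add: mult.commute)
    then have "(norm (\<psi> v - 1))\<^sup>2 \<le> e\<^sup>2 / 2" using c(1) by simp
    also have "\<dots> < e\<^sup>2" using e by simp
    finally show ?thesis using e by (auto intro: power2_less_imp_less)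
  qed
  show "\<exists>U. openin T U \<and> x0 \<in> U \<and> (\<forall>y\<in>U. dist (\<psi> y) (\<psi> x0) < e)"
  proof (intro exI conjI ballI)
    show "openin T ((\<lambda>x. x0 \<otimes> x) ` V)" by (rule openin_translate[OF x0G V(1)])
    show "x0 \<in> (\<lambda>x. x0 \<otimes> x) ` V" using V(2) x0G by (auto intro!: image_eqI[of _ _ \<one>])
    fix y assume "y \<in> (\<lambda>x. x0 \<otimes> x) ` V"
    then obtain v where v: "v \<in> V" "y = x0 \<otimes> v" by blast
    then have vG: "v \<in> carrier G" using V(1) openin_subset topspace_eq by blast
    have "\<psi> y = \<psi> x0 * \<psi> v" "norm (\<psi> x0) = 1"
      using \<psi> vG x0G v(2) unfolding unitary_characters_def by auto
    then have "dist (\<psi> y) (\<psi> x0) = norm (\<psi> x0 * (\<psi> v - 1))" by (simp add: dist_norm algebra_simps)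
    also have "\<dots> < e" using small[OF v(1)] \<open>norm (\<psi> x0) = 1\<close> by (simp add: norm_mult)
    finally show "dist (\<psi> y) (\<psi> x0) < e" .
  qed
qed

text \<open>Take a Urysohn function \<open>f\<close> with values 0 at \<open>x0\<close> and 1 at the
  identity, and let \<open>g\<close> be \<open>f\<close> minus its translate by \<open>x0\<close>.
  If a character had value 1 at \<open>x0\<close>, its twisted average along the first N powers of
  \<open>x0\<close> would telescope to a difference of two values of \<open>f\<close> divided by N,
  so its energies would not be bounded below.\<close>

lemma characters_separate_points:
  assumes x0: "x0 \<in> carrier G" "x0 \<noteq> \<one>"
  obtains \<psi> where "\<psi> \<in> unitary_characters" "continuous_map T euclidean \<psi>" "\<psi> x0 \<noteq> 1"
proof -
  have "normal_space T" using compact Hausdorff compact_Hausdorff_or_regular_imp_normal_space by blast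
  moreover have "closedin T {x0}" "closedin T {\<one>}" "disjnt {x0} {\<one>}"
    using x0 Hausdorff by (auto simp: topspace_eq closedin_Hausdorff_sing_eq)
  ultimately obtain f where "continuous_map T (top_of_set {0..1}) f" "f ` {x0} \<subseteq> {0::real}" "f ` {\<one>} \<subseteq> {1}"
    unfolding normal_space_iff_Urysohn by blast
  then have f: "continuous_map T (top_of_set {0..1}) f" "f x0 = 0" "f \<one> = 1" by auto
  have f': "continuous_map T euclideanreal f" using f(1) continuous_map_into_fulltopology by blast
  have f01: "0 \<le> f x" "f x \<le> 1" if "x \<in> carrier G" for x
    using f(1) that unfolding continuous_map_def topspace_eq by auto
  define g where "g z = f z - f (x0 \<otimes> z)" for z
  have g: "continuous_map T euclideanreal g"
    unfolding g_def by (intro continuous_map_diff f' continuous_map_translate[OF f'] x0)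
  have "g \<one> \<noteq> 0" using f x0 by (simp add: g_def)
  from character_with_large_energy[OF g this]
  obtain \<psi> c where \<psi>: "\<psi> \<in> unitary_characters" and c: "c > 0" "\<And>L. shifts L \<Longrightarrow> c \<le> energy g L \<psi>"
    by blast
  have "\<psi> x0 \<noteq> 1"
  proof
    assume 1: "\<psi> x0 = 1"
    have pow: "\<psi> (x0 [^] i) = 1" for i :: nat
    proof (induction i)
      case (Suc i)
      then show ?case using \<psi> x0 1 unfolding unitary_characters_def by simp
    qed (use unitary_character_one[OF \<psi>] in simp)
    obtain N :: nat where N: "N > 0" "inverse (real N) < c"
      using c(1) ex_inverse_of_nat_less by blast
    define L where "L = map (\<lambda>i. x0 [^] i) [0..<N]"
    have L: "shifts L" using N x0 by (auto simp: L_def shifts_def)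
    have le: "(norm (twisted_avg g \<psi> L z))\<^sup>2 \<le> inverse (real N)" if z: "z \<in> carrier G" for z
    proof -
      have "(\<Sum>i\<leftarrow>[0..<k]. complex_of_real (g (x0 [^] i \<otimes> z))) = of_real (f z - f (x0 [^] k \<otimes> z))" for k :: nat
      proof (induction k)
        case (Suc k)
        have "x0 \<otimes> (x0 [^] k \<otimes> z) = x0 [^] Suc k \<otimes> z" using x0 z by (simp add: m_ac)
        then show ?case using Suc by (simp add: g_def)
      qed (use z in simp)
      then have "twisted_avg g \<psi> L z = of_real ((f z - f (x0 [^] N \<otimes> z)) / real N)"
        unfolding twisted_avg_def L_def by (simp add: o_def pow)
      then have "norm (twisted_avg g \<psi> L z) = \<bar>f z - f (x0 [^] N \<otimes> z)\<bar> / real N"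
        by (simp only: norm_of_real abs_divide abs_of_nat)
      also have "\<dots> \<le> 1 / real N"
        using f01[of z] f01[of "x0 [^] N \<otimes> z"] z x0 by (intro divide_right_mono) (auto simp: abs_le_iff)
      finally have "(norm (twisted_avg g \<psi> L z))\<^sup>2 \<le> (1 / real N)\<^sup>2" by (intro power_mono) auto
      also have "\<dots> \<le> inverse (real N)" using N(1) by (simp add: power2_eq_square field_simps)
      finally show ?thesis .
    qed
    have "energy g L \<psi> \<le> mean (\<lambda>_. inverse (real N))"
      unfolding energy_character[OF g L \<psi>]
      by (intro mean_mono le continuous_norm_square continuous_twisted_avg[OF g L]) auto
    then show False using c(2)[OF L] N(2) by (simp add: mean_const)
  qed
  then show thesis using that \<psi> large_energy_continuous[OF g \<psi> c] by blast
qed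

end

section \<open>Endomorphisms preserving cyclic subgroups\<close>

text \<open>An element \<open>c\<close> of maximal order works. Otherwise some prime p has higher
  multiplicity in the order of a \<open>y\<close> than in that of \<open>c\<close>, and combining
  the part of \<open>c\<close> prime to p with the p-part of \<open>y\<close> gives an element of
  larger order.\<close>

lemma (in comm_group) element_of_exponent_order:
  assumes K: "K > 0" and exp: "\<And>x. x \<in> carrier G \<Longrightarrow> x [^] (K::nat) = \<one>"
  obtains c where "c \<in> carrier G" "ord c > 0" "\<And>y. y \<in> carrier G \<Longrightarrow> y [^] ord c = \<one>"
proof -
  have dvd: "ord x dvd K" if "x \<in> carrier G" for x
    using exp[OF that] pow_eq_id[OF that] by blast
  have pos: "ord x > 0" if "x \<in> carrier G" for x
    using dvd[OF that] K by (meson dvd_pos_nat)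
  have "\<forall>x. x \<in> carrier G \<longrightarrow> ord x < Suc K"
    using dvd K dvd_imp_le by (meson le_imp_less_Suc)
  then obtain c where c: "c \<in> carrier G" and max: "\<And>x. x \<in> carrier G \<Longrightarrow> ord x \<le> ord c"
    using ex_has_greatest_nat[of "\<lambda>x. x \<in> carrier G" \<one> ord "Suc K"] by auto
  show thesis
  proof (rule that[OF c pos[OF c]])
    fix y assume y: "y \<in> carrier G"
    show "y [^] ord c = \<one>"
    proof (rule ccontr)
      assume "y [^] ord c \<noteq> \<one>"
      then have "\<not> ord y dvd ord c" using pow_eq_id[OF y] by blast
      have "\<exists>p. prime p \<and> multiplicity p (ord c) < multiplicity p (ord y)"
      proof (rule ccontr)
        assume "\<nexists>p. prime p \<and> multiplicity p (ord c) < multiplicity p (ord y)"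
        then have "ord y dvd ord c"
          using pos[OF y] by (intro multiplicity_le_imp_dvd) (auto simp: not_less)
        then show False using \<open>\<not> ord y dvd ord c\<close> by contradiction
      qed
      then obtain p where p: "prime p" "multiplicity p (ord c) < multiplicity p (ord y)" by blast
      define i j where "i = multiplicity p (ord c)" and "j = multiplicity p (ord y)"
      have np: "\<not> is_unit p" using p(1) by (meson not_prime_unit)
      obtain r where r: "ord c = p ^ i * r" "\<not> p dvd r"
        using multiplicity_decompose'[of "ord c" p] pos[OF c] np unfolding i_def by auto
      obtain s where s: "ord y = p ^ j * s" "\<not> p dvd s"
        using multiplicity_decompose'[of "ord y" p] pos[OF y] np unfolding j_def by auto
      have p0: "p > 0" using p(1) by (simp add: prime_gt_0_nat)
      have rs: "r > 0" "s > 0" using r s pos[OF c] pos[OF y] by (auto intro!: Nat.gr0I)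
      \<comment> \<open>Their orders are \<open>r\<close>, prime to p, and \<open>p ^ j\<close>. As
        these are coprime, the order of the product is divisible by both and so by
        \<open>r * p ^ j\<close>, which exceeds \<open>ord c = p ^ i * r\<close>.\<close>
      define c' y' where "c' = c [^] (p ^ i)" and "y' = y [^] s"
      have G: "c' \<in> carrier G" "y' \<in> carrier G" using c y by (auto simp: c'_def y'_def)
      have oc: "ord c' = r" unfolding c'_def using ord_pow[OF c, of "p ^ i"] r p0 by simp
      have oy: "ord y' = p ^ j" unfolding y'_def using ord_pow[OF y, of s] s rs by simp
      have cop: "coprime r (p ^ j)"
        using p(1) r(2) by (simp add: coprime_commute prime_imp_coprime)
      define d where "d = ord (c' \<otimes> y')"
      have d1: "(c' \<otimes> y') [^] d = \<one>" unfolding d_def using G by simp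
      have "r dvd d"
      proof -
        have "(c' \<otimes> y') [^] (d * p ^ j) = \<one>"
          using d1 G by (simp flip: nat_pow_pow)
        moreover have "y' [^] (d * p ^ j) = \<one>" using pow_eq_id[OF G(2)] oy by simp
        ultimately have "c' [^] (d * p ^ j) = \<one>" using G by (simp add: nat_pow_distrib)
        then have "r dvd d * p ^ j" using pow_eq_id[OF G(1)] oc by simp
        then show ?thesis using cop by (simp add: coprime_dvd_mult_left_iff)
      qed
      moreover have "p ^ j dvd d"
      proof -
        have "(c' \<otimes> y') [^] (d * r) = \<one>"
          using d1 G by (simp flip: nat_pow_pow)
        moreover have "c' [^] (d * r) = \<one>" using pow_eq_id[OF G(1)] oc by simp
        ultimately have "y' [^] (d * r) = \<one>" using G by (simp add: nat_pow_distrib)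
        then have "p ^ j dvd d * r" using pow_eq_id[OF G(2)] oy by simp
        then show ?thesis using cop by (simp add: coprime_commute coprime_dvd_mult_left_iff)
      qed
      ultimately have "r * p ^ j dvd d" using cop by (simp add: divides_mult)
      moreover have "d > 0" unfolding d_def using pos G by simp
      ultimately have "r * p ^ j \<le> d" by (rule dvd_imp_le)
      moreover have "d \<le> ord c" unfolding d_def using max G by simp
      moreover have "p ^ i < p ^ j" using p prime_gt_1_nat[OF p(1)] unfolding i_def j_def by (simp add: power_strict_increasing)
      then have "ord c < r * p ^ j" using rs r(1) by simp
      ultimately show False by linarith
    qed
  qed
qed

lemma (in comm_group) cross_cancel:
  assumes "a \<otimes> b = c \<otimes> d" and G: "a \<in> carrier G" "b \<in> carrier G" "c \<in> carrier G" "d \<in> carrier G"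
  shows "c \<otimes> inv a = b \<otimes> inv d"
proof -
  have "c \<otimes> inv a = c \<otimes> (d \<otimes> inv d) \<otimes> inv a" using G by simp
  also have "\<dots> = (c \<otimes> d) \<otimes> (inv a \<otimes> inv d)" using G by (simp only: m_ac inv_closed m_closed)
  also have "\<dots> = b \<otimes> (a \<otimes> inv a) \<otimes> inv d"
    using G unfolding assms(1)[symmetric] by (simp only: m_ac inv_closed m_closed)
  also have "\<dots> = b \<otimes> inv d" using G by simp
  finally show ?thesis .
qed

lemma (in group) int_pow_eq_if:
  assumes "x \<in> carrier G" "x [^] (i - j :: int) = \<one>"
  shows "x [^] i = x [^] j"
proof -
  have "x [^] (i - j) \<otimes> x [^] j = x [^] i" using assms(1) by (simp flip: int_pow_mult)
  then show ?thesis using assms by simp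
qed

text \<open>The exponent n of \<open>c\<close> serves everywhere. If \<open>y\<close> has exponent k
  and \<open>c \<otimes> y\<close> has exponent m, comparison shows that the (m - n)-th power of
  \<open>c\<close> is the (k - m)-th power of \<open>y\<close>. On this common element f acts both
  by n and by k, so the infinite order of \<open>c\<close> forces m = n or n = k. If m = n, the
  common element is trivial and n also serves for \<open>y\<close>.\<close>

lemma (in comm_group) pointwise_power_hom_infinite_order:
  assumes f: "f \<in> hom G G" and pw: "\<And>x. x \<in> carrier G \<Longrightarrow> \<exists>n::int. f x = x [^] n"
    and c: "c \<in> carrier G" "\<And>k::int. c [^] k = \<one> \<Longrightarrow> k = 0"
  obtains n :: int where "\<And>x. x \<in> carrier G \<Longrightarrow> f x = x [^] n"
proof -
  obtain n :: int where n: "f c = c [^] n" using pw[OF c(1)] by blast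
  have "f y = y [^] n" if y: "y \<in> carrier G" for y
  proof -
    obtain k :: int where k: "f y = y [^] k" using pw[OF y] by blast
    obtain m :: int where m: "f (c \<otimes> y) = (c \<otimes> y) [^] m" using pw[of "c \<otimes> y"] c y by blast
    have "c [^] n \<otimes> y [^] k = c [^] m \<otimes> y [^] m"
      using m hom_mult[OF f c(1) y] n k c y by (simp add: int_pow_distrib)
    then have eq: "c [^] (m - n) = y [^] (k - m)"
      using cross_cancel c y by (simp add: int_pow_diff)
    have "f (c [^] (m - n)) = f (y [^] (k - m))" by (simp only: eq)
    then have "(c [^] n) [^] (m - n) = (y [^] k) [^] (k - m)"
      using hom_int_pow[OF f] c y n k is_group by simp
    also have "\<dots> = (y [^] (k - m)) [^] k" using y by (simp add: int_pow_pow mult.commute)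
    also have "\<dots> = (c [^] (m - n)) [^] k" by (simp only: eq)
    finally have "c [^] (n * (m - n)) = c [^] ((m - n) * k)" using c by (simp add: int_pow_pow)
    then have "c [^] (n * (m - n) - (m - n) * k) = \<one>" using c by (simp add: int_pow_diff)
    then have "n * (m - n) - (m - n) * k = 0" by (rule c(2))
    then have "(m - n) * (n - k) = 0" by (simp add: algebra_simps)
    then consider "m = n" | "n = k" by auto
    then show ?thesis
    proof cases
      case 1
      then have "y [^] (k - n) = \<one>" using eq by simp
      then have "y [^] k = y [^] n" using y by (rule int_pow_eq_if[rotated])
      then show ?thesis using k by simp
    qed (use k in simp)
  qed
  then show thesis using that by blast
qed

text \<open>Let \<open>c\<close> have order equal to the exponent e. Any \<open>y\<close> differs by
  a power of \<open>c\<close> from a \<open>z\<close> whose cyclic group meets that of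
  \<open>c\<close> trivially. For such a \<open>z\<close>, comparing exponents on \<open>c\<close>,
  \<open>z\<close> and \<open>c \<otimes> z\<close> separates into two trivial elements: the
  exponents of \<open>c\<close> and of the product agree modulo e, and those of \<open>z\<close> and
  of the product act alike on \<open>z\<close>.\<close>

lemma (in comm_group) pointwise_power_hom_exponent:
  assumes f: "f \<in> hom G G" and pw: "\<And>x. x \<in> carrier G \<Longrightarrow> \<exists>n::int. f x = x [^] n"
    and K: "K > 0" and exp: "\<And>x. x \<in> carrier G \<Longrightarrow> x [^] (K::nat) = \<one>"
  obtains n :: int where "\<And>x. x \<in> carrier G \<Longrightarrow> f x = x [^] n"
proof -
  obtain c where c: "c \<in> carrier G" "ord c > 0" and ce: "\<And>y. y \<in> carrier G \<Longrightarrow> y [^] ord c = \<one>"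
    using element_of_exponent_order[OF K exp] by blast
  define e where "e = int (ord c)"
  have e: "e > 0" using c(2) by (simp add: e_def)
  have ye: "y [^] e = \<one>" if "y \<in> carrier G" for y
    using ce[OF that] by (simp add: e_def int_pow_int)
  have cdvd: "c [^] i = \<one> \<longleftrightarrow> e dvd i" for i :: int
    unfolding e_def by (rule int_pow_eq_id[OF c(1)])
  obtain n :: int where n: "f c = c [^] n" using pw[OF c(1)] by blast
  have "f y = y [^] n" if y: "y \<in> carrier G" for y
  proof -
    let ?P = "\<lambda>s::nat. s > 0 \<and> (\<exists>u::int. y [^] int s = c [^] u)"
    \<comment> \<open>The order of \<open>y\<close> modulo the cyclic group generated by
      \<open>c\<close>.\<close>
    define s where "s = (LEAST s. ?P s)"
    have "?P (nat e)" using e ye[OF y] int_pow_0[of G c] by (auto intro!: exI[of _ "0::int"] simp del: int_pow_0)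
    then have Ps: "?P s" unfolding s_def by (rule LeastI)
    then obtain u :: int where s: "s > 0" and u: "y [^] int s = c [^] u" by blast
    have s_dvd: "int s dvd i" if i: "y [^] i = c [^] v" for i v :: int
    proof -
      define q r where "q = i div int s" and "r = i mod int s"
      have i_eq: "i = int s * q + r" by (simp add: q_def r_def)
      have r: "0 \<le> r" "r < int s" using s by (simp_all add: r_def)
      have "y [^] i = (c [^] u) [^] q \<otimes> y [^] r"
        using y u by (simp add: i_eq int_pow_mult flip: int_pow_pow)
      then have "y [^] r = c [^] v \<otimes> inv (c [^] (u * q))"
        using cross_cancel[of "(c [^] u) [^] q" "y [^] r" "c [^] v" \<one>] i y c(1) by (simp add: int_pow_pow)
      then have "y [^] r = c [^] (v - u * q)" using c(1) by (simp add: int_pow_diff)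
      then have "\<not> (0 < nat r)" using not_less_Least[of "nat r" ?P] r unfolding s_def[symmetric] by fastforce
      then have "r = 0" using r by simp
      then show ?thesis using i_eq by simp
    qed
    have "int s dvd e" using s_dvd[of e 0] ye[OF y] by simp
    then obtain w where w: "e = int s * w" by (rule dvdE)
    have "c [^] (u * w) = (y [^] int s) [^] w" using c(1) u by (simp add: int_pow_pow)
    also have "\<dots> = \<one>" using y w ye[OF y] by (simp add: int_pow_pow)
    \<comment> \<open>Since e = s w, it follows that s divides u. So the s-th power of
      \<open>y\<close> is the s-th power of an element \<open>c [^] t\<close>, and dividing by it
      corrects \<open>y\<close> to an element \<open>z\<close> of order dividing s.\<close>
    finally have "e dvd u * w" by (simp only: cdvd)
    then have "int s dvd u" using w e by (auto simp: mult.commute)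
    then obtain t where t: "u = int s * t" by (rule dvdE)
    define z where "z = y \<otimes> c [^] (- t)"
    have z: "z \<in> carrier G" using y c(1) by (simp add: z_def)
    have y_eq: "y = z \<otimes> c [^] t"
      using y c(1) by (simp add: z_def m_assoc flip: int_pow_mult)
    have zs: "z [^] int s = \<one>"
    proof -
      have "z [^] int s = c [^] u \<otimes> c [^] (- t * int s)"
        using y c(1) u by (simp add: z_def int_pow_distrib int_pow_pow)
      also have "\<dots> = c [^] (u + - t * int s)" using c(1) by (simp only: int_pow_mult)
      also have "u + - t * int s = 0" using t by simp
      finally show ?thesis by simp
    qed
    \<comment> \<open>The cyclic groups of \<open>z\<close> and \<open>c\<close> meet trivially: a
      power of \<open>z\<close> lying in the latter puts the same power of \<open>y\<close> there,
      so its exponent is a multiple of s and kills \<open>z\<close>.\<close>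
    have z_triv: "z [^] i = \<one>" if i: "z [^] i = c [^] v" for i v :: int
    proof -
      have "y [^] i = c [^] v \<otimes> c [^] (t * i)"
        using z c(1) i by (subst y_eq) (simp add: int_pow_distrib int_pow_pow)
      then have "y [^] i = c [^] (v + t * i)" using c(1) by (simp add: int_pow_mult)
      then have "int s dvd i" by (rule s_dvd)
      then obtain l where "i = int s * l" by (rule dvdE)
      then have "z [^] i = (z [^] int s) [^] l" using z by (simp add: int_pow_pow)
      then show ?thesis using zs by simp
    qed
    obtain k :: int where k: "f z = z [^] k" using pw[OF z] by blast
    obtain m :: int where m: "f (c \<otimes> z) = (c \<otimes> z) [^] m" using pw[of "c \<otimes> z"] c z by blast
    have "c [^] n \<otimes> z [^] k = c [^] m \<otimes> z [^] m"
      using m hom_mult[OF f c(1) z] n k c z by (simp add: int_pow_distrib)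
    then have eq: "z [^] (k - m) = c [^] (m - n)"
      using cross_cancel[of "c [^] n" "z [^] k" "c [^] m" "z [^] m"] c z by (simp add: int_pow_diff)
    then have 1: "z [^] (k - m) = \<one>" by (rule z_triv)
    then have "c [^] (m - n) = \<one>" using eq by simp
    then have "e dvd m - n" by (simp only: cdvd)
    then obtain l where l: "m - n = e * l" by (rule dvdE)
    have kn: "k - n = (k - m) + e * l" using l by simp
    have "z [^] (k - n) = z [^] (k - m) \<otimes> (z [^] e) [^] l"
      unfolding kn by (simp only: int_pow_mult[OF z] int_pow_pow[OF z])
    then have "z [^] (k - n) = \<one>" using 1 ye[OF z] by simp
    then have "z [^] k = z [^] n" using z by (rule int_pow_eq_if[rotated])
    then have fz: "f z = z [^] n" using k by simp
    have "f y = f z \<otimes> f (c [^] t)" using hom_mult[OF f z, of "c [^] t"] c(1) by (simp flip: y_eq)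
    also have "f (c [^] t) = (c [^] n) [^] t" using hom_int_pow[OF f c(1) is_group is_group] n by simp
    also have "f z \<otimes> (c [^] n) [^] t = (z \<otimes> c [^] t) [^] n"
      using fz z c(1) by (simp add: int_pow_distrib int_pow_pow mult.commute)
    finally show ?thesis by (simp flip: y_eq)
  qed
  then show thesis using that by blast
qed

section \<open>The circle group\<close>

lemma additive_continuous_imp_linear:
  fixes h :: "real \<Rightarrow> real"
  assumes add: "\<And>s t. h (s + t) = h s + h t" and cont: "continuous_on UNIV h"
  shows "h t = t * h 1"
proof -
  have h0: "h 0 = 0" using add[of 0 0] by simp
  have nat: "h (real n * t) = real n * h t" for n t
    by (induction n) (simp_all add: h0 add distrib_right)
  have neg: "h (- t) = - h t" for t using add[of t "- t"] h0 by simp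
  have int: "h (of_int k * t) = of_int k * h t" for k t
    by (cases k rule: int_cases2) (simp_all add: nat neg)
  have rat: "h q = q * h 1" if "q \<in> \<rat>" for q
  proof -
    obtain a b :: int where ab: "b > 0" "q = of_int a / of_int b"
      using \<open>q \<in> \<rat>\<close> by (rule Rats_cases')
    have "of_int b * h q = h (of_int a * 1)" using int[of b q] ab by simp
    also have "\<dots> = of_int a * h 1" by (rule int)
    also have "real_of_int a = of_int b * q" using ab by simp
    finally show ?thesis using ab(1) by simp
  qed
  have "closed {t. h t = t * h 1}"
    by (intro closed_Collect_eq continuous_intros cont)
  moreover have "\<rat> \<subseteq> {t. h t = t * h 1}" using rat by blast
  ultimately have "closure \<rat> \<subseteq> {t. h t = t * h 1}" by (simp add: closure_minimal)
  then show ?thesis using Rats_closure_real by auto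
qed

text \<open>The line is contractible, so \<open>f\<close> has a continuous logarithm, purely
  imaginary and normalised to vanish at 0. Its failure to be additive is continuous with values in
  the multiples of 2 pi, hence constant, and it vanishes at 0. A continuous additive function is
  linear.\<close>

lemma continuous_hom_real_circle:
  fixes f :: "real \<Rightarrow> complex"
  assumes cont: "continuous_on UNIV f" and add: "\<And>s t. f (s + t) = f s * f t" and norm: "\<And>t. norm (f t) = 1"
  obtains c where "\<And>t. f t = cis (c * t)"
proof -
  have nz: "f t \<noteq> 0" for t using norm[of t] by auto
  have "f 0 * f 0 = f 0" using add[of 0 0] by simp
  then have f0: "f 0 = 1" using nz[of 0] by simp
  obtain g where g: "continuous_on UNIV g" "\<And>t. f t = exp (g t)"
    using continuous_logarithm_on_contractible[OF cont] nz by auto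
  have Re0: "Re (g t) = 0" for t using norm[of t] g(2)[of t] by simp
  have f_cis: "f t = cis (Im (g t))" for t
    using g(2)[of t] Re0[of t] by (simp add: exp_eq_polar)
  define h where "h t = Im (g t) - Im (g 0)" for t
  have fh: "f t = cis (h t)" for t
    using f_cis[of t] f_cis[of 0] f0 by (simp add: h_def cis_divide[symmetric])
  have conth: "continuous_on UNIV h" unfolding h_def by (intro continuous_intros g(1))
  have "h (s + t) = h s + h t" for s t
  proof -
    define D where "D t = h (s + t) - h s - h t" for t
    have contD: "continuous_on UNIV D"
      unfolding D_def by (intro continuous_intros continuous_on_compose2[OF conth]) auto
    have D_int: "\<exists>k::int. D t = 2 * pi * of_int k" for t
    proof -
      have "cis (D t) = f (s + t) / f s / f t" by (simp add: D_def fh cis_divide)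
      also have "\<dots> = 1" using add nz by simp
      finally have "cos (D t) = 1" by (simp add: complex_eq_iff)
      then show ?thesis by (auto simp: cos_one_2pi_int mult_ac)
    qed
    have "D constant_on UNIV"
    proof (rule continuous_discrete_range_constant[OF _ contD])
      fix x
      show "\<exists>e>0. \<forall>y. y \<in> UNIV \<and> D y \<noteq> D x \<longrightarrow> e \<le> norm (D y - D x)"
      proof (intro exI[of _ "2 * pi"] conjI allI impI)
        fix y assume y: "y \<in> UNIV \<and> D y \<noteq> D x"
        obtain k l :: int where kl: "D y = 2 * pi * of_int k" "D x = 2 * pi * of_int l" using D_int by meson
        then have "k \<noteq> l" using y by auto
        then have "1 \<le> \<bar>k - l\<bar>" by linarith
        then have "1 \<le> \<bar>real_of_int k - real_of_int l\<bar>" by (metis of_int_1_le_iff of_int_abs of_int_diff)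
        moreover have "D y - D x = 2 * pi * (real_of_int k - real_of_int l)" using kl by (simp add: algebra_simps)
        ultimately show "2 * pi \<le> norm (D y - D x)" by (simp add: abs_mult)
      qed simp
    qed simp
    then have "D t = D 0" unfolding constant_on_def by auto
    also have "D 0 = 0" by (simp add: D_def h_def)
    finally show ?thesis by (simp add: D_def)
  qed
  then have lin: "h t = t * h 1" for t by (rule additive_continuous_imp_linear[OF _ conth])
  have "f t = cis (h 1 * t)" for t unfolding fh[of t] lin[of t] by (simp add: mult.commute)
  then show thesis by (rule that)
qed

text \<open>On the circle, squaring w multiplies \<open>1 - Re w\<close> by
  \<open>2 * (1 + Re w)\<close>, at least 2 as long as \<open>Re w\<close> is positive. A nonzero
  \<open>1 - Re z\<close> would grow beyond 1 under repeated squaring, contradicting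
  positivity.\<close>

lemma circle_no_small_subgroups:
  assumes z: "norm z = 1" and pos: "\<And>n::nat. Re (z ^ n) > 0"
  shows "z = 1"
proof (rule ccontr)
  assume "z \<noteq> 1"
  have sq: "1 - Re (w\<^sup>2) = 2 * (1 - Re w) * (1 + Re w)" if "norm w = 1" for w
  proof -
    have "(Re w)\<^sup>2 + (Im w)\<^sup>2 = 1" using that cmod_power2[of w] by simp
    then show ?thesis by (simp add: power2_eq_square algebra_simps)
  qed
  have "Re z \<noteq> 1"
  proof
    assume "Re z = 1"
    moreover have "(Re z)\<^sup>2 + (Im z)\<^sup>2 = 1" using z cmod_power2[of z] by simp
    ultimately show False using \<open>z \<noteq> 1\<close> by (simp add: complex_eq_iff)
  qed
  moreover have "Re z \<le> 1" using complex_Re_le_cmod[of z] z by simp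
  ultimately have u: "1 - Re z > 0" by simp
  have grow: "2 ^ k * (1 - Re z) \<le> 1 - Re (z ^ (2 ^ k))" for k :: nat
  proof (induction k)
    case (Suc k)
    let ?w = "z ^ (2 ^ k)"
    have nw: "norm ?w = 1" using z by (simp add: norm_power)
    have "Re ?w \<le> 1" using complex_Re_le_cmod[of ?w] nw by simp
    then have "2 * (1 - Re ?w) * 1 \<le> 2 * (1 - Re ?w) * (1 + Re ?w)"
      using pos[of "2 ^ k"] by (intro mult_left_mono) auto
    also have "\<dots> = 1 - Re (z ^ (2 ^ Suc k))"
      unfolding sq[OF nw, symmetric] by (simp add: power_mult[symmetric] mult.commute)
    finally show ?case using Suc by simp
  qed simp
  obtain k :: nat where "1 / (1 - Re z) < 2 ^ k" using real_arch_pow[of 2 "1 / (1 - Re z)"] by auto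
  then have "1 < 2 ^ k * (1 - Re z)" using u by (simp add: field_simps)
  then show False using grow[of k] pos[of "2 ^ k"] by linarith
qed

section \<open>The circle as a compact abelian group and its endomorphisms\<close>

lemma circle_simps [simp]:
  "carrier circle_group = sphere 0 1" "x \<otimes>\<^bsub>circle_group\<^esub> y = x * y" "\<one>\<^bsub>circle_group\<^esub> = 1"
  by (simp_all add: circle_group_def)

lemma comm_group_circle [simp]: "comm_group circle_group"
proof (rule comm_groupI)
  fix x assume x: "x \<in> carrier circle_group"
  then have "inverse x \<in> carrier circle_group" "inverse x \<otimes>\<^bsub>circle_group\<^esub> x = \<one>\<^bsub>circle_group\<^esub>"
    by (cases "x = 0"; auto simp: norm_inverse)+
  then show "\<exists>y\<in>carrier circle_group. y \<otimes>\<^bsub>circle_group\<^esub> x = \<one>\<^bsub>circle_group\<^esub>" by blast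
qed (auto simp: norm_mult)

lemma group_circle [simp]: "group circle_group"
  using comm_group_circle unfolding comm_group_def by blast

lemma inv_circle: "x \<in> sphere 0 1 \<Longrightarrow> inv\<^bsub>circle_group\<^esub> x = inverse x"
  by (cases "x = 0"; auto simp: norm_inverse intro!: group.inv_equality)

lemma nat_pow_circle: "x [^]\<^bsub>circle_group\<^esub> (n::nat) = x ^ n"
  by (induction n) (simp_all add: nat_pow_def)

lemma int_pow_circle:
  assumes "x \<in> sphere 0 1"
  shows "x [^]\<^bsub>circle_group\<^esub> (n::int) = x powi n"
proof -
  have "x ^ k \<in> sphere 0 1" for k :: nat using assms by (simp add: norm_power)
  then show ?thesis
    by (simp add: int_pow_def2 nat_pow_circle power_int_def inv_circle power_inverse)
qed

text \<open>Composed with \<open>cis\<close>, the endomorphism becomes \<open>cis (c * t)\<close>;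
  periodicity at 2 pi makes \<open>c\<close> an integer.\<close>

lemma circle_endomorphism:
  assumes "f \<in> continuous_hom circle_group (top_of_set (sphere 0 1)) circle_group (top_of_set (sphere 0 1))"
  obtains n :: int where "\<And>z. z \<in> sphere 0 1 \<Longrightarrow> f z = z powi n"
proof -
  have hom: "f (x * y) = f x * f y" if "x \<in> sphere 0 1" "y \<in> sphere 0 1" for x y
    using assms that unfolding continuous_hom_def hom_def by auto
  have f: "continuous_on (sphere 0 1) f" "f \<in> sphere 0 1 \<rightarrow> sphere 0 1"
    using assms unfolding continuous_hom_def by (auto simp: hom_def)
  have "continuous_on UNIV (\<lambda>t. f (cis t))"
    by (rule continuous_on_compose2[OF f(1)]) (auto intro!: continuous_intros)
  moreover have "f (cis (s + t)) = f (cis s) * f (cis t)" for s t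
    using hom[of "cis s" "cis t"] by (simp add: cis_mult)
  moreover have "norm (f (cis t)) = 1" for t using f(2) by (force simp: Pi_iff)
  ultimately obtain c where c: "\<And>t. f (cis t) = cis (c * t)"
    using continuous_hom_real_circle[of "\<lambda>t. f (cis t)"] by blast
  have "cis (c * (2 * pi)) = 1" using c[of "2 * pi"] c[of 0] by simp
  then have "cos (c * (2 * pi)) = 1" by (simp add: complex_eq_iff)
  then obtain n :: int where n: "c = of_int n" by (auto simp: cos_one_2pi_int)
  have "f z = z powi n" if "z \<in> sphere 0 1" for z
  proof -
    have "z = cis (Arg z)" using that cis_Arg[of z] by (cases "z = 0") (auto simp: sgn_eq)
    then show ?thesis using c[of "Arg z"] n by (metis cis_power_int)
  qed
  then show thesis using that by blast
qed

abbreviation circle_topology :: "complex topology"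
  where "circle_topology \<equiv> top_of_set (sphere 0 1)"

lemma continuous_map_circle_mult:
  assumes "continuous_map X circle_topology f" "continuous_map X circle_topology g"
  shows "continuous_map X circle_topology (\<lambda>x. f x * g x)"
proof -
  have fg: "continuous_map X euclidean f" "continuous_map X euclidean g"
    and S: "f \<in> topspace X \<rightarrow> sphere 0 1" "g \<in> topspace X \<rightarrow> sphere 0 1"
    using assms by (auto simp: continuous_map_in_subtopology)
  have "continuous_map X euclidean (\<lambda>x. (f x, g x))"
    using continuous_map_pairedI[OF fg] by (simp add: prod_topology_euclidean)
  from continuous_map_euclidean_compose[OF this, of "\<lambda>p. fst p * snd p"]
  have "continuous_map X euclidean (\<lambda>x. f x * g x)" by (simp add: continuous_intros)
  then show ?thesis using S by (auto simp: continuous_map_in_subtopology norm_mult Pi_iff)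
qed

lemma compact_abelian_group_circle: "compact_abelian_group circle_group circle_topology"
proof (intro compact_abelian_group.intro comm_group_circle compact_abelian_group_axioms.intro)
  show "compact_space circle_topology"
    by (intro compact_space_subtopology) (simp add: compactin_euclidean_iff)
  show "Hausdorff_space circle_topology" by (intro Hausdorff_space_subtopology Hausdorff_space_euclidean)
  show "continuous_map (prod_topology circle_topology circle_topology) circle_topology (\<lambda>(x, y). x \<otimes>\<^bsub>circle_group\<^esub> y)"
    using continuous_map_circle_mult[OF continuous_map_fst continuous_map_snd]
    by (simp add: case_prod_unfold)
  have "continuous_map circle_topology circle_topology inverse"
    by (auto simp: norm_inverse intro!: continuous_intros)
  then show "continuous_map circle_topology circle_topology (\<lambda>x. inv\<^bsub>circle_group\<^esub> x)"
    by (rule continuous_map_eq) (simp add: inv_circle)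
qed simp

section \<open>The dual group\<close>

lemma compact_abelian_group_product:
  assumes G: "\<And>i. i \<in> I \<Longrightarrow> compact_abelian_group (G i) (T i)"
  shows "compact_abelian_group (product_group I G) (product_topology T I)"
proof (intro compact_abelian_group.intro compact_abelian_group_axioms.intro)
  have grp: "group (G i)" if "i \<in> I" for i
    using G[OF that] unfolding compact_abelian_group_def comm_group_def by blast
  have comm: "comm_monoid (G i)" if "i \<in> I" for i
    using G[OF that] unfolding compact_abelian_group_def comm_group_def by blast
  have top: "topspace (T i) = carrier (G i)" if "i \<in> I" for i
    by (rule compact_abelian_group.topspace_eq[OF G[OF that]])
  show "comm_group (product_group I G)"
    by (rule group.group_comm_groupI[OF product_group[OF grp]])
      (auto simp: PiE_iff comm_monoid.m_comm[OF comm] intro!: restrict_ext)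
  show top_eq: "topspace (product_topology T I) = carrier (product_group I G)"
    by (simp add: topspace_product_topology top cong: PiE_cong)
  show "compact_space (product_topology T I)"
    using compact_abelian_group.compact[OF G] by (simp add: compact_space_product_topology)
  show "Hausdorff_space (product_topology T I)"
    using compact_abelian_group.Hausdorff[OF G] by (simp add: Hausdorff_space_product_topology)
  have proj: "continuous_map (product_topology T I) (T i) (\<lambda>x. x i)" if "i \<in> I" for i
    by (rule continuous_map_product_projection[OF that])
  show "continuous_map (prod_topology (product_topology T I) (product_topology T I)) (product_topology T I)
    (\<lambda>(x, y). x \<otimes>\<^bsub>product_group I G\<^esub> y)"
  proof -
    let ?P = "prod_topology (product_topology T I) (product_topology T I)"
    have "continuous_map ?P (T i) (\<lambda>p. fst p i \<otimes>\<^bsub>G i\<^esub> snd p i)" if i: "i \<in> I" for i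
      by (rule compact_abelian_group.continuous_map_mult[OF G[OF i]])
        (use continuous_map_compose[OF continuous_map_fst proj[OF i]]
          continuous_map_compose[OF continuous_map_snd proj[OF i]] in \<open>auto simp: o_def\<close>)
    then show ?thesis
      by (auto simp: continuous_map_componentwise case_prod_unfold)
  qed
  have "continuous_map (product_topology T I) (product_topology T I) (\<lambda>x. \<lambda>i\<in>I. inv\<^bsub>G i\<^esub> x i)"
    unfolding continuous_map_componentwise
  proof (intro conjI ballI)
    fix i assume i: "i \<in> I"
    have "continuous_map (product_topology T I) (T i) (\<lambda>x. inv\<^bsub>G i\<^esub> x i)"
      using continuous_map_compose[OF proj[OF i] compact_abelian_group.continuous_inv[OF G[OF i]]]
      by (simp add: o_def)
    then show "continuous_map (product_topology T I) (T i) (\<lambda>x. (\<lambda>i\<in>I. inv\<^bsub>G i\<^esub> x i) i)" using i by simp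
  qed auto
  then show "continuous_map (product_topology T I) (product_topology T I) (\<lambda>x. inv\<^bsub>product_group I G\<^esub> x)"
    by (rule continuous_map_eq) (use top_eq in \<open>simp add: inv_product_group[OF _ grp]\<close>)
qed

lemma torus_simps: "torus d = product_group {..<d} (\<lambda>_. circle_group)"
  "torus_topology d = product_topology (\<lambda>_. circle_topology) {..<d}"
  by (simp_all add: torus_def torus_topology_def)

lemma compact_abelian_group_torus: "compact_abelian_group (torus d) (torus_topology d)"
  unfolding torus_simps by (rule compact_abelian_group_product[OF compact_abelian_group_circle])

lemma continuous_hom_compose:
  assumes "f \<in> continuous_hom A S B T" "g \<in> continuous_hom B T C U"
  shows "(\<lambda>x. g (f x)) \<in> continuous_hom A S C U"
proof -
  have "continuous_map S U (g \<circ> f)"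
    by (rule continuous_map_compose) (use assms in \<open>auto simp: continuous_hom_def\<close>)
  moreover have "(\<lambda>x. g (f x)) \<in> hom A C"
    using assms by (simp add: continuous_hom_def hom_def Pi_def)
  ultimately show ?thesis by (simp add: continuous_hom_def o_def)
qed

lemma continuous_hom_cong:
  assumes "f \<in> continuous_hom A S B T" "topspace S = carrier A" "group A" "\<And>x. x \<in> carrier A \<Longrightarrow> f x = g x"
  shows "g \<in> continuous_hom A S B T"
proof -
  have "g \<in> hom A B"
    using assms unfolding continuous_hom_def hom_def
    by (auto simp: Pi_iff) (metis assms(4) group.is_monoid monoid.m_closed)
  moreover have "continuous_map S T g"
    using assms by (intro continuous_map_eq[of S T f g]) (auto simp: continuous_hom_def)
  ultimately show ?thesis by (simp add: continuous_hom_def)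
qed

context compact_abelian_group
begin

lemma compact_abelian_group_subgroup:
  assumes H: "subgroup H G" and closed: "closedin T H"
  shows "compact_abelian_group (G\<lparr>carrier := H\<rparr>) (subtopology T H)"
proof (intro compact_abelian_group.intro compact_abelian_group_axioms.intro)
  have HG: "H \<subseteq> carrier G" by (rule subgroup.subset[OF H])
  have grp: "group (G\<lparr>carrier := H\<rparr>)" by (rule subgroup.subgroup_is_group[OF H is_group])
  show "comm_group (G\<lparr>carrier := H\<rparr>)"
    by (rule group.group_comm_groupI[OF grp]) (use HG m_comm in auto)
  show "topspace (subtopology T H) = carrier (G\<lparr>carrier := H\<rparr>)"
    using HG by (auto simp: topspace_eq)
  show "compact_space (subtopology T H)"
    using closedin_compact_space[OF compact closed] by (rule compact_space_subtopology)
  show "Hausdorff_space (subtopology T H)" by (rule Hausdorff_space_subtopology[OF Hausdorff])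
  have "continuous_map (prod_topology (subtopology T H) (subtopology T H)) T (\<lambda>p. fst p \<otimes> snd p)"
    by (intro continuous_map_mult continuous_map_into_fulltopology[OF continuous_map_fst]
        continuous_map_into_fulltopology[OF continuous_map_snd])
  then show "continuous_map (prod_topology (subtopology T H) (subtopology T H)) (subtopology T H)
     (\<lambda>(x, y). x \<otimes>\<^bsub>G\<lparr>carrier := H\<rparr>\<^esub> y)"
    using subgroup.m_closed[OF H] by (auto simp: continuous_map_in_subtopology case_prod_unfold)
  have "continuous_map (subtopology T H) (subtopology T H) (\<lambda>x. inv x)"
    using subgroup.m_inv_closed[OF H]
    by (auto simp: continuous_map_in_subtopology intro: continuous_map_from_subtopology[OF continuous_inv])
  then show "continuous_map (subtopology T H) (subtopology T H) (\<lambda>x. inv\<^bsub>G\<lparr>carrier := H\<rparr>\<^esub> x)"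
    by (rule continuous_map_eq) (use m_inv_consistent[OF H] in auto)
qed

lemma continuous_nat_pow: "continuous_map T T (\<lambda>x. x [^] (n::nat))"
proof (induction n)
  case (Suc n)
  have "continuous_map T T (\<lambda>x. x [^] n \<otimes> x)" by (rule continuous_map_mult[OF Suc]) simp
  then show ?case by simp
qed (simp add: topspace_eq)

lemma continuous_int_pow: "continuous_map T T (\<lambda>x. x [^] (n::int))"
proof (cases "n < 0")
  case True
  have "continuous_map T T ((\<lambda>x. inv x) \<circ> (\<lambda>x. x [^] nat (- n)))"
    by (rule continuous_map_compose[OF continuous_nat_pow continuous_inv])
  moreover have "(\<lambda>x. x [^] n) = (\<lambda>x. inv x) \<circ> (\<lambda>x. x [^] nat (- n))"
    using True by (intro ext) (simp only: int_pow_def2[of G _ n] o_def if_True)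
  ultimately show ?thesis by (simp only:)
next
  case False
  then have "(\<lambda>x. x [^] n) = (\<lambda>x. x [^] nat n)"
    by (intro ext) (simp only: int_pow_def2[of G _ n] if_False)
  then show ?thesis using continuous_nat_pow by (simp only:)
qed

lemma int_pow_continuous_hom: "(\<lambda>x. x [^] (n::int)) \<in> continuous_hom G T G T"
  unfolding continuous_hom_def hom_def by (auto simp: int_pow_distrib continuous_int_pow)

lemma continuous_homI:
  assumes "f \<in> continuous_hom G T B U" "\<And>x. x \<in> carrier G \<Longrightarrow> f x = g x"
  shows "g \<in> continuous_hom G T B U"
  by (rule continuous_hom_cong[OF assms(1) topspace_eq is_group assms(2)])

lemma int_pow_extensible:
  assumes B: "compact_abelian_group B U" and \<theta>: "\<theta> \<in> continuous_hom G T B U"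
    and \<phi>: "\<And>a. a \<in> carrier G \<Longrightarrow> \<phi> a = a [^] (n::int)"
  shows "extensible_along G B U \<theta> \<phi>"
  unfolding extensible_along_def
proof (intro bexI ballI)
  show "(\<lambda>x. x [^]\<^bsub>B\<^esub> n) \<in> continuous_hom B U B U"
    by (rule compact_abelian_group.int_pow_continuous_hom[OF B])
  fix a assume a: "a \<in> carrier G"
  have "group B" using B unfolding compact_abelian_group_def comm_group_def by blast
  moreover have "\<theta> \<in> hom G B" using \<theta> by (simp add: continuous_hom_def)
  ultimately show "\<theta> a [^]\<^bsub>B\<^esub> n = \<theta> (\<phi> a)"
    using hom_int_pow[of \<theta> G B a n] a \<phi>[OF a] is_group by simp
qed

section \<open>Continuous characters and the dual group\<close>

abbreviation characters :: "('a \<Rightarrow> complex) set"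
  where "characters \<equiv> continuous_hom G T circle_group circle_topology"

lemma character_simps:
  assumes "\<psi> \<in> characters"
  shows "x \<in> carrier G \<Longrightarrow> norm (\<psi> x) = 1" "x \<in> carrier G \<Longrightarrow> \<psi> x \<noteq> 0"
    "x \<in> carrier G \<Longrightarrow> y \<in> carrier G \<Longrightarrow> \<psi> (x \<otimes> y) = \<psi> x * \<psi> y"
    "x \<in> carrier G \<Longrightarrow> \<psi> (x [^] (n::int)) = \<psi> x powi n" "\<psi> \<one> = 1"
    "x \<in> carrier G \<Longrightarrow> \<psi> (inv x) = inverse (\<psi> x)"
proof -
  have hom: "\<psi> \<in> hom G circle_group" using assms by (simp add: continuous_hom_def)
  then have S: "\<psi> x \<in> sphere 0 1" if "x \<in> carrier G" for x
    using that hom_in_carrier[OF hom] by simp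
  then show "x \<in> carrier G \<Longrightarrow> norm (\<psi> x) = 1" "x \<in> carrier G \<Longrightarrow> \<psi> x \<noteq> 0" by force+
  show "x \<in> carrier G \<Longrightarrow> y \<in> carrier G \<Longrightarrow> \<psi> (x \<otimes> y) = \<psi> x * \<psi> y"
    using hom_mult[OF hom] by simp
  show "x \<in> carrier G \<Longrightarrow> \<psi> (x [^] (n::int)) = \<psi> x powi n"
    using hom_int_pow[OF hom _ is_group group_circle] int_pow_circle[OF S] by simp
  show "\<psi> \<one> = 1" using hom_one[OF hom is_group group_circle] by simp
  show "x \<in> carrier G \<Longrightarrow> \<psi> (inv x) = inverse (\<psi> x)"
    using group_hom.hom_inv[of G circle_group \<psi> x] hom is_group inv_circle[OF S]
    by (simp add: group_hom_def group_hom_axioms_def)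
qed

lemma characters_separate:
  assumes "x \<in> carrier G" "x \<noteq> \<one>"
  obtains \<psi> where "\<psi> \<in> characters" "\<psi> x \<noteq> 1"
proof -
  obtain \<psi> where \<psi>: "\<psi> \<in> unitary_characters" "continuous_map T euclidean \<psi>" "\<psi> x \<noteq> 1"
    using characters_separate_points[OF assms] by blast
  have "\<psi> \<in> characters"
    using \<psi>(1,2) unfolding continuous_hom_def hom_def unitary_characters_def
    by (auto simp: continuous_map_in_subtopology topspace_eq)
  then show thesis using that \<psi>(3) by blast
qed

lemma eq_if_characters_eq:
  assumes "x \<in> carrier G" "y \<in> carrier G" "\<And>\<psi>. \<psi> \<in> characters \<Longrightarrow> \<psi> x = \<psi> y"
  shows "x = y"
proof (rule ccontr)
  assume "x \<noteq> y"
  then have "x \<otimes> inv y \<noteq> \<one>" using assms(1,2) by (metis inv_closed inv_equality inv_inv)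
  then obtain \<psi> where \<psi>: "\<psi> \<in> characters" "\<psi> (x \<otimes> inv y) \<noteq> 1"
    using characters_separate[of "x \<otimes> inv y"] assms by auto
  have "\<psi> (x \<otimes> inv y) = \<psi> x / \<psi> y" using character_simps[OF \<psi>(1)] assms by (simp add: divide_inverse)
  then show False using \<psi> assms character_simps(2)[OF \<psi>(1) assms(2)] by simp
qed

text \<open>Functions are constrained only on carriers, so many functions represent the same
  character. Extensionality picks one of them, which makes equality in the dual mean equality on the
  carrier.\<close>

definition dual :: "('a \<Rightarrow> complex) monoid"
  where "dual = \<lparr>carrier = {\<psi> \<in> characters. \<psi> \<in> extensional (carrier G)},
    monoid.mult = (\<lambda>\<psi> \<eta>. \<lambda>a\<in>carrier G. \<psi> a * \<eta> a), one = (\<lambda>a\<in>carrier G. 1)\<rparr>"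

lemma restrict_character: "\<psi> \<in> characters \<Longrightarrow> restrict \<psi> (carrier G) \<in> carrier dual"
  unfolding dual_def using continuous_homI[of \<psi> circle_group circle_topology "restrict \<psi> (carrier G)"] by simp

lemma comm_group_dual: "comm_group dual"
proof (rule comm_groupI)
  have mult: "(\<lambda>a\<in>carrier G. \<psi> a * \<eta> a) \<in> characters" if "\<psi> \<in> characters" "\<eta> \<in> characters" for \<psi> \<eta>
  proof (rule continuous_homI)
    show "(\<lambda>a. \<psi> a * \<eta> a) \<in> characters"
      using that continuous_map_circle_mult[of T \<psi> \<eta>] character_simps[OF that(1)] character_simps[OF that(2)]
      unfolding continuous_hom_def hom_def by (auto simp: norm_mult)
  qed simp
  show "\<psi> \<otimes>\<^bsub>dual\<^esub> \<eta> \<in> carrier dual" if "\<psi> \<in> carrier dual" "\<eta> \<in> carrier dual" for \<psi> \<eta>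
    using that mult by (simp add: dual_def)
  have "(\<lambda>a. 1) \<in> characters" unfolding continuous_hom_def hom_def by auto
  from restrict_character[OF this] show "\<one>\<^bsub>dual\<^esub> \<in> carrier dual" by (simp add: dual_def)
  show "\<psi> \<otimes>\<^bsub>dual\<^esub> \<eta> \<otimes>\<^bsub>dual\<^esub> \<xi> = \<psi> \<otimes>\<^bsub>dual\<^esub> (\<eta> \<otimes>\<^bsub>dual\<^esub> \<xi>)" for \<psi> \<eta> \<xi>
    by (auto simp: dual_def intro!: restrict_ext)
  show "\<psi> \<otimes>\<^bsub>dual\<^esub> \<eta> = \<eta> \<otimes>\<^bsub>dual\<^esub> \<psi>" for \<psi> \<eta> by (simp add: dual_def mult.commute)
  show "\<one>\<^bsub>dual\<^esub> \<otimes>\<^bsub>dual\<^esub> \<psi> = \<psi>" if "\<psi> \<in> carrier dual" for \<psi>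
    using that by (auto simp: dual_def extensional_def)
  show "\<exists>\<eta>\<in>carrier dual. \<eta> \<otimes>\<^bsub>dual\<^esub> \<psi> = \<one>\<^bsub>dual\<^esub>" if "\<psi> \<in> carrier dual" for \<psi>
  proof -
    have \<psi>: "\<psi> \<in> characters" using that by (simp add: dual_def)
    have "(\<lambda>a. \<psi> (inv a)) \<in> characters"
    proof -
      have "(\<lambda>a. inv a) \<in> continuous_hom G T G T"
        unfolding continuous_hom_def hom_def by (auto simp: continuous_inv inv_mult)
      from continuous_hom_compose[OF this \<psi>] show ?thesis .
    qed
    then have "restrict (\<lambda>a. \<psi> (inv a)) (carrier G) \<in> carrier dual" by (rule restrict_character)
    moreover have "restrict (\<lambda>a. \<psi> (inv a)) (carrier G) \<otimes>\<^bsub>dual\<^esub> \<psi> = \<one>\<^bsub>dual\<^esub>"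
      using character_simps[OF \<psi>] by (auto simp: dual_def intro!: restrict_ext)
    ultimately show ?thesis by blast
  qed
qed

lemma group_dual: "group dual"
  using comm_group_dual by (simp add: comm_group_def)

lemma dual_character: "\<psi> \<in> carrier dual \<Longrightarrow> \<psi> \<in> characters"
  by (simp add: dual_def)

lemma dual_eqI:
  assumes "\<psi> \<in> carrier dual" "\<eta> \<in> carrier dual" "\<And>a. a \<in> carrier G \<Longrightarrow> \<psi> a = \<eta> a"
  shows "\<psi> = \<eta>"
  by (rule extensionalityI[of _ "carrier G"]) (use assms in \<open>auto simp: dual_def\<close>)

lemma dual_int_pow:
  assumes \<psi>: "\<psi> \<in> carrier dual" and a: "a \<in> carrier G"
  shows "(\<psi> [^]\<^bsub>dual\<^esub> (n::int)) a = \<psi> a powi n"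
proof -
  have "(\<lambda>\<psi>. \<psi> a) \<in> hom dual circle_group"
    using a character_simps unfolding hom_def by (auto simp: dual_def)
  from hom_int_pow[OF this \<psi> group_dual group_circle]
  show ?thesis using character_simps(1)[OF dual_character[OF \<psi>] a] by (simp add: int_pow_circle)
qed

lemma dual_one: "a \<in> carrier G \<Longrightarrow> \<one>\<^bsub>dual\<^esub> a = 1"
  by (simp add: dual_def)

definition pullback :: "('a \<Rightarrow> 'a) \<Rightarrow> ('a \<Rightarrow> complex) \<Rightarrow> 'a \<Rightarrow> complex"
  where "pullback \<phi> \<psi> = (\<lambda>a\<in>carrier G. \<psi> (\<phi> a))"

lemma pullback_hom:
  assumes "\<phi> \<in> continuous_hom G T G T"
  shows "pullback \<phi> \<in> hom dual dual"
proof (rule homI)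
  fix \<psi> assume "\<psi> \<in> carrier dual"
  then show "pullback \<phi> \<psi> \<in> carrier dual"
    unfolding pullback_def using restrict_character[OF continuous_hom_compose[OF assms dual_character]] by simp
next
  fix \<psi> \<eta>
  have "\<phi> a \<in> carrier G" if "a \<in> carrier G" for a
    using assms that by (auto simp: continuous_hom_def hom_def)
  then show "pullback \<phi> (\<psi> \<otimes>\<^bsub>dual\<^esub> \<eta>) = pullback \<phi> \<psi> \<otimes>\<^bsub>dual\<^esub> pullback \<phi> \<eta>"
    by (auto simp: pullback_def dual_def intro!: restrict_ext)
qed

text \<open>Only the one-dimensional torus is needed: it makes \<open>\<phi>\<close> preserve the cyclic subgroups of the
  dual group.\<close>

lemma extensible_tori_character:
  assumes ext: "extensible_tori G T \<phi>" and \<psi>: "\<psi> \<in> characters"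
  obtains n :: int where "\<And>a. a \<in> carrier G \<Longrightarrow> \<psi> (\<phi> a) = \<psi> a powi n"
proof -
  \<comment> \<open>Elements of \<open>torus 1\<close> are extensional functions on
    \<open>{..<1}\<close>. This map and evaluation at 0 identify it with the circle, whose
    endomorphisms are known to be powers.\<close>
  define \<iota> where "\<iota> z = (\<lambda>i\<in>{..<1::nat}. z :: complex)" for z
  have \<iota>: "\<iota> \<in> continuous_hom circle_group circle_topology (torus 1) (torus_topology 1)"
    unfolding continuous_hom_def hom_def torus_simps \<iota>_def
    by (auto simp: continuous_map_componentwise PiE_iff)
  have pr: "(\<lambda>x. x 0) \<in> continuous_hom (torus 1) (torus_topology 1) circle_group circle_topology"
    unfolding continuous_hom_def hom_def torus_simps
    by (auto simp: PiE_iff intro!: continuous_map_product_projection)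
  have \<theta>: "(\<lambda>a. \<iota> (\<psi> a)) \<in> continuous_hom G T (torus 1) (torus_topology 1)"
    by (rule continuous_hom_compose[OF \<psi> \<iota>])
  then have "extensible_along G (torus 1) (torus_topology 1) (\<lambda>a. \<iota> (\<psi> a)) \<phi>"
    using ext unfolding extensible_tori_def by blast
  then obtain \<phi>' where \<phi>': "\<phi>' \<in> continuous_hom (torus 1) (torus_topology 1) (torus 1) (torus_topology 1)"
    and eq: "\<forall>a\<in>carrier G. \<phi>' (\<iota> (\<psi> a)) = \<iota> (\<psi> (\<phi> a))"
    unfolding extensible_along_def by blast
  have endo: "(\<lambda>z. \<phi>' (\<iota> z) 0) \<in> continuous_hom circle_group circle_topology circle_group circle_topology"
    by (rule continuous_hom_compose[OF continuous_hom_compose[OF \<iota> \<phi>'] pr])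
  then obtain n :: int where n: "\<And>z. z \<in> sphere 0 1 \<Longrightarrow> \<phi>' (\<iota> z) 0 = z powi n"
    using circle_endomorphism[OF endo] by blast
  have "\<psi> (\<phi> a) = \<psi> a powi n" if a: "a \<in> carrier G" for a
  proof -
    have "\<psi> (\<phi> a) = \<iota> (\<psi> (\<phi> a)) 0" by (simp add: \<iota>_def)
    also have "\<dots> = \<phi>' (\<iota> (\<psi> a)) 0" using eq a by simp
    also have "\<dots> = \<psi> a powi n" using n[of "\<psi> a"] character_simps(1)[OF \<psi> a] by simp
    finally show ?thesis .
  qed
  then show thesis using that by blast
qed

lemma pullback_pointwise_power:
  assumes \<phi>: "\<phi> \<in> continuous_hom G T G T" and ext: "extensible_tori G T \<phi>" and \<psi>: "\<psi> \<in> carrier dual"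
  shows "\<exists>n::int. pullback \<phi> \<psi> = \<psi> [^]\<^bsub>dual\<^esub> n"
proof -
  obtain n :: int where n: "\<And>a. a \<in> carrier G \<Longrightarrow> \<psi> (\<phi> a) = \<psi> a powi n"
    using extensible_tori_character[OF ext dual_character[OF \<psi>]] by blast
  have "pullback \<phi> \<psi> = \<psi> [^]\<^bsub>dual\<^esub> n"
  proof (rule dual_eqI)
    show "pullback \<phi> \<psi> \<in> carrier dual" using hom_in_carrier[OF pullback_hom[OF \<phi>] \<psi>] .
    show "\<psi> [^]\<^bsub>dual\<^esub> n \<in> carrier dual" using group.int_pow_closed[OF group_dual \<psi>] .
  qed (simp add: dual_int_pow[OF \<psi>] n pullback_def)
  then show ?thesis by blast
qed

lemma int_pow_if_pullback_int_pow:
  assumes \<phi>: "\<phi> \<in> continuous_hom G T G T"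
    and n: "\<And>\<psi>. \<psi> \<in> carrier dual \<Longrightarrow> pullback \<phi> \<psi> = \<psi> [^]\<^bsub>dual\<^esub> (n::int)" and a: "a \<in> carrier G"
  shows "\<phi> a = a [^] n"
proof (rule eq_if_characters_eq)
  have \<phi>G: "\<phi> a \<in> carrier G" using \<phi> a by (auto simp: continuous_hom_def hom_def)
  then show "\<phi> a \<in> carrier G" "a [^] n \<in> carrier G" using a by auto
  fix \<psi> assume \<psi>: "\<psi> \<in> characters"
  let ?\<psi> = "restrict \<psi> (carrier G)"
  have r: "?\<psi> \<in> carrier dual" by (rule restrict_character[OF \<psi>])
  have "\<psi> (\<phi> a) = pullback \<phi> ?\<psi> a" using a \<phi>G by (simp add: pullback_def)
  also have "\<dots> = ?\<psi> a powi n" using n[OF r] dual_int_pow[OF r a] by simp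
  finally show "\<psi> (\<phi> a) = \<psi> (a [^] n)" using a character_simps(4)[OF \<psi> a] by simp
qed

lemma extensible_tori_int_pow:
  assumes \<phi>: "\<phi> \<in> continuous_hom G T G T" and ext: "extensible_tori G T \<phi>"
    and \<psi>: "\<psi> \<in> carrier dual" "\<And>k::int. \<psi> [^]\<^bsub>dual\<^esub> k = \<one>\<^bsub>dual\<^esub> \<Longrightarrow> k = 0"
  obtains n :: int where "\<And>a. a \<in> carrier G \<Longrightarrow> \<phi> a = a [^] n"
proof -
  obtain n :: int where "\<And>\<psi>. \<psi> \<in> carrier dual \<Longrightarrow> pullback \<phi> \<psi> = \<psi> [^]\<^bsub>dual\<^esub> n"
    using comm_group.pointwise_power_hom_infinite_order[OF comm_group_dual pullback_hom[OF \<phi>]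
        pullback_pointwise_power[OF \<phi> ext] \<psi>] by blast
  then show thesis using that int_pow_if_pullback_int_pow[OF \<phi>] by blast
qed

end

section \<open>Profinite groups\<close>

lemma (in comm_group) rcos_eq_iff:
  assumes "subgroup N G" "x \<in> carrier G" "y \<in> carrier G"
  shows "N #> x = N #> y \<longleftrightarrow> x \<otimes> inv y \<in> N"
proof
  assume "N #> x = N #> y"
  then have "x \<in> N #> y" using rcos_self[OF assms(2,1)] by simp
  then show "x \<otimes> inv y \<in> N" using subgroup.rcos_module_imp[OF assms(1) is_group assms(3)] by simp
next
  assume "x \<otimes> inv y \<in> N"
  then have "x \<in> N #> y" by (rule subgroup.rcos_module_rev[OF assms(1) is_group assms(3,2)])
  then show "N #> x = N #> y" using repr_independence[OF _ assms(3,1)] by simp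
qed

text \<open>Multiplication by the larger subgroup is thus the projection from cosets of
  \<open>M\<close> to cosets of \<open>N\<close>, expressed without choosing representatives. It
  serves as the transition map between quotients.\<close>

lemma (in comm_group) set_mult_rcos:
  assumes N: "subgroup N G" and M: "subgroup M G" "M \<subseteq> N" and x: "x \<in> carrier G"
  shows "N <#> (M #> x) = N #> x"
proof -
  have sub: "N \<subseteq> carrier G" "M \<subseteq> carrier G" using N M by (auto dest: subgroup.subset)
  have "N <#> M = N"
  proof
    show "N <#> M \<subseteq> N" using M(2) subgroup.m_closed[OF N] by (auto simp: set_mult_def)
    show "N \<subseteq> N <#> M"
    proof
      fix n assume n: "n \<in> N"
      then have "n = n \<otimes> \<one>" using sub by auto
      then show "n \<in> N <#> M" using n subgroup.one_closed[OF M(1)] unfolding set_mult_def by blast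
    qed
  qed
  then show ?thesis using setmult_rcos_assoc[OF sub x] by simp
qed

lemma (in comm_group) FactGroup_facts:
  assumes N: "subgroup N G"
  shows "group (G Mod N)" "a \<in> carrier G \<Longrightarrow> (N #> a) [^]\<^bsub>G Mod N\<^esub> (k::int) = N #> (a [^] k)"
    "a \<in> carrier G \<Longrightarrow> b \<in> carrier G \<Longrightarrow> (N #> a) <#> (N #> b) = N #> (a \<otimes> b)"
    "a \<in> carrier G \<Longrightarrow> a [^] card (carrier (G Mod N)) \<in> N"
proof -
  interpret normal N G using N by (simp add: normal_iff_subgroup)
  show grp: "group (G Mod N)" by (rule factorgroup_is_group)
  show "a \<in> carrier G \<Longrightarrow> (N #> a) [^]\<^bsub>G Mod N\<^esub> (k::int) = N #> (a [^] k)" by (rule FactGroup_int_pow)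
  show "a \<in> carrier G \<Longrightarrow> b \<in> carrier G \<Longrightarrow> (N #> a) <#> (N #> b) = N #> (a \<otimes> b)" by (rule rcos_sum)
  assume a: "a \<in> carrier G"
  let ?n = "card (carrier (G Mod N))"
  have "(N #> a) [^]\<^bsub>G Mod N\<^esub> ?n = \<one>\<^bsub>G Mod N\<^esub>"
    using group.pow_order_eq_1[OF grp, of "N #> a"] a by (simp add: order_def carrier_FactGroup)
  then have "N #> (a [^] ?n) = N" using FactGroup_pow[OF a] by simp
  then show "a [^] ?n \<in> N" using rcos_self[OF nat_pow_closed[OF a, of ?n] N] by simp
qed

lemma (in comm_group) int_pow_mem_if_dvd:
  assumes N: "subgroup N G" and a: "a \<in> carrier G" and k: "int (card (carrier (G Mod N))) dvd k"
  shows "a [^] k \<in> N"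
proof -
  obtain l where "k = int (card (carrier (G Mod N))) * l" using k by (rule dvdE)
  then have "a [^] k = (a [^] card (carrier (G Mod N))) [^] l"
    using a by (simp add: int_pow_int flip: int_pow_pow)
  moreover have "b [^] l \<in> N" if "b \<in> N" for b
    using int_pow_consistent[OF N that, of l] group.int_pow_closed[OF subgroup.subgroup_is_group[OF N is_group]] that
    by simp
  ultimately show ?thesis using FactGroup_facts(4)[OF N a] by simp
qed

lemma (in comm_group) rcos_int_pow_eq:
  assumes N: "subgroup N G" and a: "a \<in> carrier G" and k: "int (card (carrier (G Mod N))) dvd k - l"
  shows "N #> (a [^] k) = N #> (a [^] l)"
  using int_pow_mem_if_dvd[OF assms] a by (simp add: rcos_eq_iff[OF N] int_pow_diff)

text \<open>The elements killed by \<open>K\<close> form a subgroup, mapped to itself because f acts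
  on each element by a power, and its exponent is finite.\<close>

lemma (in comm_group) pointwise_power_hom_torsion:
  assumes f: "f \<in> hom G G" and pw: "\<And>x. x \<in> carrier G \<Longrightarrow> \<exists>n::int. f x = x [^] n" and K: "K > 0"
  obtains n :: int where "\<And>x. x \<in> carrier G \<Longrightarrow> x [^] (K::nat) = \<one> \<Longrightarrow> f x = x [^] n"
proof -
  define H where "H = {x \<in> carrier G. x [^] K = \<one>}"
  have H: "subgroup H G"
    by (rule subgroupI) (auto simp: H_def nat_pow_inv nat_pow_distrib intro!: exI[of _ \<one>])
  let ?H = "G\<lparr>carrier := H\<rparr>"
  interpret H: comm_group ?H
    by (rule group.group_comm_groupI[OF subgroup.subgroup_is_group[OF H is_group]])
      (use m_comm in \<open>auto simp: H_def\<close>)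
  have pow: "x [^]\<^bsub>?H\<^esub> (n::int) = x [^] n" if "x \<in> H" for x n
    using int_pow_consistent[OF H that] by simp
  have pwH: "\<exists>n::int. f x = x [^]\<^bsub>?H\<^esub> n" if "x \<in> carrier ?H" for x
    using pw[of x] pow[of x] that by (auto simp: H_def)
  have "f x \<in> H" if "x \<in> H" for x
    using pwH[of x] that H.int_pow_closed[of x] by auto
  then have "f \<in> hom ?H ?H" using f by (auto simp: hom_def H_def Pi_iff)
  moreover have "x [^]\<^bsub>?H\<^esub> K = \<one>\<^bsub>?H\<^esub>" if "x \<in> carrier ?H" for x
    using that nat_pow_consistent[of x K H] by (simp add: H_def)
  ultimately obtain n :: int where "\<And>x. x \<in> carrier ?H \<Longrightarrow> f x = x [^]\<^bsub>?H\<^esub> n"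
    using H.pointwise_power_hom_exponent[where f = f, OF _ pwH K] by blast
  then have "f x = x [^] n" if "x \<in> carrier G" "x [^] K = \<one>" for x
    using that pow[of x n] by (simp add: H_def)
  then show thesis by (rule that)
qed

section \<open>Open subgroups, finite quotients and a criterion for being profinite\<close>

context compact_abelian_group
begin

definition open_subgroup :: "'a set \<Rightarrow> bool"
  where "open_subgroup N \<longleftrightarrow> subgroup N G \<and> openin T N"

lemma open_subgroupD: "open_subgroup N \<Longrightarrow> subgroup N G" "open_subgroup N \<Longrightarrow> openin T N"
  by (auto simp: open_subgroup_def)

lemma open_subgroup_carrier: "open_subgroup (carrier G)"
  using openin_topspace[of T] by (simp add: open_subgroup_def subgroup_self topspace_eq)

lemma open_subgroup_Int:
  "open_subgroup N \<Longrightarrow> open_subgroup M \<Longrightarrow> open_subgroup (N \<inter> M)"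
  by (simp add: open_subgroup_def subgroups_Inter_pair openin_Int)

lemma rcos_eq_translate:
  assumes "N \<subseteq> carrier G" "a \<in> carrier G"
  shows "N #> a = (\<lambda>x. a \<otimes> x) ` N"
  using assms m_comm by (auto simp: r_coset_def subset_eq)

lemma openin_rcos:
  assumes "open_subgroup N" "a \<in> carrier G"
  shows "openin T (N #> a)"
  unfolding rcos_eq_translate[OF subgroup.subset[OF open_subgroupD(1)[OF assms(1)]] assms(2)]
  by (rule openin_translate[OF assms(2) open_subgroupD(2)[OF assms(1)]])

lemma closedin_rcos:
  assumes N: "open_subgroup N" and a: "a \<in> carrier G"
  shows "closedin T (N #> a)"
proof -
  have sub: "subgroup N G" using N by (simp add: open_subgroup_def)
  have NG: "N #> b \<subseteq> carrier G" if "b \<in> carrier G" for b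
    using r_coset_subset_G[OF subgroup.subset[OF sub] that] .
  have disj: "N #> a = N #> b" if "c \<in> N #> a" "c \<in> N #> b" "b \<in> carrier G" for b c
    using repr_independence[OF that(1) a sub] repr_independence[OF that(2,3) sub] by simp
  have "topspace T - (N #> a) = \<Union>((\<lambda>b. N #> b) ` (carrier G - (N #> a)))"
  proof (intro subset_antisym subsetI)
    fix b assume "b \<in> topspace T - (N #> a)"
    then show "b \<in> \<Union>((\<lambda>b. N #> b) ` (carrier G - (N #> a)))"
      using rcos_self[OF _ sub] by (auto simp: topspace_eq)
  next
    fix c assume "c \<in> \<Union>((\<lambda>b. N #> b) ` (carrier G - (N #> a)))"
    then obtain b where b: "b \<in> carrier G" "b \<notin> N #> a" "c \<in> N #> b" by blast
    then have "c \<notin> N #> a" using disj[of c b] rcos_self[OF b(1) sub] by auto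
    then show "c \<in> topspace T - (N #> a)" using NG[OF b(1)] b(3) by (auto simp: topspace_eq)
  qed
  moreover have "openin T (\<Union>((\<lambda>b. N #> b) ` (carrier G - (N #> a))))"
    using openin_rcos[OF N] by (intro openin_Union) auto
  ultimately show ?thesis using NG[OF a] by (simp add: closedin_def topspace_eq)
qed

lemma finite_FactGroup:
  assumes N: "open_subgroup N"
  shows "finite (carrier (G Mod N))"
proof -
  have sub: "subgroup N G" using N by (simp add: open_subgroup_def)
  obtain bs where "bs \<noteq> []" and bs: "set bs \<subseteq> carrier G"
    and cover: "\<And>x. x \<in> carrier G \<Longrightarrow> \<exists>b\<in>set bs. \<exists>v\<in>N. x = b \<otimes> v"
    by (rule finite_translates_cover[OF open_subgroupD(2)[OF N] subgroup.one_closed[OF sub]]) (rule that)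
  have "carrier (G Mod N) \<subseteq> (\<lambda>b. N #> b) ` set bs"
  proof
    fix C assume "C \<in> carrier (G Mod N)"
    then obtain x where x: "x \<in> carrier G" "C = N #> x" by (auto simp: carrier_FactGroup)
    obtain b v where b: "b \<in> set bs" "v \<in> N" "x = b \<otimes> v" using cover[OF x(1)] by blast
    then have "b \<in> carrier G" "v \<in> carrier G" using bs subgroup.subset[OF sub] by auto
    then have "x \<otimes> inv b = v" using b(3) by (simp add: m_comm[of b v] m_assoc)
    then have "C = N #> b" using rcos_eq_iff[OF sub x(1), of b] x b bs by auto
    then show "C \<in> (\<lambda>b. N #> b) ` set bs" using b(1) by blast
  qed
  then show ?thesis by (rule finite_subset) simp
qed

lemma card_FactGroup_pos:
  assumes N: "open_subgroup N"
  shows "card (carrier (G Mod N)) > 0"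
proof -
  have "carrier (G Mod N) \<noteq> {}" by (auto simp: carrier_FactGroup)
  then show ?thesis using finite_FactGroup[OF N] by (simp add: card_gt_0_iff)
qed

text \<open>The cosets are closed, and finitely many of them meet because the representative chosen
  for the intersection of their subgroups lies in all of them. Compactness gives a common point.
  This yields both surjectivity onto the inverse limit and the existence of profinite
  multiples.\<close>

lemma compatible_cosets_meet:
  assumes c: "\<And>N. open_subgroup N \<Longrightarrow> c N \<in> carrier G"
    and comp: "\<And>N M. open_subgroup N \<Longrightarrow> open_subgroup M \<Longrightarrow> M \<subseteq> N \<Longrightarrow> N #> c M = N #> c N"
  obtains b where "b \<in> carrier G" "\<And>N. open_subgroup N \<Longrightarrow> N #> b = N #> c N"
proof -
  define \<U> where "\<U> = (\<lambda>N. N #> c N) ` {N. open_subgroup N}"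
  have mem: "c M \<in> N #> c N" if "open_subgroup N" "open_subgroup M" "M \<subseteq> N" for N M
    using rcos_self[OF c[OF that(2)] open_subgroupD(1)[OF that(1)]] comp[OF that] by simp
  have fip: "\<Inter>\<F> \<noteq> {}" if F: "finite \<F>" "\<F> \<subseteq> \<U>" for \<F>
  proof -
    obtain I where I: "finite I" "I \<subseteq> {N. open_subgroup N}" "\<F> = (\<lambda>N. N #> c N) ` I"
      using finite_subset_image[OF F(1) F(2)[unfolded \<U>_def]] by blast
    have "\<exists>M. open_subgroup M \<and> (\<forall>N\<in>I. M \<subseteq> N)"
      using I(1,2)
    proof (induction I rule: finite_induct)
      case empty then show ?case using open_subgroup_carrier by auto
    next
      case (insert N I)
      then obtain M where "open_subgroup M" "\<forall>N\<in>I. M \<subseteq> N" by auto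
      then show ?case using insert open_subgroup_Int[of N M] by (intro exI[of _ "N \<inter> M"]) auto
    qed
    then obtain M where M: "open_subgroup M" "\<forall>N\<in>I. M \<subseteq> N" by blast
    then have "c M \<in> \<Inter>\<F>" using I mem[OF _ M(1)] by auto
    then show ?thesis by blast
  qed
  have closed: "closedin T C" if "C \<in> \<U>" for C
    using that closedin_rcos c by (auto simp: \<U>_def)
  have "\<Inter>\<U> \<noteq> {}"
    using compact[unfolded compact_space_fip] closed fip by blast
  then obtain b where b: "b \<in> \<Inter>\<U>" by blast
  then have bN: "b \<in> N #> c N" if "open_subgroup N" for N using that by (auto simp: \<U>_def)
  have bG: "b \<in> carrier G"
    using bN[OF open_subgroup_carrier] r_coset_subset_G[OF subset_refl c[OF open_subgroup_carrier]] by blast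
  show thesis
  proof (rule that[OF bG])
    fix N assume N: "open_subgroup N"
    show "N #> b = N #> c N"
      using repr_independence[OF bN[OF N] c[OF N] open_subgroupD(1)[OF N]] by simp
  qed
qed

text \<open>A finite image makes 1 an isolated value, so the kernel is the preimage of an open
  set.\<close>

lemma open_subgroup_kernel:
  assumes \<psi>: "\<psi> \<in> characters" and fin: "finite (\<psi> ` carrier G)"
  shows "open_subgroup {a \<in> carrier G. \<psi> a = 1}"
  unfolding open_subgroup_def
proof
  show "subgroup {a \<in> carrier G. \<psi> a = 1} G"
    by (rule subgroupI) (use character_simps[OF \<psi>] in auto)
  have "continuous_map T euclidean \<psi>" using \<psi> by (auto simp: continuous_hom_def continuous_map_in_subtopology)
  moreover have "open (- (\<psi> ` carrier G - {1}))"
    using fin by (intro open_Compl finite_imp_closed) auto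
  ultimately have "openin T {x \<in> topspace T. \<psi> x \<in> - (\<psi> ` carrier G - {1})}"
    by (intro openin_continuous_map_preimage) auto
  moreover have "{x \<in> topspace T. \<psi> x \<in> - (\<psi> ` carrier G - {1})} = {a \<in> carrier G. \<psi> a = 1}"
    by (auto simp: topspace_eq)
  ultimately show "openin T {a \<in> carrier G. \<psi> a = 1}" by simp
qed

lemma finite_image_if_torsion:
  assumes \<psi>: "\<psi> \<in> carrier dual" "\<psi> [^]\<^bsub>dual\<^esub> (k::int) = \<one>\<^bsub>dual\<^esub>" "k \<noteq> 0"
  shows "finite (\<psi> ` carrier G)"
proof -
  have "\<psi> a ^ nat \<bar>k\<bar> = 1" if a: "a \<in> carrier G" for a
  proof -
    have "\<psi> a powi k = 1" using dual_int_pow[OF \<psi>(1) a, of k] \<psi>(2) dual_one[OF a] by simp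
    then show ?thesis by (cases "k \<ge> 0") (auto simp: power_int_def abs_if inverse_eq_1_iff power_inverse)
  qed
  then have "\<psi> ` carrier G \<subseteq> {z. z ^ nat \<bar>k\<bar> = 1}" by auto
  moreover have "finite {z::complex. z ^ nat \<bar>k\<bar> = 1}"
    using \<psi>(3) by (intro finite_roots_unity) auto
  ultimately show ?thesis by (rule finite_subset)
qed

lemma finite_inverse_system_open_subgroups:
  "finite_inverse_system {N. open_subgroup N} (\<lambda>N M. M \<subseteq> N) (\<lambda>N. G Mod N) (\<lambda>N M C. N <#> C)"
proof (rule finite_inverse_system.intro)
  show "{N. open_subgroup N} \<noteq> {}" using open_subgroup_carrier by blast
  fix N M assume NM: "N \<in> {N. open_subgroup N}" "M \<in> {N. open_subgroup N}"
  then have sub: "subgroup N G" "subgroup M G" by (auto simp: open_subgroup_def)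
  show "\<exists>K\<in>{N. open_subgroup N}. K \<subseteq> N \<and> K \<subseteq> M"
    using open_subgroup_Int[of N M] NM by auto
  assume le: "M \<subseteq> N"
  show "(<#>) N \<in> hom (G Mod M) (G Mod N)"
  proof (rule homI)
    fix C assume "C \<in> carrier (G Mod M)"
    then obtain x where "x \<in> carrier G" "C = M #> x" by (auto simp: carrier_FactGroup)
    then show "N <#> C \<in> carrier (G Mod N)"
      using set_mult_rcos[OF sub le] by (auto simp: carrier_FactGroup)
  next
    fix C D assume "C \<in> carrier (G Mod M)" "D \<in> carrier (G Mod M)"
    then obtain x y where x: "x \<in> carrier G" "C = M #> x" and y: "y \<in> carrier G" "D = M #> y"
      by (auto simp: carrier_FactGroup)
    show "N <#> (C \<otimes>\<^bsub>G Mod M\<^esub> D) = (N <#> C) \<otimes>\<^bsub>G Mod N\<^esub> (N <#> D)"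
      unfolding mult_FactGroup x(2) y(2) FactGroup_facts(3)[OF sub(2) x(1) y(1)]
        set_mult_rcos[OF sub le x(1)] set_mult_rcos[OF sub le y(1)] FactGroup_facts(3)[OF sub(1) x(1) y(1)]
      by (rule set_mult_rcos[OF sub le m_closed[OF x(1) y(1)]])
  qed
next
  fix N x assume "N \<in> {N. open_subgroup N}" "x \<in> carrier (G Mod N)"
  then show "N <#> x = x"
    using set_mult_rcos[OF _ _ subset_refl, of N] by (auto simp: open_subgroup_def carrier_FactGroup)
next
  fix N M K x
  assume I: "N \<in> {N. open_subgroup N}" "M \<in> {N. open_subgroup N}" "K \<in> {N. open_subgroup N}"
    and le: "M \<subseteq> N" "K \<subseteq> M" and x: "x \<in> carrier (G Mod K)"
  then obtain y where y: "y \<in> carrier G" "x = K #> y" by (auto simp: carrier_FactGroup)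
  have sub: "subgroup N G" "subgroup M G" "subgroup K G" using I by (auto simp: open_subgroup_def)
  show "N <#> (M <#> x) = N <#> x"
    unfolding y(2) set_mult_rcos[OF sub(2,3) le(2) y(1)] set_mult_rcos[OF sub(1,2) le(1) y(1)]
      set_mult_rcos[OF sub(1,3) subset_trans[OF le(2,1)] y(1)] ..
qed (auto simp: open_subgroup_def FactGroup_facts(1) finite_FactGroup)

lemma continuous_rcos:
  assumes N: "open_subgroup N"
  shows "continuous_map T (discrete_topology (carrier (G Mod N))) (\<lambda>a. N #> a)"
proof -
  have "openin T {a \<in> topspace T. N #> a \<in> U}" for U
  proof (subst openin_subopen, intro ballI)
    fix a assume "a \<in> {a \<in> topspace T. N #> a \<in> U}"
    then have a: "a \<in> carrier G" "N #> a \<in> U" by (auto simp: topspace_eq)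
    show "\<exists>V. openin T V \<and> a \<in> V \<and> V \<subseteq> {a \<in> topspace T. N #> a \<in> U}"
    proof (intro exI[of _ "N #> a"] conjI openin_rcos[OF N] rcos_self open_subgroupD(1)[OF N] a(1) subsetI)
      fix b assume b: "b \<in> N #> a"
      then have "N #> a = N #> b" using repr_independence[OF b a(1) open_subgroupD(1)[OF N]] by simp
      moreover have "b \<in> carrier G"
        using b r_coset_subset_G[OF subgroup.subset[OF open_subgroupD(1)[OF N]] a(1)] by blast
      ultimately show "b \<in> {a \<in> topspace T. N #> a \<in> U}" using a by (simp add: topspace_eq)
    qed
  qed
  then show ?thesis
    by (auto simp: continuous_map_def carrier_FactGroup topspace_eq)
qed

text \<open>Map an element to its cosets modulo all open subgroups. The hypothesis makes this
  injective and \<open>compatible_cosets_meet\<close> makes it surjective; a continuous bijection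
  from a compact space to a Hausdorff space is a homeomorphism.\<close>

lemma profinite_if_open_subgroups_separate:
  assumes sep: "\<And>a. a \<in> carrier G \<Longrightarrow> (\<And>N. open_subgroup N \<Longrightarrow> a \<in> N) \<Longrightarrow> a = \<one>"
  shows "profinite G T"
proof -
  let ?I = "{N. open_subgroup N}"
  let ?below = "\<lambda>N M :: 'a set. M \<subseteq> N"
  let ?p = "\<lambda>N M C. N <#> C"
  let ?L = "inverse_limit ?I ?below (\<lambda>N. G Mod N) ?p"
  define h where "h a = (\<lambda>N\<in>?I. N #> a)" for a
  have carrier_L: "carrier ?L = {x \<in> PiE ?I (\<lambda>N. carrier (G Mod N)).
      \<forall>N\<in>?I. \<forall>M\<in>?I. M \<subseteq> N \<longrightarrow> N <#> x M = x N}"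
    by (simp add: inverse_limit_def)
  have mult_L: "x \<otimes>\<^bsub>?L\<^esub> y = (\<lambda>N\<in>?I. x N <#> y N)" for x y
    by (simp add: inverse_limit_def)
  have h_mem: "h a \<in> carrier ?L" if "a \<in> carrier G" for a
    using that set_mult_rcos[of _ _ a] unfolding carrier_L h_def
    by (auto simp: carrier_FactGroup open_subgroup_def)
  have "h \<in> hom G ?L"
    using h_mem FactGroup_facts(3)[OF open_subgroupD(1)]
    by (intro homI) (auto simp: mult_L h_def intro!: restrict_ext)
  have inj: "inj_on h (carrier G)"
  proof (rule inj_onI)
    fix a b assume ab: "a \<in> carrier G" "b \<in> carrier G" "h a = h b"
    have "a \<otimes> inv b \<in> N" if "open_subgroup N" for N
    proof -
      have "N #> a = N #> b" using fun_cong[OF ab(3), of N] that by (simp add: h_def)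
      then show ?thesis using rcos_eq_iff[OF open_subgroupD(1)[OF that] ab(1,2)] by simp
    qed
    then have "a \<otimes> inv b = \<one>" using ab by (intro sep) auto
    then show "a = b" using ab by (metis inv_closed inv_equality inv_inv)
  qed
  have surj: "h ` carrier G = carrier ?L"
  proof (intro subset_antisym subsetI)
    fix x assume x: "x \<in> carrier ?L"
    then have "\<forall>N\<in>?I. \<exists>a. a \<in> carrier G \<and> x N = N #> a"
      unfolding carrier_L by (force simp: carrier_FactGroup PiE_iff)
    then obtain c where c: "\<And>N. open_subgroup N \<Longrightarrow> c N \<in> carrier G \<and> x N = N #> c N"
      by (metis mem_Collect_eq)
    have "N #> c M = N #> c N" if NM: "open_subgroup N" "open_subgroup M" "M \<subseteq> N" for N M
    proof -
      have "N <#> x M = x N" using x NM unfolding carrier_L by blast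
      then show ?thesis
        using c[OF NM(1)] c[OF NM(2)] set_mult_rcos[OF open_subgroupD(1)[OF NM(1)] open_subgroupD(1)[OF NM(2)] NM(3)]
        by simp
    qed
    with c obtain b where b: "b \<in> carrier G" "\<And>N. open_subgroup N \<Longrightarrow> N #> b = N #> c N"
      using compatible_cosets_meet[of c] by metis
    have "x \<in> extensional ?I" using x unfolding carrier_L by (auto simp: PiE_iff)
    then have "x = h b"
      by (rule extensionalityI) (use b c in \<open>auto simp: h_def\<close>)
    then show "x \<in> h ` carrier G" using b(1) by blast
  qed (use h_mem in auto)
  have "h \<in> iso G ?L"
    using \<open>h \<in> hom G ?L\<close> inj surj by (simp add: iso_def bij_betw_def)
  moreover have "homeomorphic_map T (inverse_limit_topology ?I ?below (\<lambda>N. G Mod N) ?p) h"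
    unfolding inverse_limit_topology_def
  proof (rule continuous_imp_homeomorphic_map[OF _ compact])
    let ?P = "product_topology (\<lambda>N. discrete_topology (carrier (G Mod N))) ?I"
    have top: "topspace (subtopology ?P (carrier ?L)) = carrier ?L"
      unfolding carrier_L by (auto simp: topspace_product_topology)
    then show "h ` topspace T = topspace (subtopology ?P (carrier ?L))"
      by (simp add: surj topspace_eq)
    show "inj_on h (topspace T)" using inj by (simp add: topspace_eq)
    show "Hausdorff_space (subtopology ?P (carrier ?L))"
      by (intro Hausdorff_space_subtopology) (simp add: Hausdorff_space_product_topology)
    have "continuous_map T ?P h"
      unfolding continuous_map_componentwise h_def by (auto intro: continuous_rcos)
    then show "continuous_map T (subtopology ?P (carrier ?L)) h"
      using h_mem by (auto simp: continuous_map_in_subtopology topspace_eq)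
  qed
  ultimately show ?thesis
    unfolding profinite_def using finite_inverse_system_open_subgroups by blast
qed

text \<open>If every character is torsion, every character has finite image and an open kernel. As
  characters separate points, these open subgroups do too, and the group is profinite.\<close>

lemma infinite_order_character:
  assumes "\<not> profinite G T"
  obtains \<psi> where "\<psi> \<in> carrier dual" "\<And>k::int. \<psi> [^]\<^bsub>dual\<^esub> k = \<one>\<^bsub>dual\<^esub> \<Longrightarrow> k = 0"
proof (rule ccontr)
  note found = that
  assume no: "\<not> thesis"
  have fin: "finite (\<psi> ` carrier G)" if \<psi>: "\<psi> \<in> carrier dual" for \<psi>
  proof -
    obtain k :: int where "\<psi> [^]\<^bsub>dual\<^esub> k = \<one>\<^bsub>dual\<^esub>" "k \<noteq> 0" using no found[OF \<psi>] by blast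
    then show ?thesis by (rule finite_image_if_torsion[OF \<psi>])
  qed
  have "profinite G T"
  proof (rule profinite_if_open_subgroups_separate, rule ccontr)
    fix a assume a: "a \<in> carrier G" "\<And>N. open_subgroup N \<Longrightarrow> a \<in> N" "a \<noteq> \<one>"
    obtain \<psi> where \<psi>: "\<psi> \<in> characters" "\<psi> a \<noteq> 1" using characters_separate[OF a(1,3)] by blast
    have "\<psi> ` carrier G = restrict \<psi> (carrier G) ` carrier G" by auto
    then have "finite (\<psi> ` carrier G)" using fin[OF restrict_character[OF \<psi>(1)]] by simp
    from a(2)[OF open_subgroup_kernel[OF \<psi>(1) this]] \<psi>(2) show False by simp
  qed
  then show False using assms by contradiction
qed

end

text \<open>Choices made one k at a time need not be coherent, so compactness is used. Sequences of
  residues form a compact product of finite sets, and validity at k together with coherence at the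
  divisors of k is a closed condition. Finitely many such conditions are met by the residues of one
  integer valid at the product of the indices.\<close>

lemma profinite_integers_choice:
  fixes P :: "nat \<Rightarrow> int \<Rightarrow> bool"
  assumes ex: "\<And>k. k > 0 \<Longrightarrow> \<exists>m. P k m"
    and mod: "\<And>k l m. k > 0 \<Longrightarrow> l > 0 \<Longrightarrow> k dvd l \<Longrightarrow> P l m \<Longrightarrow> P k (m mod int k)"
  obtains n where "n \<in> profinite_integers" "\<And>k. k > 0 \<Longrightarrow> P k (n k)"
proof -
  \<comment> \<open>A profinite integer is extensional on the positive naturals. The singleton at 0
    fixes that default value, so that the product can be taken over all naturals.\<close>
  define S where "S k = (if k = 0 then {undefined} else {0..<int k})" for k :: nat
  have "compactin (product_topology (\<lambda>_. euclidean) UNIV) (PiE UNIV S)"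
    unfolding compactin_PiE by (auto simp: compactin_euclidean_iff S_def finite_imp_compact)
  then have comp: "compact (PiE UNIV S)" by (simp add: euclidean_product_topology compactin_euclidean_iff)
  define D where "D k = {x. P k (x k)} \<inter> (\<Inter>j\<in>{j. 0 < j \<and> j dvd k}. {x. x k mod int j = x j})" for k
  have cont: "continuous_on UNIV (\<lambda>x::nat \<Rightarrow> int. f (x k))" for f :: "int \<Rightarrow> int" and k
  proof -
    have "continuous_on UNIV f" by (simp add: continuous_on_open_vimage open_discrete)
    then show ?thesis by (rule continuous_on_compose2[OF _ continuous_on_product_coordinates]) simp
  qed
  have "PiE UNIV S \<inter> (\<Inter>k\<in>{0<..}. D k) \<noteq> {}"
  proof (rule compact_imp_fip_image[OF comp])
    fix k :: nat
    have "closed {x. P k (x k)}"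
      using closed_vimage[OF _ continuous_on_product_coordinates, of "{m. P k m}" k]
      by (simp add: vimage_def closed_def open_discrete)
    then show "closed (D k)"
      unfolding D_def by (intro closed_Int closed_INT ballI closed_Collect_eq cont) auto
  next
    fix I' :: "nat set" assume I': "finite I'" "I' \<subseteq> {0<..}"
    define l where "l = \<Prod>I'"
    have l: "l > 0" using I' unfolding l_def by (intro prod_pos) auto
    have dvd: "k dvd l" if "k \<in> I'" for k using that I'(1) unfolding l_def by (simp add: dvd_prod_eqI)
    obtain m where m: "P l m" using ex[OF l] by blast
    define x where "x j = (if j = 0 then undefined else m mod int j)" for j :: nat
    have "x \<in> PiE UNIV S" by (auto simp: x_def S_def)
    moreover have "x \<in> D k" if k: "k \<in> I'" for k
    proof -
      have "k > 0" using k I'(2) by auto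
      moreover have "x k mod int j = x j" if "0 < j" "j dvd k" for j
        using that \<open>k > 0\<close> by (simp add: x_def mod_mod_cancel)
      ultimately show ?thesis using mod[OF _ l dvd[OF k] m] by (simp add: D_def x_def)
    qed
    ultimately show "PiE UNIV S \<inter> (\<Inter>k\<in>I'. D k) \<noteq> {}" by blast
  qed
  then obtain n where n: "n \<in> PiE UNIV S" "\<And>k. k > 0 \<Longrightarrow> n \<in> D k" by auto
  have nS: "n k \<in> S k" for k using n(1) by auto
  have "n k \<in> {0..<int k}" if "k > 0" for k
    using nS[of k] that by (simp add: S_def del: atLeastLessThan_iff)
  moreover have "n 0 = undefined" using nS[of 0] by (simp add: S_def)
  ultimately have "n \<in> (\<Pi>\<^sub>E k\<in>{0<..}. {0..<int k})"
    unfolding PiE_iff extensional_def by (auto simp del: atLeastLessThan_iff)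
  then have "n \<in> profinite_integers"
    using n(2) unfolding profinite_integers_def D_def by auto
  then show thesis using that n(2) unfolding D_def by auto
qed

section \<open>Small open subgroups and scaling by profinite integers\<close>

context compact_abelian_group
begin

text \<open>The image of \<open>V\<close> in the inverse limit contains a basic neighbourhood of the
  image of the identity, and that constrains only finitely many coordinates. The elements trivial in
  these coordinates form an open subgroup inside \<open>V\<close>.\<close>

lemma profinite_open_subgroup:
  assumes prof: "profinite G T" and V: "openin T V" "\<one> \<in> V"
  obtains N where "open_subgroup N" "N \<subseteq> V"
proof -
  obtain I :: "'a set set" and below and F :: "'a set \<Rightarrow> 'a set monoid"
      and p :: "'a set \<Rightarrow> 'a set \<Rightarrow> 'a set \<Rightarrow> 'a set" and h :: "'a \<Rightarrow> 'a set \<Rightarrow> 'a set"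
    where sys: "finite_inverse_system I below F p"
    and iso: "h \<in> iso G (inverse_limit I below F p)"
    and homeo: "homeomorphic_map T (inverse_limit_topology I below F p) h"
    using prof unfolding profinite_def by blast
  let ?L = "inverse_limit I below F p" and ?P = "product_topology (\<lambda>i. discrete_topology (carrier (F i))) I"
  have grp: "group (F i)" if "i \<in> I" for i using sys that by (rule finite_inverse_system.groups)
  have L: "carrier ?L \<subseteq> (\<Pi>\<^sub>E i\<in>I. carrier (F i))" "x \<otimes>\<^bsub>?L\<^esub> y = (\<lambda>i\<in>I. x i \<otimes>\<^bsub>F i\<^esub> y i)" for x y
    by (auto simp: inverse_limit_def)
  have h: "h \<in> hom G ?L" "inj_on h (carrier G)" "h ` carrier G = carrier ?L"
    using iso by (auto simp: iso_def bij_betw_def)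
  have hom: "(\<lambda>a. h a i) \<in> hom G (F i)" if i: "i \<in> I" for i
  proof (rule homI)
    fix a assume "a \<in> carrier G"
    then have "h a \<in> carrier ?L" using hom_in_carrier[OF h(1)] by simp
    then show "h a i \<in> carrier (F i)" using L(1) i by (auto simp: PiE_iff)
  next
    fix a b assume "a \<in> carrier G" "b \<in> carrier G"
    then show "h (a \<otimes> b) i = h a i \<otimes>\<^bsub>F i\<^esub> h b i" using hom_mult[OF h(1)] i by (simp add: L(2))
  qed
  have gh: "group_hom G (F i) (\<lambda>a. h a i)" if "i \<in> I" for i
    using hom[OF that] grp[OF that] is_group by (simp add: group_hom_def group_hom_axioms_def)
  have cont: "continuous_map T ?P h"
    using homeomorphic_imp_continuous_map[OF homeo]
    unfolding inverse_limit_topology_def continuous_map_in_subtopology by blast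
  have "openin (inverse_limit_topology I below F p) (h ` V)"
    using homeomorphic_imp_open_map[OF homeo] V(1) by (simp add: open_map_def)
  then obtain W where W: "openin ?P W" "h ` V = W \<inter> carrier ?L"
    unfolding inverse_limit_topology_def openin_subtopology by blast
  then have "h \<one> \<in> W" using V(2) by blast
  from bspec[OF W(1)[unfolded openin_product_topology_alt] this] obtain U
    where "finite {i \<in> I. U i \<noteq> topspace (discrete_topology (carrier (F i)))} \<and>
      (\<forall>i\<in>I. openin (discrete_topology (carrier (F i))) (U i)) \<and> h \<one> \<in> PiE I U \<and> PiE I U \<subseteq> W"
    by blast
  then have U: "finite {i \<in> I. U i \<noteq> carrier (F i)}" "h \<one> \<in> PiE I U" "PiE I U \<subseteq> W" by auto
  define J where "J = {i \<in> I. U i \<noteq> carrier (F i)}"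
  have J: "finite J" "J \<subseteq> I" using U(1) by (auto simp: J_def)
  define N where "N = {a \<in> carrier G. \<forall>i\<in>J. h a i = \<one>\<^bsub>F i\<^esub>}"
  have "subgroup N G"
  proof (rule subgroupI)
    have "\<one> \<in> N" using J(2) group_hom.hom_one[OF gh] by (auto simp: N_def)
    then show "N \<noteq> {}" by blast
    show "a \<otimes> b \<in> N" if "a \<in> N" "b \<in> N" for a b
      using that J(2) hom_mult[OF hom] group.is_monoid[OF grp] by (auto simp: N_def subset_eq monoid.l_one)
    show "inv a \<in> N" if "a \<in> N" for a
      using that J(2) group_hom.hom_inv[OF gh] group.is_monoid[OF grp] by (auto simp: N_def subset_eq monoid.inv_one)
  qed (auto simp: N_def)
  moreover have "openin T N"
  proof -
    define E where "E i = (if i \<in> J then {\<one>\<^bsub>F i\<^esub>} else carrier (F i))" for i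
    have "finite {i \<in> I. E i \<noteq> topspace (discrete_topology (carrier (F i)))}"
      by (rule finite_subset[OF _ J(1)]) (auto simp: E_def)
    moreover have "E i \<subseteq> carrier (F i)" if "i \<in> I" for i
      using group.is_monoid[OF grp[OF that]] by (auto simp: E_def monoid.one_closed)
    ultimately have "openin ?P (PiE I E)" by (simp add: openin_PiE_gen)
    from openin_continuous_map_preimage[OF cont this] have "openin T {a \<in> topspace T. h a \<in> PiE I E}" .
    moreover have "h a \<in> PiE I (\<lambda>i. carrier (F i))" if "a \<in> carrier G" for a
      using L(1) hom_in_carrier[OF h(1) that] by blast
    then have "{a \<in> topspace T. h a \<in> PiE I E} = N"
      using J(2) by (auto simp: N_def E_def topspace_eq PiE_iff subset_eq)
    ultimately show ?thesis by simp
  qed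
  moreover have "N \<subseteq> V"
  proof
    fix a assume a: "a \<in> N"
    then have aG: "a \<in> carrier G" by (simp add: N_def)
    have ha: "h a \<in> carrier ?L" using hom_in_carrier[OF h(1) aG] .
    have "h a i \<in> U i" if i: "i \<in> I" for i
    proof (cases "i \<in> J")
      case True
      then have "h a i = h \<one> i" using a group_hom.hom_one[OF gh[OF i]] by (simp add: N_def)
      then show ?thesis using U(2) i by (auto simp: PiE_iff)
    next
      case False
      then show ?thesis using ha L(1) i by (auto simp: J_def PiE_iff)
    qed
    then have "h a \<in> PiE I U" using ha L(1) by (auto simp: PiE_iff)
    then have "h a \<in> h ` V" using U(3) W(2) ha by blast
    then show "a \<in> V" using h(2) aG V(1) openin_subset[of T V] by (auto simp: inj_on_def topspace_eq)
  qed
  ultimately show thesis using that by (simp add: open_subgroup_def)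
qed

lemma nat_pow_mem_subgroup:
  assumes "subgroup N G" "a \<in> N"
  shows "a [^] (n::nat) \<in> N"
  by (induction n) (use assms subgroup.one_closed subgroup.m_closed in auto)

text \<open>Some open subgroup maps into the open right half-plane, and the circle has no nontrivial
  subgroup there.\<close>

lemma profinite_character_kernel:
  assumes prof: "profinite G T" and \<psi>: "\<psi> \<in> characters"
  obtains N where "open_subgroup N" "\<And>a. a \<in> N \<Longrightarrow> \<psi> a = 1"
proof -
  have cont: "continuous_map T euclidean \<psi>" using \<psi> by (auto simp: continuous_hom_def continuous_map_in_subtopology)
  have "openin T {x \<in> topspace T. \<psi> x \<in> {z. Re z > 0}}"
    by (rule openin_continuous_map_preimage[OF cont]) (simp add: open_halfspace_Re_gt)
  then obtain N where N: "open_subgroup N" "N \<subseteq> {x \<in> topspace T. \<psi> x \<in> {z. Re z > 0}}"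
    using profinite_open_subgroup[OF prof, of "{x \<in> topspace T. \<psi> x \<in> {z. Re z > 0}}"]
      character_simps(5)[OF \<psi>] by (auto simp: topspace_eq)
  have "\<psi> a = 1" if a: "a \<in> N" for a
  proof (rule circle_no_small_subgroups)
    have aG: "a \<in> carrier G" using a N(2) by (auto simp: topspace_eq)
    then show "norm (\<psi> a) = 1" by (rule character_simps(1)[OF \<psi>])
    fix n :: nat
    have "a [^] n \<in> N" by (rule nat_pow_mem_subgroup[OF open_subgroupD(1)[OF N(1)] a])
    then have "Re (\<psi> (a [^] n)) > 0" using N(2) by blast
    then show "Re (\<psi> a ^ n) > 0"
      using character_simps(4)[OF \<psi> aG, of "int n"] by (simp add: int_pow_int)
  qed
  then show thesis using that N(1) by blast
qed

lemma character_root_of_unity: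
  assumes N: "open_subgroup N" and \<psi>: "\<psi> \<in> characters" "\<And>a. a \<in> N \<Longrightarrow> \<psi> a = 1" and a: "a \<in> carrier G"
  shows "\<psi> a ^ card (carrier (G Mod N)) = 1"
  using \<psi>(2)[OF FactGroup_facts(4)[OF open_subgroupD(1)[OF N] a]]
    character_simps(4)[OF \<psi>(1) a, of "int (card (carrier (G Mod N)))"] by (simp add: int_pow_int)

lemma profinite_character_finite:
  assumes prof: "profinite G T" and \<psi>: "\<psi> \<in> characters"
  shows "finite (\<psi> ` carrier G)"
proof -
  obtain N where N: "open_subgroup N" "\<And>a. a \<in> N \<Longrightarrow> \<psi> a = 1"
    using profinite_character_kernel[OF prof \<psi>] by blast
  let ?k = "card (carrier (G Mod N))"
  have "\<psi> ` carrier G \<subseteq> {z. z ^ ?k = 1}" using character_root_of_unity[OF N(1) \<psi> N(2)] by auto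
  moreover have "finite {z::complex. z ^ ?k = 1}"
    using card_FactGroup_pos[OF N(1)] by (intro finite_roots_unity) auto
  ultimately show ?thesis by (rule finite_subset)
qed

lemma profinite_eqI:
  assumes prof: "profinite G T" and ab: "a \<in> carrier G" "b \<in> carrier G"
    and eq: "\<And>N. open_subgroup N \<Longrightarrow> N #> a = N #> b"
  shows "a = b"
proof (rule ccontr)
  assume "a \<noteq> b"
  then have ne: "a \<otimes> inv b \<noteq> \<one>" using ab by (metis inv_closed inv_equality inv_inv)
  have "openin T (topspace T - {a \<otimes> inv b})"
    using Hausdorff ab by (intro openin_diff openin_topspace) (simp add: closedin_Hausdorff_singleton topspace_eq)
  then obtain N where N: "open_subgroup N" "N \<subseteq> topspace T - {a \<otimes> inv b}"
    using profinite_open_subgroup[OF prof, of "topspace T - {a \<otimes> inv b}"] ne by (auto simp: topspace_eq)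
  then show False using eq[OF N(1)] rcos_eq_iff[OF open_subgroupD(1)[OF N(1)] ab] by blast
qed

text \<open>This discharges the definite description. The prescribed cosets are compatible, so they
  have a common point by compactness, and it is unique because open subgroups separate the points of
  a profinite group.\<close>

lemma profinite_scale_iff:
  assumes prof: "profinite G T" and n: "n \<in> profinite_integers" and a: "a \<in> carrier G"
  shows "b = profinite_scale G T n a \<longleftrightarrow> b \<in> carrier G \<and>
    (\<forall>N. open_subgroup N \<longrightarrow> N #> b = N #> (a [^] n (card (carrier (G Mod N)))))"
proof -
  define c where "c N = a [^] n (card (carrier (G Mod N)))" for N
  have cong: "n l mod int k = n k" if "k > 0" "l > 0" "k dvd l" for k l
    using n that unfolding profinite_integers_def by blast
  have "N #> c M = N #> c N" if NM: "open_subgroup N" "open_subgroup M" "M \<subseteq> N" for N M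
  proof -
    define i j where "i = card (carrier (G Mod N))" and "j = card (carrier (G Mod M))"
    have ij: "i > 0" "j > 0" using card_FactGroup_pos NM by (auto simp: i_def j_def)
    have sub: "subgroup N G" "subgroup M G" using NM by (auto simp: open_subgroup_def)
    \<comment> \<open>The component at the common multiple \<open>i * j\<close> reduces to the
      components at \<open>i\<close> and at \<open>j\<close>. The power of \<open>a\<close> with
      that exponent therefore represents both prescribed cosets, which gives their
      compatibility.\<close>
    have d: "int i dvd n (i * j) - n i" "int j dvd n (i * j) - n j"
      using dvd_minus_mod[of "int i" "n (i * j)"] dvd_minus_mod[of "int j" "n (i * j)"]
        cong[of i "i * j"] cong[of j "i * j"] ij by simp_all
    have "N #> (a [^] n (i * j)) = N #> (a [^] n i)"
      by (rule rcos_int_pow_eq[OF sub(1) a]) (use d(1) in \<open>simp add: i_def\<close>)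
    moreover have "M #> (a [^] n (i * j)) = M #> (a [^] n j)"
      by (rule rcos_int_pow_eq[OF sub(2) a]) (use d(2) in \<open>simp add: j_def\<close>)
    then have "N #> (a [^] n (i * j)) = N #> (a [^] n j)"
      using set_mult_rcos[OF sub NM(3) int_pow_closed[OF a]] by metis
    ultimately show ?thesis by (simp add: c_def i_def j_def)
  qed
  note comp = this
  have cG: "c N \<in> carrier G" for N using a by (simp add: c_def)
  obtain b0 where b0: "b0 \<in> carrier G" "\<And>N. open_subgroup N \<Longrightarrow> N #> b0 = N #> c N"
    using compatible_cosets_meet[of c, OF cG comp] by blast
  have uniq: "b = b0" if "b \<in> carrier G" "\<And>N. open_subgroup N \<Longrightarrow> N #> b = N #> c N" for b
    by (rule profinite_eqI[OF prof that(1) b0(1)]) (simp add: that(2) b0(2))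
  have fact: "(N #> a) [^]\<^bsub>G Mod N\<^esub> n (card (carrier (G Mod N))) = N #> c N" if "open_subgroup N" for N
    by (simp add: c_def FactGroup_facts(2)[OF open_subgroupD(1)[OF that] a])
  have sc: "profinite_scale G T n a = b0"
    unfolding profinite_scale_def open_subgroup_def[symmetric]
  proof (rule the_equality)
    show "b0 \<in> carrier G \<and> (\<forall>N. open_subgroup N \<longrightarrow> N #> b0 = (N #> a) [^]\<^bsub>G Mod N\<^esub> n (card (carrier (G Mod N))))"
      using b0 fact by simp
    show "b = b0" if "b \<in> carrier G \<and> (\<forall>N. open_subgroup N \<longrightarrow> N #> b = (N #> a) [^]\<^bsub>G Mod N\<^esub> n (card (carrier (G Mod N))))" for b
      using that fact by (intro uniq) auto
  qed
  show ?thesis unfolding sc c_def[symmetric] using b0 uniq by blast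
qed

text \<open>Modulo any open subgroup \<phi> is an ordinary power map, with exponent
  \<open>k N\<close>. This gives the homomorphism property and continuity. A morphism to a torus is
  trivial on some open subgroup, so there the same integral power of the torus extends
  \<phi>.\<close>

lemma profinite_scale_extensible:
  assumes prof: "profinite G T" and n: "n \<in> profinite_integers"
    and \<phi>: "\<And>a. a \<in> carrier G \<Longrightarrow> \<phi> a = profinite_scale G T n a"
  shows "\<phi> \<in> continuous_hom G T G T" "extensible_tori G T \<phi>"
proof -
  define k where "k N = n (card (carrier (G Mod N)))" for N
  have \<phi>G: "\<phi> a \<in> carrier G" if "a \<in> carrier G" for a
    using profinite_scale_iff[OF prof n that] \<phi>[OF that] by blast
  have cos: "N #> \<phi> a = N #> (a [^] k N)" if "open_subgroup N" "a \<in> carrier G" for N a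
    using profinite_scale_iff[OF prof n that(2)] \<phi>[OF that(2)] that(1) by (simp add: k_def)
  have hom: "\<phi> \<in> hom G G"
  proof (rule homI)
    fix a b assume ab: "a \<in> carrier G" "b \<in> carrier G"
    show "\<phi> (a \<otimes> b) = \<phi> a \<otimes> \<phi> b"
    proof (rule profinite_eqI[OF prof])
      fix N assume N: "open_subgroup N"
      have "N #> \<phi> (a \<otimes> b) = N #> (a [^] k N \<otimes> b [^] k N)"
        using cos[OF N, of "a \<otimes> b"] ab by (simp add: int_pow_distrib)
      also have "\<dots> = (N #> \<phi> a) <#> (N #> \<phi> b)"
        using FactGroup_facts(3)[OF open_subgroupD(1)[OF N]] ab cos[OF N] by simp
      also have "\<dots> = N #> (\<phi> a \<otimes> \<phi> b)"
        using FactGroup_facts(3)[OF open_subgroupD(1)[OF N]] ab \<phi>G by simp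
      finally show "N #> \<phi> (a \<otimes> b) = N #> (\<phi> a \<otimes> \<phi> b)" .
    qed (use ab \<phi>G in auto)
  qed (use \<phi>G in auto)
  have "openin T {a \<in> topspace T. \<phi> a \<in> U}" if U: "openin T U" for U
  proof (subst openin_subopen, intro ballI)
    fix a assume "a \<in> {a \<in> topspace T. \<phi> a \<in> U}"
    then have a: "a \<in> carrier G" "\<phi> a \<in> U" by (auto simp: topspace_eq)
    \<comment> \<open>Choose \<open>N\<close> with the translate of \<open>N\<close> by
      \<open>\<phi> a\<close> inside \<open>U\<close>. Since \<phi> is a power map modulo
      \<open>N\<close>, it sends the coset of \<open>a\<close> into that of
      \<open>\<phi> a\<close>.\<close>
    have "openin T {y \<in> topspace T. \<phi> a \<otimes> y \<in> U}"
      by (rule openin_continuous_map_preimage[OF continuous_translate[OF \<phi>G[OF a(1)]] U])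
    then obtain N where N: "open_subgroup N" "N \<subseteq> {y \<in> topspace T. \<phi> a \<otimes> y \<in> U}"
      using profinite_open_subgroup[OF prof, of "{y \<in> topspace T. \<phi> a \<otimes> y \<in> U}"] a \<phi>G[OF a(1)]
      by (auto simp: topspace_eq)
    have sub: "subgroup N G" by (rule open_subgroupD(1)[OF N(1)])
    have "b \<in> {a \<in> topspace T. \<phi> a \<in> U}" if b: "b \<in> N #> a" for b
    proof -
      have bG: "b \<in> carrier G" using b r_coset_subset_G[OF subgroup.subset[OF sub] a(1)] by blast
      have "N #> b = N #> a" using repr_independence[OF b a(1) sub] by simp
      then have "N #> (b [^] k N) = N #> (a [^] k N)"
        using FactGroup_facts(2)[OF sub a(1), of "k N"] FactGroup_facts(2)[OF sub bG, of "k N"] by metis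
      then have "N #> \<phi> b = N #> \<phi> a" using cos[OF N(1)] a(1) bG by metis
      then have "\<phi> b \<in> N #> \<phi> a" using rcos_self[OF \<phi>G[OF bG] sub] by simp
      then obtain y where y: "y \<in> N" "\<phi> b = \<phi> a \<otimes> y"
        unfolding rcos_eq_translate[OF subgroup.subset[OF sub] \<phi>G[OF a(1)]] by blast
      then show ?thesis using N(2) bG by (auto simp: topspace_eq)
    qed
    then show "\<exists>V. openin T V \<and> a \<in> V \<and> V \<subseteq> {a \<in> topspace T. \<phi> a \<in> U}"
      using openin_rcos[OF N(1) a(1)] rcos_self[OF a(1) sub] by blast
  qed
  then have "continuous_map T T \<phi>"
    using \<phi>G by (simp add: continuous_map_def topspace_eq)
  then show ch: "\<phi> \<in> continuous_hom G T G T" using hom by (simp add: continuous_hom_def)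
  show "extensible_tori G T \<phi>"
    unfolding extensible_tori_def
  proof (intro allI ballI)
    fix d \<theta> assume \<theta>: "\<theta> \<in> continuous_hom G T (torus d) (torus_topology d)"
    have \<theta>i: "(\<lambda>a. \<theta> a i) \<in> characters" if "i < d" for i
    proof (rule continuous_hom_compose[OF \<theta>])
      show "(\<lambda>x. x i) \<in> continuous_hom (torus d) (torus_topology d) circle_group circle_topology"
        using that unfolding continuous_hom_def hom_def torus_simps
        by (auto simp: PiE_iff intro!: continuous_map_product_projection)
    qed
    \<comment> \<open>Finiteness of the dimension enters here: only finitely many coordinate
      characters have to be killed at once.\<close>
    have "\<exists>N. open_subgroup N \<and> (\<forall>i<m. \<forall>a\<in>N. \<theta> a i = 1)" if "m \<le> d" for m
      using that
    proof (induction m)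
      case 0 then show ?case using open_subgroup_carrier by auto
    next
      case (Suc m)
      then obtain N where N: "open_subgroup N" "\<forall>i<m. \<forall>a\<in>N. \<theta> a i = 1" by auto
      obtain M where M: "open_subgroup M" "\<And>a. a \<in> M \<Longrightarrow> \<theta> a m = 1"
        using profinite_character_kernel[OF prof \<theta>i[of m]] Suc.prems by auto
      show ?case
        using open_subgroup_Int[OF N(1) M(1)] N(2) M(2)
        by (intro exI[of _ "N \<inter> M"]) (auto simp: less_Suc_eq)
    qed
    then obtain N where N: "open_subgroup N" "\<forall>i<d. \<forall>a\<in>N. \<theta> a i = 1" by blast
    have sub: "subgroup N G" by (rule open_subgroupD(1)[OF N(1)])
    have eq: "\<theta> (\<phi> a) = \<theta> (a [^] k N)" if a: "a \<in> carrier G" for a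
    proof -
      have G: "\<phi> a \<in> carrier G" "a [^] k N \<in> carrier G" using a \<phi>G by auto
      have mem: "\<phi> a \<otimes> inv (a [^] k N) \<in> N"
        using cos[OF N(1) a] rcos_eq_iff[OF sub G] by simp
      have "\<theta> (\<phi> a) i = \<theta> (a [^] k N) i" if i: "i < d" for i
      proof -
        have "\<theta> (\<phi> a \<otimes> inv (a [^] k N)) i = 1" using N(2) mem i by blast
        then have "\<theta> (\<phi> a) i * inverse (\<theta> (a [^] k N) i) = 1"
          using character_simps(3,6)[OF \<theta>i[OF i]] G by simp
        then show ?thesis using character_simps(2)[OF \<theta>i[OF i] G(2)] by (simp add: field_simps)
      qed
      moreover have "\<theta> (\<phi> a) \<in> extensional {..<d}" "\<theta> (a [^] k N) \<in> extensional {..<d}"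
        using \<theta> G unfolding continuous_hom_def hom_def torus_simps by (auto simp: PiE_iff Pi_iff)
      ultimately show ?thesis by (intro extensionalityI[of _ "{..<d}"]) auto
    qed
    have "extensible_along G (torus d) (torus_topology d) \<theta> (\<lambda>a. a [^] k N)"
      by (rule int_pow_extensible[OF compact_abelian_group_torus \<theta>]) simp
    then show "extensible_along G (torus d) (torus_topology d) \<theta> \<phi>"
      using eq unfolding extensible_along_def by simp
  qed
qed

lemma FactGroup_compact_abelian_group:
  assumes N: "open_subgroup N"
  shows "compact_abelian_group (G Mod N) (discrete_topology (carrier (G Mod N)))"
proof -
  have cg: "comm_group (G Mod N)" by (rule abelian_FactGroup[OF open_subgroupD(1)[OF N]])
  interpret Q: comm_group "G Mod N" by (rule cg)
  have "continuous_map (prod_topology (discrete_topology (carrier (G Mod N))) (discrete_topology (carrier (G Mod N))))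
    (discrete_topology (carrier (G Mod N))) (\<lambda>(x, y). x \<otimes>\<^bsub>G Mod N\<^esub> y)"
    using Q.m_closed unfolding prod_topology_discrete_topology[symmetric] by (auto simp del: mult_FactGroup)
  then show ?thesis
    using cg finite_FactGroup[OF N] Q.inv_closed
    by (auto intro!: compact_abelian_group.intro compact_abelian_group_axioms.intro
        simp: compact_space_discrete_topology Hausdorff_space_discrete_topology simp del: mult_FactGroup)
qed

text \<open>Separation of points, applied to the finite quotient with its discrete topology and
  pulled back.\<close>

lemma character_of_quotient:
  assumes N: "open_subgroup N" and a: "a \<in> carrier G" "a \<notin> N"
  obtains \<psi> where "\<psi> \<in> characters" "\<And>b. b \<in> N \<Longrightarrow> \<psi> b = 1" "\<psi> a \<noteq> 1"
proof -
  have sub: "subgroup N G" by (rule open_subgroupD(1)[OF N])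
  interpret Q: compact_abelian_group "G Mod N" "discrete_topology (carrier (G Mod N))"
    by (rule FactGroup_compact_abelian_group[OF N])
  have "N #> a \<noteq> N" using rcos_self[OF a(1) sub] a(2) by auto
  then obtain \<psi> where \<psi>: "\<psi> \<in> Q.characters" "\<psi> (N #> a) \<noteq> 1"
    using Q.characters_separate[of "N #> a"] a(1) by (auto simp: carrier_FactGroup)
  have "(\<lambda>a. N #> a) \<in> continuous_hom G T (G Mod N) (discrete_topology (carrier (G Mod N)))"
    unfolding continuous_hom_def
  proof (intro CollectI conjI)
    show "(\<lambda>a. N #> a) \<in> hom G (G Mod N)"
      using normal.r_coset_hom_Mod[of N G] sub by (simp add: normal_iff_subgroup)
    show "continuous_map T (discrete_topology (carrier (G Mod N))) (\<lambda>a. N #> a)"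
      by (rule continuous_rcos[OF N])
  qed
  from continuous_hom_compose[OF this \<psi>(1)] have "(\<lambda>a. \<psi> (N #> a)) \<in> characters" .
  moreover have "\<psi> (N #> b) = 1" if "b \<in> N" for b
    using subgroup.rcos_const[OF sub is_group that] Q.character_simps(5)[OF \<psi>(1)] by simp
  ultimately show thesis using that \<psi>(2) by blast
qed

text \<open>On the characters killed by k the dual of \<phi> is a single power, and by compactness
  the exponents can be chosen as the components of one profinite integer. Characters trivial on an
  open subgroup are killed by its index and separate the points of the quotient, so the component at
  the index describes \<phi> there.\<close>

lemma extensible_tori_profinite_scale:
  assumes prof: "profinite G T" and \<phi>: "\<phi> \<in> continuous_hom G T G T" and ext: "extensible_tori G T \<phi>"
  obtains n where "n \<in> profinite_integers" "\<And>a. a \<in> carrier G \<Longrightarrow> \<phi> a = profinite_scale G T n a"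
proof -
  interpret D: comm_group dual by (rule comm_group_dual)
  \<comment> \<open>\<open>P k m\<close> says that \<open>m\<close> serves for all k-torsion
    characters. Such an \<open>m\<close> also serves for divisors of k and may be reduced modulo k,
    which are the conditions for choosing a profinite integer.\<close>
  define P where "P k m \<longleftrightarrow> (\<forall>\<psi>\<in>carrier dual. \<psi> [^]\<^bsub>dual\<^esub> k = \<one>\<^bsub>dual\<^esub> \<longrightarrow> pullback \<phi> \<psi> = \<psi> [^]\<^bsub>dual\<^esub> m)"
    for k :: nat and m :: int
  have ex: "\<exists>m. P k m" if "k > 0" for k
    using D.pointwise_power_hom_torsion[OF pullback_hom[OF \<phi>] pullback_pointwise_power[OF \<phi> ext] that]
    unfolding P_def by metis
  have red: "\<psi> [^]\<^bsub>dual\<^esub> (m mod int k) = \<psi> [^]\<^bsub>dual\<^esub> m"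
    if "\<psi> \<in> carrier dual" "\<psi> [^]\<^bsub>dual\<^esub> k = \<one>\<^bsub>dual\<^esub>" for \<psi> m and k :: nat
  proof -
    have "\<psi> [^]\<^bsub>dual\<^esub> m = \<psi> [^]\<^bsub>dual\<^esub> (int k * (m div int k) + m mod int k)" by simp
    also have "\<dots> = (\<psi> [^]\<^bsub>dual\<^esub> int k) [^]\<^bsub>dual\<^esub> (m div int k) \<otimes>\<^bsub>dual\<^esub> \<psi> [^]\<^bsub>dual\<^esub> (m mod int k)"
      using that(1) by (simp only: D.int_pow_mult D.int_pow_pow)
    also have "\<dots> = \<psi> [^]\<^bsub>dual\<^esub> (m mod int k)" using that by (simp add: int_pow_int)
    finally show ?thesis by simp
  qed
  have mod: "P k (m mod int k)" if kl: "k > 0" "l > 0" "k dvd l" "P l m" for k l m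
    unfolding P_def
  proof (intro ballI impI)
    fix \<psi> assume \<psi>: "\<psi> \<in> carrier dual" "\<psi> [^]\<^bsub>dual\<^esub> k = \<one>\<^bsub>dual\<^esub>"
    obtain i where i: "l = k * i" using kl(3) by (rule dvdE)
    then have "\<psi> [^]\<^bsub>dual\<^esub> l = (\<psi> [^]\<^bsub>dual\<^esub> k) [^]\<^bsub>dual\<^esub> i" using \<psi>(1) by (simp add: D.nat_pow_pow)
    then have "\<psi> [^]\<^bsub>dual\<^esub> l = \<one>\<^bsub>dual\<^esub>" using \<psi> by simp
    then show "pullback \<phi> \<psi> = \<psi> [^]\<^bsub>dual\<^esub> (m mod int k)"
      using kl(4) \<psi>(1) red[OF \<psi>] unfolding P_def by simp
  qed
  have "\<exists>n\<in>profinite_integers. \<forall>k>0. P k (n k)"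
    by (rule profinite_integers_choice[of P]) (use ex mod in blast)+
  then obtain n where n: "n \<in> profinite_integers" "\<And>k. k > 0 \<Longrightarrow> P k (n k)" by blast
  have "\<phi> a = profinite_scale G T n a" if a: "a \<in> carrier G" for a
    unfolding profinite_scale_iff[OF prof n(1) a]
  proof (intro conjI allI impI)
    show \<phi>G: "\<phi> a \<in> carrier G" using \<phi> a by (auto simp: continuous_hom_def hom_def)
    fix N assume N: "open_subgroup N"
    define k where "k = card (carrier (G Mod N))"
    have k: "k > 0" using card_FactGroup_pos[OF N] by (simp add: k_def)
    have sub: "subgroup N G" by (rule open_subgroupD(1)[OF N])
    have akG: "a [^] n k \<in> carrier G" using a by simp
    have "\<phi> a \<otimes> inv (a [^] n k) \<in> N"
    proof (rule ccontr)
      assume "\<phi> a \<otimes> inv (a [^] n k) \<notin> N"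
      then obtain \<psi> where \<psi>: "\<psi> \<in> characters" "\<And>b. b \<in> N \<Longrightarrow> \<psi> b = 1" "\<psi> (\<phi> a \<otimes> inv (a [^] n k)) \<noteq> 1"
        using character_of_quotient[OF N, of "\<phi> a \<otimes> inv (a [^] n k)"] \<phi>G akG by auto
      let ?\<psi> = "restrict \<psi> (carrier G)"
      have r: "?\<psi> \<in> carrier dual" by (rule restrict_character[OF \<psi>(1)])
      have "?\<psi> [^]\<^bsub>dual\<^esub> k = \<one>\<^bsub>dual\<^esub>"
      proof (rule dual_eqI)
        fix b assume b: "b \<in> carrier G"
        show "(?\<psi> [^]\<^bsub>dual\<^esub> k) b = \<one>\<^bsub>dual\<^esub> b"
          using dual_int_pow[OF r b, of "int k"] character_root_of_unity[OF N \<psi>(1,2) b] b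
          by (simp add: int_pow_int dual_one k_def)
      qed (use r in auto)
      then have "pullback \<phi> ?\<psi> = ?\<psi> [^]\<^bsub>dual\<^esub> n k" using n(2)[OF k] r unfolding P_def by blast
      then have "pullback \<phi> ?\<psi> a = ?\<psi> a powi n k" using dual_int_pow[OF r a] by simp
      then have "\<psi> (\<phi> a) = \<psi> (a [^] n k)"
        using a \<phi>G character_simps(4)[OF \<psi>(1) a] by (simp add: pullback_def)
      then have "\<psi> (\<phi> a \<otimes> inv (a [^] n k)) = 1"
        using character_simps[OF \<psi>(1)] \<phi>G akG by (simp del: int_pow_closed)
      then show False using \<psi>(3) by contradiction
    qed
    then show "N #> \<phi> a = N #> (a [^] n (card (carrier (G Mod N))))"
      using rcos_eq_iff[OF sub \<phi>G akG] by (simp add: k_def)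
  qed
  then show thesis using that n(1) by blast
qed

end

section \<open>Solenoids\<close>

text \<open>\<open>extensible_cab\<close> tests only targets carried by one type, so a target on
  another type is copied into it. Pulling the topology back along the inverse \<open>g\<close> makes
  \<open>f\<close> an isomorphism of topological groups onto the copy.\<close>

lemma compact_abelian_group_transport:
  fixes f :: "'c \<Rightarrow> 'b"
  assumes B: "compact_abelian_group B U" and f: "inj_on f (carrier B)"
  obtains B' :: "'b monoid" and U' g where "compact_abelian_group B' U'"
    "f \<in> continuous_hom B U B' U'" "g \<in> continuous_hom B' U' B U" "\<And>x. x \<in> carrier B \<Longrightarrow> g (f x) = x"
proof -
  interpret B: compact_abelian_group B U by (rule B)
  define g where "g = inv_into (carrier B) f"
  define B' where "B' = \<lparr>carrier = f ` carrier B, monoid.mult = \<lambda>x y. f (g x \<otimes>\<^bsub>B\<^esub> g y), one = f \<one>\<^bsub>B\<^esub>\<rparr>"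
  define U' where "U' = pullback_topology (f ` carrier B) g U"
  have gf: "g (f x) = x" if "x \<in> carrier B" for x using f that by (simp add: g_def)
  have top: "topspace U' = carrier B'"
    by (auto simp: U'_def topspace_pullback_topology B.topspace_eq B'_def gf)
  have cont_g: "continuous_map U' U g"
    using continuous_map_pullback[of U U id "f ` carrier B" g] by (simp add: U'_def)
  have cont_f: "continuous_map U U' f"
    unfolding U'_def
  proof (rule continuous_map_pullback')
    show "continuous_map U U (g \<circ> f)"
      by (rule continuous_map_eq[of U U id]) (auto simp: B.topspace_eq gf)
  qed (auto simp: B.topspace_eq)
  have comm: "comm_group B'"
  proof (rule comm_groupI)
    fix x assume "x \<in> carrier B'"
    then obtain u where u: "u \<in> carrier B" "x = f u" by (auto simp: B'_def)
    then show "\<exists>y\<in>carrier B'. y \<otimes>\<^bsub>B'\<^esub> x = \<one>\<^bsub>B'\<^esub>"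
      by (intro bexI[of _ "f (inv\<^bsub>B\<^esub> u)"]) (auto simp: B'_def gf)
  qed (auto simp: B'_def gf B.m_ac)
  interpret B': comm_group B' by (rule comm)
  have hom_f: "f \<in> hom B B'" by (auto simp: hom_def B'_def gf)
  have hom_g: "g \<in> hom B' B" by (auto simp: hom_def B'_def gf)
  have inv': "inv\<^bsub>B'\<^esub> y = f (inv\<^bsub>B\<^esub> (g y))" if "y \<in> carrier B'" for y
    using that by (intro B'.inv_equality) (auto simp: B'_def gf)
  have "compact_abelian_group B' U'"
  proof (intro compact_abelian_group.intro comm compact_abelian_group_axioms.intro top)
    have "compactin U' (f ` topspace U)"
      using image_compactin[OF _ cont_f] B.compact by (simp add: compact_space_def)
    then show "compact_space U'" by (simp add: compact_space_def top B.topspace_eq B'_def)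
    show "Hausdorff_space U'"
      by (rule Hausdorff_space_injective_preimage[OF B.Hausdorff cont_g])
        (auto simp: top B'_def gf intro!: inj_onI)
    have "continuous_map (prod_topology U' U') U' (f \<circ> (\<lambda>p. g (fst p) \<otimes>\<^bsub>B\<^esub> g (snd p)))"
      by (intro continuous_map_compose[OF _ cont_f] B.continuous_map_mult
          continuous_map_compose[OF continuous_map_fst cont_g, unfolded o_def]
          continuous_map_compose[OF continuous_map_snd cont_g, unfolded o_def])
    then show "continuous_map (prod_topology U' U') U' (\<lambda>(x, y). x \<otimes>\<^bsub>B'\<^esub> y)"
      by (simp add: o_def B'_def case_prod_unfold)
    have "continuous_map U' U' (f \<circ> (\<lambda>x. inv\<^bsub>B\<^esub> x) \<circ> g)"
      by (intro continuous_map_compose[OF cont_g] continuous_map_compose[OF B.continuous_inv cont_f])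
    then show "continuous_map U' U' (\<lambda>x. inv\<^bsub>B'\<^esub> x)"
      by (rule continuous_map_eq) (simp add: top inv')
  qed
  then show thesis
    using that[of B' U' g] hom_f hom_g cont_f cont_g gf by (simp add: continuous_hom_def)
qed

lemma extensible_cab_along:
  fixes f :: "'c \<Rightarrow> 'b" and B :: "'c monoid"
  assumes ext: "extensible_cab TYPE('b) A S \<phi>" and f: "inj f" and B: "compact_abelian_group B U"
    and \<theta>: "\<theta> \<in> continuous_hom A S B U" and \<phi>: "\<And>a. a \<in> carrier A \<Longrightarrow> \<phi> a \<in> carrier A"
  shows "extensible_along A B U \<theta> \<phi>"
proof -
  obtain B' :: "'b monoid" and U' g where B': "compact_abelian_group B' U'"
    and fg: "f \<in> continuous_hom B U B' U'" "g \<in> continuous_hom B' U' B U" "\<And>x. x \<in> carrier B \<Longrightarrow> g (f x) = x"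
    using compact_abelian_group_transport[OF B inj_on_subset[OF f subset_UNIV]] by blast
  have "(\<lambda>a. f (\<theta> a)) \<in> continuous_hom A S B' U'" by (rule continuous_hom_compose[OF \<theta> fg(1)])
  then have "extensible_along A B' U' (\<lambda>a. f (\<theta> a)) \<phi>"
    using ext B' unfolding extensible_cab_def by blast
  then obtain \<phi>' where \<phi>': "\<phi>' \<in> continuous_hom B' U' B' U'" "\<forall>a\<in>carrier A. \<phi>' (f (\<theta> a)) = f (\<theta> (\<phi> a))"
    unfolding extensible_along_def by blast
  show ?thesis
    unfolding extensible_along_def
  proof (intro bexI ballI)
    show "(\<lambda>x. g (\<phi>' (f x))) \<in> continuous_hom B U B U"
      by (rule continuous_hom_compose[OF continuous_hom_compose[OF fg(1) \<phi>'(1)] fg(2)])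
    fix a assume a: "a \<in> carrier A"
    have "\<theta> (\<phi> a) \<in> carrier B" using \<theta> \<phi>[OF a] by (auto simp: continuous_hom_def hom_def)
    then show "g (\<phi>' (f (\<theta> a))) = \<theta> (\<phi> a)" using \<phi>'(2) a fg(3) by simp
  qed
qed

text \<open>A sequence is coded by the rational cuts of all its real and imaginary parts. This is a
  set of elements of a countable type, hence a set of naturals, and there are as many of those as
  reals.\<close>

lemma inj_sequences_of_complex:
  assumes "(UNIV :: real set) \<lesssim> (UNIV :: 'b set)"
  obtains f :: "(nat \<Rightarrow> complex) \<Rightarrow> 'b" where "inj f"
proof -
  define F where "F x = to_nat ` {(n, b, q) | n b q. of_rat q < (if b then Re (x n) else Im (x n))}"
    for x :: "nat \<Rightarrow> complex"
  have real_eq: "u = v" if "\<And>q. of_rat q < u \<longleftrightarrow> of_rat q < v" for u v :: real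
    using that of_rat_dense[of u v] of_rat_dense[of v u] by (meson less_asym not_less_iff_gr_or_eq)
  have "inj F"
  proof (rule injI)
    fix x y assume eq: "F x = F y"
    have "of_rat q < (if b then Re (x n) else Im (x n)) \<longleftrightarrow> of_rat q < (if b then Re (y n) else Im (y n))" for n b q
    proof -
      have "to_nat (n, b, q) \<in> F x \<longleftrightarrow> to_nat (n, b, q) \<in> F y" using eq by simp
      then show ?thesis unfolding F_def by (auto simp: inj_image_mem_iff)
    qed
    from real_eq[OF this[of _ True]] real_eq[OF this[of _ False]] show "x = y"
      by (intro ext complex_eqI) simp_all
  qed
  moreover have "(UNIV :: nat set set) \<lesssim> (UNIV :: 'b set)"
    using nat_sets_eqpoll_reals assms eqpoll_imp_lepoll lepoll_trans by blast
  then obtain e :: "nat set \<Rightarrow> 'b" where "inj e" unfolding lepoll_def by blast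
  ultimately show thesis using that[of "e \<circ> F"] by (simp add: inj_compose)
qed

section \<open>Solenoids in a countable power of the circle\<close>

abbreviation "infinite_torus \<equiv> product_group (UNIV :: nat set) (\<lambda>_. circle_group)"
abbreviation "infinite_torus_topology \<equiv> product_topology (\<lambda>_. circle_topology) (UNIV :: nat set)"

lemma compact_abelian_group_infinite_torus: "compact_abelian_group infinite_torus infinite_torus_topology"
  by (rule compact_abelian_group_product[OF compact_abelian_group_circle])

lemma infinite_torus_int_pow:
  assumes "x \<in> carrier infinite_torus"
  shows "(x [^]\<^bsub>infinite_torus\<^esub> (k::int)) i = x i powi k"
proof -
  have "(\<lambda>x. x i) \<in> hom infinite_torus circle_group" by (auto simp: hom_def PiE_iff)
  from hom_int_pow[OF this assms product_group[OF group_circle] group_circle, of k] show ?thesis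
    using assms by (simp add: int_pow_circle PiE_iff)
qed

context compact_abelian_group
begin

text \<open>The target is the image of \<open>\<real> \<times> G\<close> in which \<open>(1, \<one>)\<close> is identified with the image of \<open>a0\<close>; an
  extension sends the one-parameter subgroup through that point into itself, up to a path in a
  totally disconnected group.\<close>

lemma solenoid_extension:
  assumes prof: "profinite G T" and \<psi>: "\<And>n::nat. \<psi> n \<in> characters" and a0: "a0 \<in> carrier G"
    and \<phi>: "\<And>a. a \<in> carrier G \<Longrightarrow> \<phi> a \<in> carrier G"
    and ext: "\<And>(B :: (nat \<Rightarrow> complex) monoid) U \<theta>. compact_abelian_group B U \<Longrightarrow>
      \<theta> \<in> continuous_hom G T B U \<Longrightarrow> extensible_along G B U \<theta> \<phi>"
  obtains k :: int where "\<And>m. \<psi> m (\<phi> a0) = \<psi> m a0 powi k"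
proof -
  interpret W: compact_abelian_group infinite_torus infinite_torus_topology
    by (rule compact_abelian_group_infinite_torus)
  define w where "w n = Arg (\<psi> n a0)" for n
  have w: "cis (w n) = \<psi> n a0" for n
    using character_simps(1,2)[OF \<psi> a0] cis_Arg[of "\<psi> n a0"] by (simp add: w_def sgn_eq)
  have wj: "cis (of_int j * w n) = \<psi> n (a0 [^] j)" for n and j :: int
    using character_simps(4)[OF \<psi> a0] by (simp add: cis_power_int w[symmetric] mult.commute)
  \<comment> \<open>Coordinate 0 records the time t modulo 1. The others carry the image of
    \<open>a\<close> along a path that starts at the image of \<open>a\<close> and, after time 1,
    has been multiplied by the image of \<open>a0\<close>; \<open>w n\<close> is an argument of
    \<open>\<psi> n a0\<close>.\<close>
  define e where "e t a i = (case i of 0 \<Rightarrow> cis (2 * pi * t) | Suc n \<Rightarrow> cis (t * w n) * \<psi> n a)"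
    for t :: real and a i
  have e_simps [simp]: "e t a 0 = cis (2 * pi * t)" "e t a (Suc n) = cis (t * w n) * \<psi> n a" for t a n
    by (simp_all add: e_def)
  have e_torus: "e t a \<in> carrier infinite_torus" if "a \<in> carrier G" for t a
    using that character_simps(1)[OF \<psi>] by (auto simp: e_def norm_mult split: nat.split)
  have e_mult: "e t a \<otimes>\<^bsub>infinite_torus\<^esub> e s b = e (t + s) (a \<otimes> b)" if "a \<in> carrier G" "b \<in> carrier G" for t s a b
  proof
    fix i show "(e t a \<otimes>\<^bsub>infinite_torus\<^esub> e s b) i = e (t + s) (a \<otimes> b) i"
      using that character_simps(3)[OF \<psi>]
      by (cases i) (simp_all add: cis_mult distrib_left distrib_right flip: cis_mult)
  qed
  have e_one: "e 0 \<one> = \<one>\<^bsub>infinite_torus\<^esub>"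
  proof
    fix i show "e 0 \<one> i = \<one>\<^bsub>infinite_torus\<^esub> i" using character_simps(5)[OF \<psi>] by (cases i) auto
  qed
  \<comment> \<open>The gluing: whole units of time are the same as factors
    \<open>a0\<close>.\<close>
  have e_shift: "e (t + of_int j) a = e t (a \<otimes> a0 [^] j)" if "a \<in> carrier G" for t a and j :: int
  proof
    fix i show "e (t + of_int j) a i = e t (a \<otimes> a0 [^] j) i"
    proof (cases i)
      case 0
      have "cis (2 * pi * of_int j) = 1" by (simp add: cis_multiple_2pi)
      then show ?thesis using 0 by (simp add: distrib_left flip: cis_mult)
    next
      case (Suc n)
      then show ?thesis
        using that a0 character_simps(3)[OF \<psi>] wj by (simp add: distrib_right flip: cis_mult)
    qed
  qed
  define C where "C = {e t a | t a. a \<in> carrier G}"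
  have C: "subgroup C infinite_torus"
  proof (rule W.subgroupI)
    show "C \<subseteq> carrier infinite_torus" using e_torus by (auto simp: C_def)
    show "C \<noteq> {}" by (auto simp: C_def)
    show "inv\<^bsub>infinite_torus\<^esub> x \<in> C" if x: "x \<in> C" for x
    proof -
      obtain t a where ta: "a \<in> carrier G" "x = e t a" using x by (auto simp: C_def)
      have "inv\<^bsub>infinite_torus\<^esub> x = e (- t) (inv a)"
        using ta e_torus by (intro W.inv_equality) (simp_all add: e_mult e_one del: mult_product_group one_product_group carrier_product_group)
      then show ?thesis using ta by (auto simp: C_def)
    qed
    show "x \<otimes>\<^bsub>infinite_torus\<^esub> y \<in> C" if xy: "x \<in> C" "y \<in> C" for x y
    proof -
      obtain t a s b where "a \<in> carrier G" "x = e t a" "b \<in> carrier G" "y = e s b"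
        using xy by (auto simp: C_def)
      then show ?thesis
        unfolding C_def using e_mult by (auto simp del: mult_product_group)
    qed
  qed
  have "closedin infinite_torus_topology C"
  proof -
    \<comment> \<open>By the gluing, times in the unit interval already give all of
      \<open>C\<close>, so \<open>C\<close> is a continuous image of a compact space and hence
      closed.\<close>
    let ?X = "prod_topology (top_of_set {0..1::real}) T"
    have fst: "continuous_map ?X euclideanreal fst"
      using continuous_map_into_fulltopology[OF continuous_map_fst] by blast
    have "continuous_map ?X circle_topology (\<lambda>p. e (fst p) (snd p) i)" for i
    proof (cases i)
      case 0
      have "continuous_map ?X euclidean (\<lambda>p. cis (2 * pi * fst p))"
        by (rule continuous_map_euclidean_compose[OF fst]) (intro continuous_intros)
      then show ?thesis using 0 by (simp add: continuous_map_in_subtopology)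
    next
      case (Suc n)
      have "continuous_map ?X euclidean (\<lambda>p. cis (fst p * w n))"
        by (rule continuous_map_euclidean_compose[OF fst]) (intro continuous_intros)
      then have 1: "continuous_map ?X circle_topology (\<lambda>p. cis (fst p * w n))"
        by (simp add: continuous_map_in_subtopology)
      have 2: "continuous_map ?X circle_topology (\<lambda>p. \<psi> n (snd p))"
        using continuous_map_compose[OF continuous_map_snd, of T circle_topology "\<psi> n"] \<psi>
        by (simp add: continuous_hom_def o_def)
      show ?thesis using continuous_map_circle_mult[OF 1 2] Suc by simp
    qed
    then have cont: "continuous_map ?X infinite_torus_topology (\<lambda>p. e (fst p) (snd p))"
      by (simp add: continuous_map_componentwise_UNIV)
    have "compact_space ?X"
      by (simp add: compact_space_prod_topology compact compact_space_subtopology compactin_euclidean_iff)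
    then have "compactin infinite_torus_topology ((\<lambda>p. e (fst p) (snd p)) ` topspace ?X)"
      using image_compactin[OF _ cont] by (simp add: compact_space_def)
    moreover have "(\<lambda>p. e (fst p) (snd p)) ` topspace ?X = C"
    proof (intro subset_antisym subsetI)
      fix x assume "x \<in> C"
      then obtain t a where ta: "a \<in> carrier G" "x = e t a" by (auto simp: C_def)
      have "e t a = e (frac t) (a \<otimes> a0 [^] \<lfloor>t\<rfloor>)"
        using e_shift[OF ta(1), of "frac t" "\<lfloor>t\<rfloor>"] by (simp add: frac_def)
      then show "x \<in> (\<lambda>p. e (fst p) (snd p)) ` topspace ?X"
        using ta a0 frac_ge_0[of t] frac_lt_1[of t]
        by (intro image_eqI[of _ _ "(frac t, a \<otimes> a0 [^] \<lfloor>t\<rfloor>)"]) (auto simp: topspace_eq)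
    qed (auto simp: C_def topspace_eq, blast)
    ultimately show ?thesis using compactin_imp_closedin[OF W.Hausdorff] by simp
  qed
  define B where "B = infinite_torus\<lparr>carrier := C\<rparr>"
  define U where "U = subtopology infinite_torus_topology C"
  have B: "compact_abelian_group B U"
    unfolding B_def U_def by (rule W.compact_abelian_group_subgroup[OF C \<open>closedin infinite_torus_topology C\<close>])
  have B_simps: "carrier B = C" "x \<otimes>\<^bsub>B\<^esub> y = x \<otimes>\<^bsub>infinite_torus\<^esub> y" for x y by (simp_all add: B_def)
  have "e 0 \<in> continuous_hom G T B U"
    unfolding continuous_hom_def
  proof (intro CollectI conjI)
    show "e 0 \<in> hom G B"
      by (rule homI) (auto simp: B_simps C_def e_mult simp del: mult_product_group)
    have "continuous_map T circle_topology (\<lambda>a. e 0 a i)" for i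
      using \<psi> by (cases i) (auto simp: continuous_hom_def)
    then show "continuous_map T U (e 0)"
      unfolding U_def by (auto simp: continuous_map_in_subtopology continuous_map_componentwise_UNIV C_def topspace_eq)
  qed
  from ext[OF B this] obtain \<phi>' where \<phi>': "\<phi>' \<in> continuous_hom B U B U"
    and eq: "\<And>a. a \<in> carrier G \<Longrightarrow> \<phi>' (e 0 a) = e 0 (\<phi> a)"
    unfolding extensible_along_def by blast
  have hom': "\<phi>' x \<in> C" "y \<in> C \<Longrightarrow> \<phi>' (x \<otimes>\<^bsub>infinite_torus\<^esub> y) = \<phi>' x \<otimes>\<^bsub>infinite_torus\<^esub> \<phi>' y" if "x \<in> C" for x y
    using \<phi>' that by (auto simp: continuous_hom_def hom_def B_simps simp del: mult_product_group)
  define \<gamma> where "\<gamma> t = e t \<one>" for t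
  have \<gamma>C: "\<gamma> t \<in> C" for t by (auto simp: \<gamma>_def C_def)
  have \<gamma>_add: "\<gamma> (s + t) = \<gamma> s \<otimes>\<^bsub>infinite_torus\<^esub> \<gamma> t" for s t
    unfolding \<gamma>_def by (subst e_mult) simp_all
  have \<gamma>1: "\<gamma> 1 = e 0 a0" using e_shift[of \<one> 0 1] a0 by (simp add: \<gamma>_def)
  have \<gamma>0: "\<phi>' (\<gamma> 0) = e 0 \<one>"
  proof -
    have "\<phi>' \<one>\<^bsub>B\<^esub> = \<one>\<^bsub>B\<^esub>"
      using hom_one[of \<phi>' B B] \<phi>' B
      by (simp add: continuous_hom_def compact_abelian_group_def comm_group_def)
    then show ?thesis by (simp add: B_def \<gamma>_def e_one)
  qed
  have cont_\<gamma>: "continuous_map euclideanreal U \<gamma>"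
  proof -
    have "continuous_map euclideanreal circle_topology (\<lambda>t. \<gamma> t i)" for i
      unfolding \<gamma>_def using character_simps(1)[OF \<psi> one_closed]
      by (cases i) (auto simp: continuous_map_in_subtopology norm_mult intro!: continuous_intros)
    then show ?thesis
      using \<gamma>C unfolding U_def by (auto simp: continuous_map_in_subtopology continuous_map_componentwise_UNIV)
  qed
  have cont: "continuous_on UNIV (\<lambda>t. \<phi>' (\<gamma> t) i)" for i
  proof -
    have "continuous_map euclideanreal U (\<phi>' \<circ> \<gamma>)"
      by (rule continuous_map_compose[OF cont_\<gamma>]) (use \<phi>' in \<open>simp add: continuous_hom_def\<close>)
    then have "continuous_map euclideanreal circle_topology (\<lambda>t. \<phi>' (\<gamma> t) i)"
      unfolding U_def by (simp add: continuous_map_in_subtopology continuous_map_componentwise_UNIV)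
    then show ?thesis by (simp add: continuous_map_in_subtopology)
  qed
  have "norm (\<phi>' (\<gamma> t) 0) = 1" for t
    using hom'(1)[OF \<gamma>C, of t] by (auto simp: C_def)
  moreover have "\<phi>' (\<gamma> (s + t)) 0 = \<phi>' (\<gamma> s) 0 * \<phi>' (\<gamma> t) 0" for s t
    by (simp add: \<gamma>_add hom'(2)[OF \<gamma>C \<gamma>C] del: mult_product_group) simp
  ultimately obtain c where c: "\<And>t. \<phi>' (\<gamma> t) 0 = cis (c * t)"
    using continuous_hom_real_circle[OF cont[of 0]] by blast
  \<comment> \<open>At time 1 the path is at the image of \<open>a0\<close>, which \<phi>' sends to
    the image of \<open>\<phi> a0\<close>, where the time coordinate is 1. So the time coordinate of
    the image path winds an integral number k of times.\<close>
  have "cis c = 1" using c[of 1] eq[OF a0] by (simp add: \<gamma>1)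
  then have "cos c = 1" by (simp add: complex_eq_iff)
  then obtain k :: int where k: "c = 2 * pi * of_int k" by (auto simp: cos_one_2pi_int mult_ac)
  have "\<psi> m (\<phi> a0) = \<psi> m a0 powi k" for m
  proof -
    \<comment> \<open>The time of \<open>\<phi>' (\<gamma> t)\<close> agrees with k t modulo 1, so
      removing the motion at speed k leaves a value of \<open>\<psi> m\<close>. These values form a
      finite set because the group is profinite; hence the continuous \<open>D\<close> is constant.
      Its values at 0 and 1 give the claim.\<close>
    define D where "D t = \<phi>' (\<gamma> t) (Suc m) * cis (- (of_int k * t * w m))" for t
    have contD: "continuous_on UNIV D" unfolding D_def by (intro continuous_intros cont)
    have "D t \<in> \<psi> m ` carrier G" for t
    proof -
      obtain s a where sa: "a \<in> carrier G" "\<phi>' (\<gamma> t) = e s a"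
        using hom'(1)[OF \<gamma>C, of t] by (auto simp: C_def)
      have "cis (2 * pi * s) = cis (2 * pi * of_int k * t)" using c[of t] sa k by (simp add: mult_ac)
      then have "cis (2 * pi * s - 2 * pi * of_int k * t) = 1" by (simp flip: cis_divide)
      then have "cos (2 * pi * s - 2 * pi * of_int k * t) = 1" by (simp add: complex_eq_iff)
      then obtain j :: int where j: "2 * pi * s - 2 * pi * of_int k * t = of_int j * 2 * pi"
        by (auto simp: cos_one_2pi_int)
      have "2 * pi * (s - of_int k * t - of_int j) = 0" using j by (simp add: algebra_simps)
      then have s: "s = of_int k * t + of_int j" by simp
      have "D t = cis (s * w m + - (of_int k * t * w m)) * \<psi> m a"
        unfolding D_def sa(2) by (simp only: e_simps cis_mult[symmetric] mult_ac)
      also have "s * w m + - (of_int k * t * w m) = of_int j * w m" unfolding s by (simp add: distrib_right)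
      also have "cis (of_int j * w m) * \<psi> m a = \<psi> m (a0 [^] j \<otimes> a)"
        using wj character_simps(3)[OF \<psi>] a0 sa(1) by simp
      finally show ?thesis using a0 sa(1) by blast
    qed
    then have "range D \<subseteq> \<psi> m ` carrier G" by blast
    then have "finite (range D)" using profinite_character_finite[OF prof \<psi>] by (rule finite_subset)
    then have "D constant_on UNIV" using continuous_finite_range_constant[OF connected_UNIV contD] by simp
    then have "D 1 = D 0" unfolding constant_on_def by auto
    also have "D 0 = 1" using character_simps(5)[OF \<psi>] by (simp add: D_def \<gamma>0)
    finally have "\<psi> m (\<phi> a0) * cis (- (of_int k * w m)) = 1" by (simp add: D_def \<gamma>1 eq[OF a0])
    then have "\<psi> m (\<phi> a0) * (cis (- (of_int k * w m)) * cis (of_int k * w m)) = cis (of_int k * w m)"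
      by (simp only: mult.assoc[symmetric] mult_1)
    then have "\<psi> m (\<phi> a0) = cis (of_int k * w m)" by (simp add: cis_mult)
    then show ?thesis using wj[of k m] character_simps(4)[OF \<psi> a0] by simp
  qed
  then show thesis by (rule that)
qed

text \<open>By the Baire category theorem.\<close>

lemma torsion_image_exponent:
  assumes \<psi>: "\<And>n::nat. \<psi> n \<in> characters"
    and torsion: "\<And>a. a \<in> carrier G \<Longrightarrow> \<exists>k::nat. k > 0 \<and> (\<forall>n. \<psi> n a ^ k = 1)"
  obtains K :: nat where "K > 0" "\<And>a n. a \<in> carrier G \<Longrightarrow> \<psi> n a ^ K = 1"
proof -
  define C where "C k = {a \<in> topspace T. \<forall>n. \<psi> n a ^ k = 1}" for k :: nat
  have closed: "closedin T (C k)" for k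
  proof -
    have "closedin T {a \<in> topspace T. \<psi> n a ^ k \<in> {1}}" for n
    proof (rule closedin_continuous_map_preimage)
      have "continuous_map T euclidean (\<psi> n)" using \<psi>[of n] by (simp add: continuous_hom_def continuous_map_in_subtopology)
      then show "continuous_map T euclidean (\<lambda>a. \<psi> n a ^ k)"
        by (rule continuous_map_euclidean_compose) (intro continuous_intros)
    qed simp
    then have "closedin T (\<Inter>n. {a \<in> topspace T. \<psi> n a ^ k \<in> {1}})" by (intro closedin_INT) auto
    moreover have "C k = (\<Inter>n. {a \<in> topspace T. \<psi> n a ^ k \<in> {1}})" by (auto simp: C_def)
    ultimately show ?thesis by simp
  qed
  have "\<exists>k>0. T interior_of C k \<noteq> {}"
  proof (rule ccontr)
    assume no: "\<not> (\<exists>k>0. T interior_of C k \<noteq> {})"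
    have "T interior_of \<Union>(C ` {0<..}) = {}"
    proof (rule Baire_category_alt)
      show "completely_metrizable_space T \<or> locally_compact_space T \<and> regular_space T"
        using compact Hausdorff by (simp add: compact_imp_locally_compact_space compact_Hausdorff_imp_regular_space)
      show "closedin T X \<and> T interior_of X = {}" if X: "X \<in> C ` {0<..}" for X
      proof -
        obtain k where "k > 0" "X = C k" using X by auto
        then show ?thesis using closed no by blast
      qed
    qed simp
    moreover have "\<Union>(C ` {0<..}) = topspace T" using torsion by (auto simp: C_def topspace_eq)
    ultimately show False using one_closed by (simp add: interior_of_topspace topspace_eq[symmetric]) 
  qed
  then obtain k u where k: "k > 0" "u \<in> T interior_of C k" by blast
  have u: "u \<in> carrier G" "u \<in> C k" using k(2) interior_of_subset[of T "C k"] by (auto simp: C_def topspace_eq)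
  \<comment> \<open>Moving the interior to the identity keeps the exponent k, because
    \<open>u\<close> itself lies in \<open>C k\<close>.\<close>
  define V where "V = (\<lambda>x. inv u \<otimes> x) ` (T interior_of C k)"
  have V: "openin T V" "\<one> \<in> V"
    using openin_translate[OF inv_closed[OF u(1)] openin_interior_of] k(2) u(1) by (auto simp: V_def image_iff intro!: bexI[of _ u])
  have Vk: "\<psi> n v ^ k = 1" if v: "v \<in> V" for v n
  proof -
    obtain x where x: "x \<in> C k" "v = inv u \<otimes> x"
      using v interior_of_subset[of T "C k"] by (auto simp: V_def)
    then have "x \<in> carrier G" by (simp add: C_def topspace_eq)
    then have "\<psi> n v = inverse (\<psi> n u) * \<psi> n x" using character_simps(3,6)[OF \<psi>] u(1) x(2) by simp
    then show ?thesis using x(1) u(2) by (simp add: power_mult_distrib power_inverse C_def)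
  qed
  obtain bs where bs: "bs \<noteq> []" "set bs \<subseteq> carrier G"
    "\<And>x. x \<in> carrier G \<Longrightarrow> \<exists>b\<in>set bs. \<exists>v\<in>V. x = b \<otimes> v"
    by (rule finite_translates_cover[OF V]) (rule that)
  have "\<forall>a. \<exists>k::nat. a \<in> carrier G \<longrightarrow> k > 0 \<and> (\<forall>n. \<psi> n a ^ k = 1)" using torsion by blast
  then obtain o' where o': "\<And>a. a \<in> carrier G \<Longrightarrow> o' a > (0::nat) \<and> (\<forall>n. \<psi> n a ^ o' a = 1)" by metis
  \<comment> \<open>Finitely many translates of \<open>V\<close> cover the group. The factor k takes
    care of \<open>V\<close>, the product of the exponents takes care of the centres.\<close>
  define K where "K = k * (\<Prod>b\<in>set bs. o' b)"
  have "K > 0" using k(1) o' bs(2) by (auto simp: K_def intro!: prod_pos)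
  moreover have "\<psi> n a ^ K = 1" if a: "a \<in> carrier G" for a n
  proof -
    obtain b v where b: "b \<in> set bs" "v \<in> V" "a = b \<otimes> v" using bs(3)[OF a] by blast
    have G: "b \<in> carrier G" "v \<in> carrier G"
      using b bs(2) openin_subset[OF V(1)] by (auto simp: topspace_eq)
    have "o' b dvd K" using b(1) unfolding K_def by (intro dvd_mult dvd_prod_eqI) auto
    then obtain i where i: "K = o' b * i" by (rule dvdE)
    have "k dvd K" by (simp add: K_def)
    then obtain j where j: "K = k * j" by (rule dvdE)
    have "\<psi> n b ^ K = 1" unfolding i power_mult using o'[OF G(1)] by simp
    moreover have "\<psi> n v ^ K = 1" unfolding j power_mult using Vk[OF b(2)] by simp
    ultimately show ?thesis using b(3) character_simps(3)[OF \<psi> G] by (simp add: power_mult_distrib)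
  qed
  ultimately show thesis by (rule that)
qed

text \<open>\<open>solenoid_extension\<close> gives an exponent for each point. So \<phi> descends
  to the image \<open>H\<close> of \<open>G\<close> in the infinite torus, where it acts on every
  element by a power, and the algebraic results produce one exponent for all of
  \<open>H\<close>.\<close>

lemma extensible_countable_characters:
  assumes prof: "profinite G T" and \<phi>: "\<phi> \<in> continuous_hom G T G T" and \<psi>: "\<And>n::nat. \<psi> n \<in> characters"
    and ext: "\<And>(B :: (nat \<Rightarrow> complex) monoid) U \<theta>. compact_abelian_group B U \<Longrightarrow>
      \<theta> \<in> continuous_hom G T B U \<Longrightarrow> extensible_along G B U \<theta> \<phi>"
  obtains n :: int where "\<And>a m. a \<in> carrier G \<Longrightarrow> \<psi> m (\<phi> a) = \<psi> m a powi n"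
proof -
  have \<phi>G: "\<phi> a \<in> carrier G" and \<phi>_mult: "b \<in> carrier G \<Longrightarrow> \<phi> (a \<otimes> b) = \<phi> a \<otimes> \<phi> b" if "a \<in> carrier G" for a b
    using \<phi> that by (auto simp: continuous_hom_def hom_def)
  interpret W: compact_abelian_group infinite_torus infinite_torus_topology
    by (rule compact_abelian_group_infinite_torus)
  define \<Theta> where "\<Theta> a n = \<psi> n a" for a n
  have \<Theta>: "\<Theta> \<in> hom G infinite_torus"
    using character_simps(1,3)[OF \<psi>] by (auto simp: hom_def \<Theta>_def)
  define H where "H = \<Theta> ` carrier G"
  have H: "subgroup H infinite_torus"
    unfolding H_def using group_hom.img_is_subgroup[of G infinite_torus \<Theta>] \<Theta> is_group W.is_group
    by (simp add: group_hom_def group_hom_axioms_def)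
  let ?H = "infinite_torus\<lparr>carrier := H\<rparr>"
  have HW: "H \<subseteq> carrier infinite_torus" by (rule subgroup.subset[OF H])
  interpret H: comm_group ?H
    by (rule group.group_comm_groupI[OF subgroup.subgroup_is_group[OF H W.is_group]])
      (use W.m_comm HW in auto)
  have pow: "(\<Theta> a [^]\<^bsub>?H\<^esub> (k::int)) n = \<psi> n a powi k" if "a \<in> carrier G" for a k n
  proof -
    have "\<Theta> a \<in> H" using that by (simp add: H_def)
    then show ?thesis
      using W.int_pow_consistent[OF H, of "\<Theta> a" k] infinite_torus_int_pow[of "\<Theta> a" k n] HW by (auto simp: \<Theta>_def)
  qed
  have pw: "\<exists>k::int. \<forall>n. \<psi> n (\<phi> a) = \<psi> n a powi k" if "a \<in> carrier G" for a
    by (rule solenoid_extension[where \<psi> = \<psi>, OF prof \<psi> that \<phi>G ext]) blast+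
  define s where "s y = (SOME a. a \<in> carrier G \<and> \<Theta> a = y)" for y
  have s: "s y \<in> carrier G \<and> \<Theta> (s y) = y" if "y \<in> H" for y
  proof -
    have "\<exists>a. a \<in> carrier G \<and> \<Theta> a = y" using that by (auto simp: H_def)
    then show ?thesis unfolding s_def by (rule someI_ex)
  qed
  \<comment> \<open>An element killed by all the characters is sent by \<phi> to a power of a
    trivial image, so \<phi> preserves the kernel and induces a map on \<open>H\<close>.\<close>
  have wd: "\<Theta> (\<phi> a) = \<Theta> (\<phi> b)" if ab: "a \<in> carrier G" "b \<in> carrier G" "\<Theta> a = \<Theta> b" for a b
  proof
    fix n
    have c: "a \<otimes> inv b \<in> carrier G" using ab by simp
    obtain k :: int where "\<psi> n (\<phi> (a \<otimes> inv b)) = \<psi> n (a \<otimes> inv b) powi k" using pw[OF c] by blast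
    also have "\<psi> n a = \<psi> n b" using fun_cong[OF ab(3), of n] by (simp add: \<Theta>_def)
    then have "\<psi> n (a \<otimes> inv b) = 1"
      using ab(1,2) character_simps(2,3,6)[OF \<psi>] by simp
    finally have "\<psi> n (\<phi> (a \<otimes> inv b)) = 1" by simp
    then have "\<psi> n (\<phi> (a \<otimes> inv b)) * \<psi> n (\<phi> b) = \<psi> n (\<phi> b)" by simp
    then have "\<psi> n (\<phi> (a \<otimes> inv b \<otimes> b)) = \<psi> n (\<phi> b)"
      using character_simps(3)[OF \<psi>] \<phi>_mult[OF c ab(2)] \<phi>G[OF c] \<phi>G[OF ab(2)] by simp
    then show "\<Theta> (\<phi> a) n = \<Theta> (\<phi> b) n" using ab(1,2) by (simp add: \<Theta>_def m_assoc)
  qed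
  define f where "f y = \<Theta> (\<phi> (s y))" for y
  have f\<Theta>: "f (\<Theta> a) = \<Theta> (\<phi> a)" if "a \<in> carrier G" for a
    unfolding f_def using s[of "\<Theta> a"] that by (intro wd) (auto simp: H_def)
  have f: "f \<in> hom ?H ?H"
  proof (rule homI)
    fix x y assume "x \<in> carrier ?H" "y \<in> carrier ?H"
    then obtain a b where ab: "a \<in> carrier G" "x = \<Theta> a" "b \<in> carrier G" "y = \<Theta> b" by (auto simp: H_def)
    have "f (x \<otimes>\<^bsub>?H\<^esub> y) = f (\<Theta> (a \<otimes> b))" using hom_mult[OF \<Theta> ab(1,3)] ab by simp
    also have "\<dots> = \<Theta> (\<phi> a) \<otimes>\<^bsub>infinite_torus\<^esub> \<Theta> (\<phi> b)"
      using f\<Theta>[of "a \<otimes> b"] ab \<phi>_mult hom_mult[OF \<Theta>] \<phi>G by simp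
    finally show "f (x \<otimes>\<^bsub>?H\<^esub> y) = f x \<otimes>\<^bsub>?H\<^esub> f y" using ab f\<Theta> by simp
  qed (auto simp: f\<Theta> \<phi>G H_def)
  have pwH: "\<exists>k::int. f y = y [^]\<^bsub>?H\<^esub> k" if y: "y \<in> carrier ?H" for y
  proof -
    obtain a where a: "a \<in> carrier G" "y = \<Theta> a" using y by (auto simp: H_def)
    obtain k :: int where k: "\<forall>n. \<psi> n (\<phi> a) = \<psi> n a powi k" using pw[OF a(1)] by blast
    have "f y = y [^]\<^bsub>?H\<^esub> k"
      using k pow[OF a(1), of k] by (auto simp: a f\<Theta>[OF a(1)] \<Theta>_def[of "\<phi> a"])
    then show ?thesis by blast
  qed
  \<comment> \<open>Either \<open>H\<close> has an element of infinite order, or it is torsion and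
    the category argument bounds its exponent. Each case has its own algebraic lemma.\<close>
  have "\<exists>n::int. \<forall>y\<in>carrier ?H. f y = y [^]\<^bsub>?H\<^esub> n"
  proof (cases "\<exists>y\<in>carrier ?H. \<forall>k::int. y [^]\<^bsub>?H\<^esub> k = \<one>\<^bsub>?H\<^esub> \<longrightarrow> k = 0")
    case True
    then obtain y where y: "y \<in> carrier ?H" "\<And>k::int. y [^]\<^bsub>?H\<^esub> k = \<one>\<^bsub>?H\<^esub> \<Longrightarrow> k = 0" by blast
    show ?thesis by (rule H.pointwise_power_hom_infinite_order[OF f pwH y]) blast+
  next
    case False
    have tor: "\<exists>k::nat. k > 0 \<and> (\<forall>n. \<psi> n a ^ k = 1)" if a: "a \<in> carrier G" for a
    proof -
      obtain k :: int where k: "\<Theta> a [^]\<^bsub>?H\<^esub> k = \<one>\<^bsub>?H\<^esub>" "k \<noteq> 0" using False a by (auto simp: H_def)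
      have "\<psi> n a ^ nat \<bar>k\<bar> = 1" for n
      proof -
        have "\<psi> n a powi k = 1" using pow[OF a, of k n] unfolding k(1) by simp
        then show ?thesis by (cases "k \<ge> 0") (auto simp: power_int_def abs_if inverse_eq_1_iff power_inverse)
      qed
      then show ?thesis using k(2) by (intro exI[of _ "nat \<bar>k\<bar>"]) auto
    qed
    obtain K :: nat where K: "K > 0" "\<And>a n. a \<in> carrier G \<Longrightarrow> \<psi> n a ^ K = 1"
      by (rule torsion_image_exponent[where \<psi> = \<psi>, OF \<psi> tor]) blast+
    have exp: "y [^]\<^bsub>?H\<^esub> K = \<one>\<^bsub>?H\<^esub>" if y: "y \<in> carrier ?H" for y
    proof -
      obtain a where a: "a \<in> carrier G" "y = \<Theta> a" using y by (auto simp: H_def)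
      have "y [^]\<^bsub>?H\<^esub> int K = \<one>\<^bsub>?H\<^esub>"
        using pow[OF a(1), of "int K"] K(2)[OF a(1)] by (auto simp: a)
      then show ?thesis by (simp only: int_pow_int)
    qed
    show ?thesis by (rule H.pointwise_power_hom_exponent[OF f pwH K(1) exp]) blast+
  qed
  then obtain n :: int where n: "\<And>y. y \<in> carrier ?H \<Longrightarrow> f y = y [^]\<^bsub>?H\<^esub> n" by blast
  have "\<psi> m (\<phi> a) = \<psi> m a powi n" if a: "a \<in> carrier G" for a m
  proof -
    have "\<Theta> (\<phi> a) = \<Theta> a [^]\<^bsub>?H\<^esub> n" using n[of "\<Theta> a"] f\<Theta>[OF a] a by (simp add: H_def)
    then have "\<Theta> (\<phi> a) m = \<psi> m a powi n" using pow[OF a] by simp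
    then show ?thesis by (simp add: \<Theta>_def)
  qed
  then show thesis by (rule that)
qed

text \<open>If no integer works, each n is refuted by some character. Enumerated by
  \<open>int_decode\<close>, these characters form a sequence with a common exponent n, which
  contradicts the character chosen to refute n.\<close>

lemma profinite_extensible_int_pow:
  assumes prof: "profinite G T" and \<phi>: "\<phi> \<in> continuous_hom G T G T"
    and ext: "\<And>(B :: (nat \<Rightarrow> complex) monoid) U \<theta>. compact_abelian_group B U \<Longrightarrow>
      \<theta> \<in> continuous_hom G T B U \<Longrightarrow> extensible_along G B U \<theta> \<phi>"
  shows "\<exists>n::int. \<forall>a\<in>carrier G. \<phi> a = a [^] n"
proof (rule ccontr)
  assume no: "\<nexists>n::int. \<forall>a\<in>carrier G. \<phi> a = a [^] n"
  have "\<exists>\<eta>\<in>characters. \<exists>a\<in>carrier G. \<eta> (\<phi> a) \<noteq> \<eta> a powi n" for n :: int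
  proof -
    obtain a where a: "a \<in> carrier G" "\<phi> a \<noteq> a [^] n" using no by blast
    have "\<phi> a \<in> carrier G" using \<phi> a(1) by (auto simp: continuous_hom_def hom_def)
    then obtain \<eta> where \<eta>: "\<eta> \<in> characters" "\<eta> (\<phi> a) \<noteq> \<eta> (a [^] n)"
      using eq_if_characters_eq[of "\<phi> a" "a [^] n"] a by auto
    then show ?thesis using a(1) character_simps(4)[OF \<eta>(1) a(1)] by auto
  qed
  then obtain \<eta> where \<eta>: "\<And>n::int. \<eta> n \<in> characters \<and> (\<exists>a\<in>carrier G. \<eta> n (\<phi> a) \<noteq> \<eta> n a powi n)" by metis
  define \<psi> where "\<psi> i = \<eta> (int_decode i)" for i
  have \<psi>: "\<psi> i \<in> characters" for i using \<eta> by (simp add: \<psi>_def)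
  obtain n :: int where n: "\<And>a m. a \<in> carrier G \<Longrightarrow> \<psi> m (\<phi> a) = \<psi> m a powi n"
    by (rule extensible_countable_characters[where \<psi> = \<psi>, OF prof \<phi> \<psi> ext]) blast+
  obtain a where "a \<in> carrier G" "\<eta> n (\<phi> a) \<noteq> \<eta> n a powi n" using \<eta> by blast
  then show False using n[of a "int_encode n"] by (simp add: \<psi>_def)
qed

end

theorem theoremC:
  fixes A :: "'a monoid" and S :: "'a topology"
  assumes "compact_abelian_group A S"
  shows "((UNIV :: real set) \<lesssim> (UNIV :: 'b set) \<longrightarrow>
      (\<forall>\<phi>. \<phi> \<in> continuous_hom A S A S \<and> extensible_cab TYPE('b) A S \<phi> \<longleftrightarrow>
        (\<exists>n :: int. \<forall>a \<in> carrier A. \<phi> a = a [^]\<^bsub>A\<^esub> n))) \<and>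
    (\<not> profinite A S \<longrightarrow>
      (\<forall>\<phi>. \<phi> \<in> continuous_hom A S A S \<and> extensible_tori A S \<phi> \<longleftrightarrow>
        (\<exists>n :: int. \<forall>a \<in> carrier A. \<phi> a = a [^]\<^bsub>A\<^esub> n))) \<and>
    (profinite A S \<longrightarrow>
      (\<forall>\<phi>. \<phi> \<in> continuous_hom A S A S \<and> extensible_tori A S \<phi> \<longleftrightarrow>
        (\<exists>n \<in> profinite_integers. \<forall>a \<in> carrier A. \<phi> a = profinite_scale A S n a)))"
proof -
  interpret A: compact_abelian_group A S by (rule assms)
  have \<phi>A: "\<phi> a \<in> carrier A" if "\<phi> \<in> continuous_hom A S A S" "a \<in> carrier A" for \<phi> a
    using that by (auto simp: continuous_hom_def hom_def)
  have scaling: "\<phi> \<in> continuous_hom A S A S" "extensible_cab TYPE('b) A S \<phi>" "extensible_tori A S \<phi>"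
    if n: "\<forall>a\<in>carrier A. \<phi> a = a [^]\<^bsub>A\<^esub> (n::int)" for \<phi> n
  proof -
    show "\<phi> \<in> continuous_hom A S A S"
      by (rule A.continuous_homI[OF A.int_pow_continuous_hom[of n]]) (simp add: n)
    show "extensible_cab TYPE('b) A S \<phi>"
      unfolding extensible_cab_def using A.int_pow_extensible n by blast
    show "extensible_tori A S \<phi>"
      unfolding extensible_tori_def using A.int_pow_extensible[OF compact_abelian_group_torus] n by blast
  qed
  have nonprof: "\<exists>n::int. \<forall>a\<in>carrier A. \<phi> a = a [^]\<^bsub>A\<^esub> n"
    if np: "\<not> profinite A S" and \<phi>: "\<phi> \<in> continuous_hom A S A S" "extensible_tori A S \<phi>" for \<phi>
  proof -
    obtain \<psi> where \<psi>: "\<psi> \<in> carrier A.dual" "\<And>k::int. \<psi> [^]\<^bsub>A.dual\<^esub> k = \<one>\<^bsub>A.dual\<^esub> \<Longrightarrow> k = 0"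
      using A.infinite_order_character[OF np] by blast
    show ?thesis by (rule A.extensible_tori_int_pow[OF \<phi> \<psi>]) blast+
  qed
  have cab: "\<exists>n::int. \<forall>a\<in>carrier A. \<phi> a = a [^]\<^bsub>A\<^esub> n"
    if big: "(UNIV :: real set) \<lesssim> (UNIV :: 'b set)" and \<phi>: "\<phi> \<in> continuous_hom A S A S"
      and ext: "extensible_cab TYPE('b) A S \<phi>" for \<phi>
  proof -
    obtain f :: "(nat \<Rightarrow> complex) \<Rightarrow> 'b" where f: "inj f"
      using inj_sequences_of_complex[OF big] by blast
    have along: "extensible_along A B U \<theta> \<phi>"
      if "compact_abelian_group B U" "\<theta> \<in> continuous_hom A S B U"
      for B :: "(nat \<Rightarrow> complex) monoid" and U \<theta>
      using extensible_cab_along[OF ext f that \<phi>A[OF \<phi>]] .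
    show ?thesis
    proof (cases "profinite A S")
      case True
      show ?thesis by (rule A.profinite_extensible_int_pow[OF True \<phi> along])
    next
      case False
      \<comment> \<open>Finite-dimensional tori are also carried by sequences of complex numbers, so
        they are among the targets just transported.\<close>
      have "extensible_tori A S \<phi>"
        unfolding extensible_tori_def using along[OF compact_abelian_group_torus] by blast
      then show ?thesis by (rule nonprof[OF False \<phi>])
    qed
  qed
  have prof: "\<phi> \<in> continuous_hom A S A S \<and> extensible_tori A S \<phi> \<longleftrightarrow>
      (\<exists>n \<in> profinite_integers. \<forall>a \<in> carrier A. \<phi> a = profinite_scale A S n a)"
    if prof: "profinite A S" for \<phi>
  proof
    assume "\<phi> \<in> continuous_hom A S A S \<and> extensible_tori A S \<phi>"
    then obtain n where "n \<in> profinite_integers" "\<And>a. a \<in> carrier A \<Longrightarrow> \<phi> a = profinite_scale A S n a"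
      using A.extensible_tori_profinite_scale[OF prof] by blast
    then show "\<exists>n \<in> profinite_integers. \<forall>a \<in> carrier A. \<phi> a = profinite_scale A S n a" by blast
  qed (use A.profinite_scale_extensible[OF prof] in blast)
  show ?thesis
  proof (intro conjI impI allI)
    fix \<phi> assume "(UNIV :: real set) \<lesssim> (UNIV :: 'b set)"
    from cab[OF this] show "\<phi> \<in> continuous_hom A S A S \<and> extensible_cab TYPE('b) A S \<phi> \<longleftrightarrow>
        (\<exists>n :: int. \<forall>a \<in> carrier A. \<phi> a = a [^]\<^bsub>A\<^esub> n)"
      using scaling(1,2) by metis
  next
    fix \<phi> assume "\<not> profinite A S"
    from nonprof[OF this] show "\<phi> \<in> continuous_hom A S A S \<and> extensible_tori A S \<phi> \<longleftrightarrow>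
        (\<exists>n :: int. \<forall>a \<in> carrier A. \<phi> a = a [^]\<^bsub>A\<^esub> n)"
      using scaling(1,3) by metis
  qed (rule prof)
qed

end
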